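(* Let $p\in C^1[0,\infty)$, $p(0)=0$, $p'(\varrho)>0$ for all $\varrho>0$. Then any numerical solution $(\varrho^k,\mathbf u^k)_{k=1}^N$ (see context) satisfies for all $m=1,\dots,N$: 1. (Mass conservation) $\varrho^m>0$ and $$\int_\Omega\varrho^m dx+\Delta t\sum_{k=1}^m\sum_{\sigma\in\mathcal E^{\rm out}}\int_\sigma\varrho^k\mathbf u_{B,\sigma}\cdot\mathbf n_\sigma dS_x=\int_\Omega\varrho^0dx-\Delta t\sum_{k=1}^m\sum_{\sigma\in\mathcal E^{\rm in}}\int_\sigma\varrho_B\mathbf u_{B,\sigma}\cdot\mathbf n_\sigma dS_x.$$ 2. (Energy balance) There exist $\overline\varrho^{k-1,k}\in Q(\Omega)$ with $\overline\varrho^{k-1,k}_K\in[\min\{\varrho_K^{k-1},\varrho_K^k\},\max\{\varrho_K^{k-1},\varrho_K^k\}]$, $K\in\mathcal T$, and numbers $\overline\varrho^{k,\sigma}\in[\min\{\varrho_\sigma^{k,-},\varrho_\sigma^{k,+}\},\max\{\varrho_\sigma^{k,-},\varrho_\sigma^{k,+}\}]$, $\sigma\in\mathcal E_{\rm int}$, $k=1,\dots,N$, such that $$\int_\Omega\tfrac12\varrho^m|\widehat{\mathbf v}^m|^2dx+\int_\Omega H_h(\varrho^m)dx+\Delta t\sum_{k=1}^m\int_\Omega\mathbb S(\nabla_h\mathbf v^k):\nabla_h\mathbf v^kdx$$ $$+\tfrac12\sum_{k=1}^m\int_\Omega\Big(\varrho^{k-1}|\widehat{\mathbf v}^k-\widehat{\mathbf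 v}^{k-1}|^2+H_h''(\overline\varrho^{k-1,k})|\varrho^k-\varrho^{k-1}|^2\Big)dx$$ $$+\tfrac{\Delta t}2\sum_{k=1}^m\sum_{\sigma\in\mathcal E_{\rm int}}\int_\sigma|\mathrm{Up}_\sigma(\varrho^k,\mathbf u^k)|\,\big|[[\widehat{\mathbf v}^k]]_\sigma\big|^2dS_x+\kappa h^\omega\Delta t\sum_{k=1}^m\sum_{\sigma\in\mathcal E_{\rm int}}\int_\sigma[[\varrho^k]]_\sigma[[H_h'(\varrho^k)]]_\sigma dS_x$$ $$+\tfrac{\Delta t}2\sum_{k=1}^m\sum_{\sigma\in\mathcal E_{\rm int}}\int_\sigma H_h''(\overline\varrho^{k,\sigma})[[\varrho^k]]_\sigma^2|\mathbf u^k_\sigma\cdot\mathbf n_\sigma|dS_x+\tfrac{\Delta t}2\sum_{k=1}^m\sum_{\sigma\in\mathcal E^{\rm out}}\int_\sigma\varrho^k\mathbf u_{B,\sigma}\cdot\mathbf n_\sigma|\widehat{\mathbf v}^k|^2dS_x$$ $$+\Delta t\sum_{k=1}^m\sum_{\sigma\in\mathcal E^{\rm out}}\int_\sigma H_h(\varrho^k)\mathbf u_{B,\sigma}\cdot\mathbf n_\sigma dS_x+\Delta t\sum_{k=1}^m\sum_{\sigma\in\mathcal E^{\rm in}}\int_\sigma E_{H_h}(\varrho_B|\varrho^k)|\mathbf u_{B,\sigma}\cdot\mathbf n_\sigma|dS_x$$ $$=\int_\Omega\Big[\tfrac12\varrho^0|\widehat{\mathbf v}^0|^2+H_h(\varrho^0)\Big]dx+\Delta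 t\sum_{k=1}^m\sum_{\sigma\in\mathcal E^{\rm in}}\int_\sigma H_h(\varrho_B)|\mathbf u_{B,\sigma}\cdot\mathbf n_\sigma|dS_x$$ $$-\Delta t\sum_{k=1}^m\int_\Omega\mathbb S(\nabla_h\mathbf u_B):\nabla_h\mathbf v^kdx-\Delta t\sum_{k=1}^m\int_\Omega p_h(\varrho^k)\mathrm{div}_h\mathbf u_Bdx$$ $$-\Delta t\sum_{k=1}^m\int_\Omega\varrho^k\widehat{\mathbf u}^k\cdot\nabla_h\mathbf u_B\cdot\widehat{\mathbf v}^kdx-\tfrac{\Delta t}2\sum_{k=1}^m\sum_{\sigma\in\mathcal E^{\rm in}}\int_\sigma\varrho_B\mathbf u_{B,\sigma}\cdot\mathbf n_\sigma|\widehat{\mathbf v}^k|^2dS_x.$$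
   Context: **Data.** $\Omega\subset\mathbb R^3$ is a bounded polyhedral (Lipschitz) domain with outer unit normal $\mathbf n$, $T>0$, $\mu>0$, $\lambda+\frac23\mu>0$, and $\mathbb S(A)=\mu A+(\mu+\lambda)\,\mathrm{tr}(A)\,\mathbb I$, so that $\mathbb S(\nabla\mathbf u):\nabla\phi=\mu\nabla\mathbf u:\nabla\phi+(\mu+\lambda)\,\mathrm{div}\,\mathbf u\,\mathrm{div}\,\phi$. Initial and boundary data: $0<\mathfrak r_0\in C(\overline\Omega)$, $\mathfrak u_0\in C(\overline\Omega;\mathbb R^3)$, $0<\mathfrak r_B\in C^1(\overline\Omega)$, $\mathfrak u_B\in C^2(\overline\Omega;\mathbb R^3)$. $\Gamma^{\rm out}=\overline{\{x\in\partial\Omega:\ \mathfrak u_B(x)\cdot\mathbf n(x)\ge0\text{ or }\mathbf n(x)\text{ is not defined}\}}$, $\Gamma^{\rm in}=\partial\Omega\setminus\Gamma^{\rm out}$. Convention: $\mathbf a\cdot\nabla\mathbf b\cdot\mathbf c=\sum_{i,j}a_j\partial_jb_ic_i$. **Pressure functions.** $H(\varrho)=\varrho\int_1^\varrho\frac{p(z)}{z^2}dz$, $p_h(\varrho)=p(\varrho)+\tilde\kappa h^\eta\varrho^2$, $H_h(\varrho)=H(\varrho)+\tilde\kappa h^\eta\varrho^2$, with $\kappa,\tilde\kappa\in\{0,1\}$, $\omega,\eta>0$; $E_B(\varrho|r)=B(\varrho)-B'(r)(\varrho-r)-B(r)$. **Mesh.** $\mathcal T=\mathcal T_h$ is a tetrahedral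 mesh of $\Omega$ (closed elements $K$), where the intersection of two distinct elements is empty, a common vertex, a common edge or a common face ($\sigma=K|L$); $\mathcal E$ is the set of faces, $\mathcal E(K)$ the faces of $K$, $\mathcal E_{\rm ext}$ the faces contained in $\partial\Omega$, $\mathcal E_{\rm int}=\mathcal E\setminus\mathcal E_{\rm ext}$. $h$ is the maximal element diameter and $\mathfrak h$ the minimal inradius; the meshes satisfy $h\le c\,\mathfrak h$ with $c$ independent of $h$. $\mathbf n_{\sigma,K}$ is the unit normal to $\sigma\in\mathcal E(K)$ outward to $K$; each $\sigma$ carries a fixed unit normal $\mathbf n_\sigma$ (outer normal of $\Omega$ if $\sigma\in\mathcal E_{\rm ext}$). **Spaces.** $Q(\Omega)$: functions constant on each $K$; $\Pi^Q[g]|_K=\widehat g|_K=\frac1{|K|}\int_Kg$. $V(\Omega)$ (Crouzeix–Raviart): functions affine on each $K$ with $\int_\sigma v|_K=\int_\sigma v|_L$ for every $\sigma=K|L\in\mathcal E_{\rm int}$; $V_0(\Omega)$: those with also $\int_\sigma v=0$ for $\sigma\in\mathcal E_{\rm ext}$. $v_\sigma=\frac1{|\sigma|}\int_\sigma v\,dS_x$; $\tilde v=\Pi^V[v]\in V(\Omega)$ is the element with $(\tilde v)_\sigma=v_\sigma$ for all $\sigma\in\mathcal E$. $\nabla_h,\mathrm{div}_h$ are element-wise operators. For $g\in Q(\Omega)$ and $\sigma\in\mathcal E_{\rm int}$, $g^\pm_\sigma=\lim_{\delta\to0+}g(x_\sigma\pm\delta\mathbf n_\sigma)$ ($x_\sigma$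 the gravity centre of $\sigma$), $[[g]]_\sigma=g^+_\sigma-g^-_\sigma$, $\{g\}_\sigma=\frac12(g^+_\sigma+g^-_\sigma)$, $\mathrm{Up}_\sigma(g,\mathbf u)=g^-_\sigma[\mathbf u_\sigma\cdot\mathbf n_\sigma]^++g^+_\sigma[\mathbf u_\sigma\cdot\mathbf n_\sigma]^-$, $[c]^+=\max\{c,0\}$, $[c]^-=\min\{c,0\}$. For $\sigma=K|L$, $F_{\sigma,K}(g,\mathbf u)=g^{\rm up}_\sigma\,\mathbf u_\sigma\cdot\mathbf n_{\sigma,K}$ with $g_\sigma^{\rm up}=g_K$ if $\mathbf u_\sigma\cdot\mathbf n_{\sigma,K}\ge0$ and $g_L$ otherwise (componentwise for vector $g$). In integrals over $\sigma\in\mathcal E(K)$ inside $\sum_K$, traces are taken from $K$. **Scheme.** $T=N\Delta t$, $\varrho^0=\Pi^Q[\mathfrak r_0]$, $\mathbf u^0=\Pi^V[\mathfrak u_0]$, $\varrho_B=\Pi^Q[\mathfrak r_B]$, $\mathbf u_B=\Pi^V[\mathfrak u_B]$, $\mathcal E^{\rm in}=\{\sigma\in\mathcal E_{\rm ext}:\mathbf u_{B,\sigma}\cdot\mathbf n_\sigma<0\}$, $\mathcal E^{\rm out}=\mathcal E_{\rm ext}\setminus\mathcal E^{\rm in}$; the mesh fits the boundary: $\overline{\Gamma^{\rm in}}=\bigcup_{\sigma\in\mathcal E^{\rm in}}\sigma$, $\overline{\Gamma^{\rm out}}=\bigcup_{\sigma\in\mathcal E^{\rm out}}\sigma$. $D_tz^k=(z^k-z^{k-1})/\Delta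 t$, $\mathbf v^k=\mathbf u^k-\mathbf u_B$ for $k=0,\dots,N$. A numerical solution is $(\varrho^k,\mathbf u^k)_{k=1}^N$ with $0<\varrho^k\in Q(\Omega)$, $\mathbf u^k\in V(\Omega;\mathbb R^3)$, $\mathbf v^k\in V_0(\Omega;\mathbb R^3)$ satisfying for $k=1,\dots,N$: for all $\phi\in Q(\Omega)$, $$\int_\Omega D_t\varrho^k\phi\,dx+\sum_{K}\sum_{\sigma\in\mathcal E(K)\cap\mathcal E_{\rm int}}\int_\sigma F_{\sigma,K}(\varrho^k,\mathbf u^k)\phi\,dS_x+\sum_{\sigma\in\mathcal E^{\rm out}}\int_\sigma\varrho^k\mathbf u_{B,\sigma}\cdot\mathbf n_\sigma\phi\,dS_x+\sum_{\sigma\in\mathcal E^{\rm in}}\int_\sigma\varrho_B\mathbf u_{B,\sigma}\cdot\mathbf n_\sigma\phi\,dS_x+\kappa h^\omega\sum_{\sigma\in\mathcal E_{\rm int}}\int_\sigma[[\varrho^k]]_\sigma[[\phi]]_\sigma dS_x=0,$$ and for all $\phi\in V_0(\Omega;\mathbb R^3)$, $$\int_\Omega D_t(\varrho^k\widehat{\mathbf v}^k)\cdot\widehat\phi\,dx+\sum_K\sum_{\sigma\in\mathcal E(K)\cap\mathcal E_{\rm int}}\int_\sigma F_{\sigma,K}(\varrho^k\widehat{\mathbf v}^k,\mathbf u^k)\cdot\widehat\phi\,dS_x+\sum_K\sum_{\sigma\in\mathcal E(K)}\int_\sigma\varrho^k\widehat{\mathbf u}^k\cdot\mathbf n_{\sigma,K}\,\mathbf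 u_B\cdot\widehat\phi\,dS_x$$ $$+\sum_{\sigma\in\mathcal E^{\rm out}}\int_\sigma\varrho^k\mathbf u_{B,\sigma}\cdot\mathbf n_\sigma\widehat{\mathbf v}^k\cdot\widehat\phi\,dS_x+\sum_{\sigma\in\mathcal E^{\rm in}}\int_\sigma\varrho_B\mathbf u_{B,\sigma}\cdot\mathbf n_\sigma\widehat{\mathbf v}^k\cdot\widehat\phi\,dS_x+\int_\Omega\big(\mathbb S(\nabla_h\mathbf u^k):\nabla_h\phi-p_h(\varrho^k)\mathrm{div}_h\phi\big)dx$$ $$+\kappa h^\omega\sum_{\sigma\in\mathcal E_{\rm int}}\int_\sigma[[\varrho^k]]_\sigma\{\widehat{\mathbf v}^k\}_\sigma\cdot[[\widehat\phi]]_\sigma dS_x=0.$$ *)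

theory Defs
  imports "HOL-Analysis.Analysis"
begin

section \<open>The domain and the data\<close>

type_synonym vec3 = "real^3"

text \<open>Near each boundary point, \<open>\<Omega>\<close> is the strict epigraph, in some direction \<open>e\<close>, of a Lipschitz
  function \<open>\<gamma>\<close> of the coordinates orthogonal to \<open>e\<close>.\<close>

definition lipschitz_boundary :: "vec3 set \<Rightarrow> bool" where
  "lipschitz_boundary \<Omega> \<longleftrightarrow>
     (\<forall>x\<in>frontier \<Omega>. \<exists>e r L (\<gamma> :: vec3 \<Rightarrow> real).
        norm e = 1 \<and> 0 < r \<and> lipschitz_on L {z. z \<bullet> e = 0} \<gamma> \<and>
        (\<forall>y\<in>ball x r. y \<in> \<Omega> \<longleftrightarrow> \<gamma> (y - (y \<bullet> e) *\<^sub>R e) < y \<bullet> e))"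

definition polyhedral_lipschitz_domain :: "vec3 set \<Rightarrow> bool" where
  "polyhedral_lipschitz_domain \<Omega> \<longleftrightarrow>
     open \<Omega> \<and> connected \<Omega> \<and> bounded \<Omega> \<and> \<Omega> \<noteq> {} \<and>
     (\<exists>P. finite P \<and> (\<forall>C\<in>P. polytope C) \<and> closure \<Omega> = \<Union>P) \<and>
     lipschitz_boundary \<Omega>"

text \<open>\<open>\<partial>\<Omega>\<close> has a tangent plane at \<open>x\<close>, with unit normal \<open>n\<close> pointing out of \<open>\<Omega>\<close>: every cone around
  \<open>- n\<close> (resp. \<open>n\<close>) of opening less than a half-space lies, near \<open>x\<close>, in \<open>\<Omega>\<close> (resp. outside
  the closure of \<open>\<Omega>\<close>).\<close>

definition outer_normal :: "vec3 set \<Rightarrow> vec3 \<Rightarrow> vec3 \<Rightarrow> bool" where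
  "outer_normal \<Omega> x n \<longleftrightarrow> x \<in> frontier \<Omega> \<and> norm n = 1 \<and>
     (\<forall>\<epsilon>>0. \<exists>r>0. \<forall>y\<in>ball x r.
        ((y - x) \<bullet> n < - \<epsilon> * norm (y - x) \<longrightarrow> y \<in> \<Omega>) \<and>
        (\<epsilon> * norm (y - x) < (y - x) \<bullet> n \<longrightarrow> y \<notin> closure \<Omega>))"

definition Gamma_out :: "vec3 set \<Rightarrow> (vec3 \<Rightarrow> vec3) \<Rightarrow> vec3 set" where
  "Gamma_out \<Omega> b =
     closure {x \<in> frontier \<Omega>. (\<exists>n. outer_normal \<Omega> x n \<and> 0 \<le> b x \<bullet> n) \<or> (\<nexists>n. outer_normal \<Omega> x n)}"

definition Gamma_in :: "vec3 set \<Rightarrow> (vec3 \<Rightarrow> vec3) \<Rightarrow> vec3 set" where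
  "Gamma_in \<Omega> b = frontier \<Omega> - Gamma_out \<Omega> b"

text \<open>\<open>C\<^sup>1\<close> and \<open>C\<^sup>2\<close> up to the boundary: the derivatives in the open set \<open>\<Omega>\<close> extend continuously
  to its closure.\<close>

definition C1_closure :: "vec3 set \<Rightarrow> (vec3 \<Rightarrow> 'b::real_normed_vector) \<Rightarrow> bool" where
  "C1_closure \<Omega> f \<longleftrightarrow> continuous_on (closure \<Omega>) f \<and>
     (\<exists>f' :: vec3 \<Rightarrow> vec3 \<Rightarrow>\<^sub>L 'b. continuous_on (closure \<Omega>) f' \<and>
        (\<forall>x\<in>\<Omega>. (f has_derivative blinfun_apply (f' x)) (at x)))"

definition C2_closure :: "vec3 set \<Rightarrow> (vec3 \<Rightarrow> 'b::real_normed_vector) \<Rightarrow> bool" where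
  "C2_closure \<Omega> f \<longleftrightarrow> continuous_on (closure \<Omega>) f \<and>
     (\<exists>f' :: vec3 \<Rightarrow> vec3 \<Rightarrow>\<^sub>L 'b. C1_closure \<Omega> f' \<and>
        (\<forall>x\<in>\<Omega>. (f has_derivative blinfun_apply (f' x)) (at x)))"


section \<open>Pressure and viscous stress\<close>

definition H_pot :: "(real \<Rightarrow> real) \<Rightarrow> real \<Rightarrow> real" where
  "H_pot p r = r * (LBINT z=1..ereal r. p z / z\<^sup>2)"

definition p_reg :: "(real \<Rightarrow> real) \<Rightarrow> real \<Rightarrow> real \<Rightarrow> real \<Rightarrow> real \<Rightarrow> real" where
  "p_reg p \<kappa>' \<eta> h r = p r + \<kappa>' * h powr \<eta> * r\<^sup>2"

definition H_reg :: "(real \<Rightarrow> real) \<Rightarrow> real \<Rightarrow> real \<Rightarrow> real \<Rightarrow> real \<Rightarrow> real" where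
  "H_reg p \<kappa>' \<eta> h r = H_pot p r + \<kappa>' * h powr \<eta> * r\<^sup>2"

definition bregman :: "(real \<Rightarrow> real) \<Rightarrow> real \<Rightarrow> real \<Rightarrow> real" where
  "bregman B s r = B s - deriv B r * (s - r) - B r"

definition stress :: "real \<Rightarrow> real \<Rightarrow> real^3^3 \<Rightarrow> real^3^3" where
  "stress \<mu> lam A = \<mu> *\<^sub>R A + ((\<mu> + lam) * trace A) *\<^sub>R mat 1"


section \<open>The mesh\<close>

definition tet_mesh :: "vec3 set \<Rightarrow> vec3 set set \<Rightarrow> bool" where
  "tet_mesh \<Omega> \<T> \<longleftrightarrow> triangulation \<T> \<and> (\<forall>K\<in>\<T>. 3 simplex K) \<and> \<Union>\<T> = closure \<Omega>"

definition faces_of :: "vec3 set \<Rightarrow> vec3 set set" where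
  "faces_of K = {\<sigma>. \<sigma> facet_of K}"

definition faces :: "vec3 set set \<Rightarrow> vec3 set set" where
  "faces \<T> = (\<Union>K\<in>\<T>. faces_of K)"

definition faces_ext :: "vec3 set \<Rightarrow> vec3 set set \<Rightarrow> vec3 set set" where
  "faces_ext \<Omega> \<T> = {\<sigma> \<in> faces \<T>. \<sigma> \<subseteq> frontier \<Omega>}"

definition faces_int :: "vec3 set \<Rightarrow> vec3 set set \<Rightarrow> vec3 set set" where
  "faces_int \<Omega> \<T> = faces \<T> - faces_ext \<Omega> \<T>"

definition mesh_size :: "vec3 set set \<Rightarrow> real" where
  "mesh_size \<T> = Max (diameter ` \<T>)"

definition inradius :: "vec3 set \<Rightarrow> real" where
  "inradius K = Sup {r. 0 < r \<and> (\<exists>x. cball x r \<subseteq> K)}"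

definition mesh_inradius :: "vec3 set set \<Rightarrow> real" where
  "mesh_inradius \<T> = Min (inradius ` \<T>)"

definition elem_normal :: "vec3 set \<Rightarrow> vec3 set \<Rightarrow> vec3" where
  "elem_normal K \<sigma> = (THE n. norm n = 1 \<and> (\<forall>x\<in>\<sigma>. \<forall>y\<in>\<sigma>. (y - x) \<bullet> n = 0) \<and>
                            (\<forall>x\<in>\<sigma>. \<forall>y\<in>K. (y - x) \<bullet> n \<le> 0))"

text \<open>An admissible choice \<open>\<nu>\<close> of the fixed normals \<open>n\<^sub>\<sigma>\<close>.\<close>

definition face_normals :: "vec3 set \<Rightarrow> vec3 set set \<Rightarrow> (vec3 set \<Rightarrow> vec3) \<Rightarrow> bool" where
  "face_normals \<Omega> \<T> \<nu> \<longleftrightarrow>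
     (\<forall>\<sigma>\<in>faces \<T>. norm (\<nu> \<sigma>) = 1 \<and> (\<forall>x\<in>\<sigma>. \<forall>y\<in>\<sigma>. (y - x) \<bullet> \<nu> \<sigma> = 0)) \<and>
     (\<forall>\<sigma>\<in>faces_ext \<Omega> \<T>. \<forall>x\<in>rel_interior \<sigma>. outer_normal \<Omega> x (\<nu> \<sigma>))"

text \<open>Surface integral over a non-degenerate triangle, through an affine parametrization by the
  reference triangle; the value does not depend on the order in which the vertices are listed.\<close>

definition surf_int :: "vec3 set \<Rightarrow> (vec3 \<Rightarrow> 'b::real_normed_vector) \<Rightarrow> 'b" where
  "surf_int \<sigma> f =
     (let (a, b, c) = (SOME (a, b, c). \<sigma> = convex hull {a, b, c})
      in norm (cross3 (b - a) (c - a)) *\<^sub>R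
         integral {(s, t). 0 \<le> s \<and> 0 \<le> t \<and> s + t \<le> 1}
           (\<lambda>(s::real, t::real). f (a + s *\<^sub>R (b - a) + t *\<^sub>R (c - a))))"

definition face_mean :: "vec3 set \<Rightarrow> (vec3 \<Rightarrow> 'b::real_normed_vector) \<Rightarrow> 'b" where
  "face_mean \<sigma> f = surf_int \<sigma> f /\<^sub>R surf_int \<sigma> (\<lambda>x. 1)"

abbreviation face_centre :: "vec3 set \<Rightarrow> vec3" where
  "face_centre \<sigma> \<equiv> face_mean \<sigma> (\<lambda>x. x)"

definition elem_mean :: "vec3 set \<Rightarrow> (vec3 \<Rightarrow> 'b::real_normed_vector) \<Rightarrow> 'b" where
  "elem_mean K f = integral K f /\<^sub>R measure lebesgue K"


section \<open>Discrete function spaces\<close>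

text \<open>Discontinuous piecewise smooth functions are ordinary functions on \<open>\<real>\<^sup>3\<close> of which only the
  values in the interiors of the elements matter. Values on (parts of) the closed faces are the
  one-sided limits from within an element.\<close>

definition elem_trace :: "vec3 set \<Rightarrow> (vec3 \<Rightarrow> 'b::t2_space) \<Rightarrow> vec3 \<Rightarrow> 'b" where
  "elem_trace K g x = Lim (at x within interior K) g"

definition elem_val :: "vec3 set \<Rightarrow> (vec3 \<Rightarrow> 'b) \<Rightarrow> 'b" where
  "elem_val K g = (THE c. \<forall>x\<in>interior K. g x = c)"

definition Q_space :: "vec3 set set \<Rightarrow> (vec3 \<Rightarrow> 'b) set" where
  "Q_space \<T> = {g. \<forall>K\<in>\<T>. \<exists>c. \<forall>x\<in>interior K. g x = c}"

definition V_space :: "vec3 set \<Rightarrow> vec3 set set \<Rightarrow> (vec3 \<Rightarrow> 'b::real_normed_vector) set" where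
  "V_space \<Omega> \<T> = {v. (\<forall>K\<in>\<T>. \<exists>A b. linear A \<and> (\<forall>x\<in>interior K. v x = A x + b)) \<and>
     (\<forall>\<sigma>\<in>faces_int \<Omega> \<T>. \<forall>K\<in>\<T>. \<forall>L\<in>\<T>. \<sigma> \<in> faces_of K \<and> \<sigma> \<in> faces_of L \<longrightarrow>
        surf_int \<sigma> (elem_trace K v) = surf_int \<sigma> (elem_trace L v))}"

definition V0_space :: "vec3 set \<Rightarrow> vec3 set set \<Rightarrow> (vec3 \<Rightarrow> 'b::real_normed_vector) set" where
  "V0_space \<Omega> \<T> = {v \<in> V_space \<Omega> \<T>.
     \<forall>\<sigma>\<in>faces_ext \<Omega> \<T>. \<forall>K\<in>\<T>. \<sigma> \<in> faces_of K \<longrightarrow> surf_int \<sigma> (elem_trace K v) = 0}"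

definition PiQ :: "vec3 set set \<Rightarrow> (vec3 \<Rightarrow> 'b::real_normed_vector) \<Rightarrow> vec3 \<Rightarrow> 'b" where
  "PiQ \<T> g x = (\<Sum>K\<in>\<T>. indicator (interior K) x *\<^sub>R elem_mean K g)"

text \<open>On an exterior face the adjacent element is unique; on an interior face either of the two
  neighbours may be used for the face value \<open>v\<^sub>\<sigma>\<close> of a Crouzeix-Raviart function.\<close>

definition adj_elem :: "vec3 set set \<Rightarrow> vec3 set \<Rightarrow> vec3 set" where
  "adj_elem \<T> \<sigma> = (SOME K. K \<in> \<T> \<and> \<sigma> \<in> faces_of K)"

definition opp_elem :: "vec3 set set \<Rightarrow> vec3 set \<Rightarrow> vec3 set \<Rightarrow> vec3 set" where
  "opp_elem \<T> K \<sigma> = (THE L. L \<in> \<T> \<and> L \<noteq> K \<and> \<sigma> \<in> faces_of L)"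

abbreviation face_trace :: "vec3 set set \<Rightarrow> vec3 set \<Rightarrow> (vec3 \<Rightarrow> 'b::t2_space) \<Rightarrow> vec3 \<Rightarrow> 'b" where
  "face_trace \<T> \<sigma> g \<equiv> elem_trace (adj_elem \<T> \<sigma>) g"

definition face_val :: "vec3 set set \<Rightarrow> (vec3 \<Rightarrow> 'b::real_normed_vector) \<Rightarrow> vec3 set \<Rightarrow> 'b" where
  "face_val \<T> v \<sigma> = face_mean \<sigma> (face_trace \<T> \<sigma> v)"

text \<open>\<open>v = \<Pi>\<^sup>V[g]\<close> for \<open>g\<close> continuous on the closure of \<open>\<Omega>\<close>.\<close>

definition is_PiV :: "vec3 set \<Rightarrow> vec3 set set \<Rightarrow> (vec3 \<Rightarrow> 'b::real_normed_vector) \<Rightarrow> (vec3 \<Rightarrow> 'b) \<Rightarrow> bool" where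
  "is_PiV \<Omega> \<T> g v \<longleftrightarrow> v \<in> V_space \<Omega> \<T> \<and> (\<forall>\<sigma>\<in>faces \<T>. face_val \<T> v \<sigma> = face_mean \<sigma> g)"

text \<open>Element-wise gradient \<open>(\<nabla>\<^sub>h v)\<^sub>i\<^sub>j = \<partial>\<^sub>j v\<^sub>i\<close> and divergence, meaningful in the interiors of the
  elements.\<close>

definition grad_h :: "(vec3 \<Rightarrow> vec3) \<Rightarrow> vec3 \<Rightarrow> real^3^3" where
  "grad_h v x = jacobian v (at x)"

definition div_h :: "(vec3 \<Rightarrow> vec3) \<Rightarrow> vec3 \<Rightarrow> real" where
  "div_h v x = trace (grad_h v x)"


section \<open>Traces, jumps and fluxes on interior faces\<close>

definition trace_p :: "(vec3 set \<Rightarrow> vec3) \<Rightarrow> (vec3 \<Rightarrow> 'b::t2_space) \<Rightarrow> vec3 set \<Rightarrow> 'b" where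
  "trace_p \<nu> g \<sigma> = Lim (at_right 0) (\<lambda>\<delta>. g (face_centre \<sigma> + \<delta> *\<^sub>R \<nu> \<sigma>))"

definition trace_m :: "(vec3 set \<Rightarrow> vec3) \<Rightarrow> (vec3 \<Rightarrow> 'b::t2_space) \<Rightarrow> vec3 set \<Rightarrow> 'b" where
  "trace_m \<nu> g \<sigma> = Lim (at_right 0) (\<lambda>\<delta>. g (face_centre \<sigma> - \<delta> *\<^sub>R \<nu> \<sigma>))"

definition jump :: "(vec3 set \<Rightarrow> vec3) \<Rightarrow> (vec3 \<Rightarrow> 'b::real_normed_vector) \<Rightarrow> vec3 set \<Rightarrow> 'b" where
  "jump \<nu> g \<sigma> = trace_p \<nu> g \<sigma> - trace_m \<nu> g \<sigma>"

definition mean :: "(vec3 set \<Rightarrow> vec3) \<Rightarrow> (vec3 \<Rightarrow> 'b::real_normed_vector) \<Rightarrow> vec3 set \<Rightarrow> 'b" where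
  "mean \<nu> g \<sigma> = (1/2) *\<^sub>R (trace_p \<nu> g \<sigma> + trace_m \<nu> g \<sigma>)"

definition Up :: "vec3 set set \<Rightarrow> (vec3 set \<Rightarrow> vec3) \<Rightarrow> (vec3 \<Rightarrow> real) \<Rightarrow> (vec3 \<Rightarrow> vec3) \<Rightarrow> vec3 set \<Rightarrow> real" where
  "Up \<T> \<nu> g u \<sigma> = trace_m \<nu> g \<sigma> * max (face_val \<T> u \<sigma> \<bullet> \<nu> \<sigma>) 0
                 + trace_p \<nu> g \<sigma> * min (face_val \<T> u \<sigma> \<bullet> \<nu> \<sigma>) 0"

definition flux ::
  "vec3 set set \<Rightarrow> (vec3 \<Rightarrow> 'b::real_normed_vector) \<Rightarrow> (vec3 \<Rightarrow> vec3) \<Rightarrow> vec3 set \<Rightarrow> vec3 set \<Rightarrow> 'b" where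
  "flux \<T> g u K \<sigma> =
     (let un = face_val \<T> u \<sigma> \<bullet> elem_normal K \<sigma>
      in un *\<^sub>R (if 0 \<le> un then elem_val K g else elem_val (opp_elem \<T> K \<sigma>) g))"

definition faces_in ::
  "vec3 set \<Rightarrow> vec3 set set \<Rightarrow> (vec3 set \<Rightarrow> vec3) \<Rightarrow> (vec3 \<Rightarrow> vec3) \<Rightarrow> vec3 set set" where
  "faces_in \<Omega> \<T> \<nu> uB = {\<sigma> \<in> faces_ext \<Omega> \<T>. face_val \<T> uB \<sigma> \<bullet> \<nu> \<sigma> < 0}"

definition faces_out ::
  "vec3 set \<Rightarrow> vec3 set set \<Rightarrow> (vec3 set \<Rightarrow> vec3) \<Rightarrow> (vec3 \<Rightarrow> vec3) \<Rightarrow> vec3 set set" where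
  "faces_out \<Omega> \<T> \<nu> uB = faces_ext \<Omega> \<T> - faces_in \<Omega> \<T> \<nu> uB"


section \<open>The scheme\<close>

definition Dt :: "real \<Rightarrow> (nat \<Rightarrow> vec3 \<Rightarrow> 'b::real_normed_vector) \<Rightarrow> nat \<Rightarrow> vec3 \<Rightarrow> 'b" where
  "Dt \<tau> z k x = (z k x - z (k - 1) x) /\<^sub>R \<tau>"

text \<open>Here \<open>\<tau>\<close> is the time step, and \<open>\<alpha> = \<kappa> h\<^sup>\<omega>\<close> the coefficient of the artificial diffusion.\<close>

definition continuity_scheme ::
  "vec3 set \<Rightarrow> vec3 set set \<Rightarrow> (vec3 set \<Rightarrow> vec3) \<Rightarrow> real \<Rightarrow> real \<Rightarrow> (vec3 \<Rightarrow> real) \<Rightarrow> (vec3 \<Rightarrow> vec3) \<Rightarrow>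
   (nat \<Rightarrow> vec3 \<Rightarrow> real) \<Rightarrow> (nat \<Rightarrow> vec3 \<Rightarrow> vec3) \<Rightarrow> nat \<Rightarrow> bool" where
  "continuity_scheme \<Omega> \<T> \<nu> \<tau> \<alpha> \<rho>B uB \<rho> u k \<longleftrightarrow>
    (\<forall>\<phi>\<in>Q_space \<T>.
      integral \<Omega> (\<lambda>x. Dt \<tau> \<rho> k x * \<phi> x)
      + (\<Sum>K\<in>\<T>. \<Sum>\<sigma>\<in>faces_of K \<inter> faces_int \<Omega> \<T>.
           surf_int \<sigma> (\<lambda>x. flux \<T> (\<rho> k) (u k) K \<sigma> * elem_trace K \<phi> x))
      + (\<Sum>\<sigma>\<in>faces_out \<Omega> \<T> \<nu> uB.
           surf_int \<sigma> (\<lambda>x. face_trace \<T> \<sigma> (\<rho> k) x * (face_val \<T> uB \<sigma> \<bullet> \<nu> \<sigma>) * face_trace \<T> \<sigma> \<phi> x))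
      + (\<Sum>\<sigma>\<in>faces_in \<Omega> \<T> \<nu> uB.
           surf_int \<sigma> (\<lambda>x. face_trace \<T> \<sigma> \<rho>B x * (face_val \<T> uB \<sigma> \<bullet> \<nu> \<sigma>) * face_trace \<T> \<sigma> \<phi> x))
      + \<alpha> * (\<Sum>\<sigma>\<in>faces_int \<Omega> \<T>. surf_int \<sigma> (\<lambda>x. jump \<nu> (\<rho> k) \<sigma> * jump \<nu> \<phi> \<sigma>))
      = 0)"

definition momentum_scheme ::
  "vec3 set \<Rightarrow> vec3 set set \<Rightarrow> (vec3 set \<Rightarrow> vec3) \<Rightarrow> real \<Rightarrow> real \<Rightarrow> real \<Rightarrow> real \<Rightarrow> (real \<Rightarrow> real) \<Rightarrow>
   (vec3 \<Rightarrow> real) \<Rightarrow> (vec3 \<Rightarrow> vec3) \<Rightarrow> (nat \<Rightarrow> vec3 \<Rightarrow> real) \<Rightarrow> (nat \<Rightarrow> vec3 \<Rightarrow> vec3) \<Rightarrow> nat \<Rightarrow> bool" where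
  "momentum_scheme \<Omega> \<T> \<nu> \<tau> \<alpha> \<mu> lam ph \<rho>B uB \<rho> u k \<longleftrightarrow>
    (let uh = PiQ \<T> (u k); vh = (\<lambda>j. PiQ \<T> (\<lambda>x. u j x - uB x)) in
    \<forall>\<phi>\<in>V0_space \<Omega> \<T>. let \<phi>h = PiQ \<T> \<phi> in
      integral \<Omega> (\<lambda>x. Dt \<tau> (\<lambda>j y. \<rho> j y *\<^sub>R vh j y) k x \<bullet> \<phi>h x)
      + (\<Sum>K\<in>\<T>. \<Sum>\<sigma>\<in>faces_of K \<inter> faces_int \<Omega> \<T>.
           surf_int \<sigma> (\<lambda>x. flux \<T> (\<lambda>y. \<rho> k y *\<^sub>R vh k y) (u k) K \<sigma> \<bullet> elem_trace K \<phi>h x))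
      + (\<Sum>K\<in>\<T>. \<Sum>\<sigma>\<in>faces_of K.
           surf_int \<sigma> (\<lambda>x. elem_trace K (\<rho> k) x * (elem_trace K uh x \<bullet> elem_normal K \<sigma>)
                            * (elem_trace K uB x \<bullet> elem_trace K \<phi>h x)))
      + (\<Sum>\<sigma>\<in>faces_out \<Omega> \<T> \<nu> uB.
           surf_int \<sigma> (\<lambda>x. face_trace \<T> \<sigma> (\<rho> k) x * (face_val \<T> uB \<sigma> \<bullet> \<nu> \<sigma>)
                            * (face_trace \<T> \<sigma> (vh k) x \<bullet> face_trace \<T> \<sigma> \<phi>h x)))
      + (\<Sum>\<sigma>\<in>faces_in \<Omega> \<T> \<nu> uB.
           surf_int \<sigma> (\<lambda>x. face_trace \<T> \<sigma> \<rho>B x * (face_val \<T> uB \<sigma> \<bullet> \<nu> \<sigma>)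
                            * (face_trace \<T> \<sigma> (vh k) x \<bullet> face_trace \<T> \<sigma> \<phi>h x)))
      + integral \<Omega> (\<lambda>x. stress \<mu> lam (grad_h (u k) x) \<bullet> grad_h \<phi> x - ph (\<rho> k x) * div_h \<phi> x)
      + \<alpha> * (\<Sum>\<sigma>\<in>faces_int \<Omega> \<T>.
           surf_int \<sigma> (\<lambda>x. jump \<nu> (\<rho> k) \<sigma> * (mean \<nu> (vh k) \<sigma> \<bullet> jump \<nu> \<phi>h \<sigma>)))
      = 0)"

text \<open>The sequences \<open>\<rho>\<close>, \<open>u\<close> carry the initial values at index \<open>0\<close>; only their entries
  \<open>0, \<dots>, N\<close> matter.\<close>

definition numerical_solution ::
  "vec3 set \<Rightarrow> vec3 set set \<Rightarrow> (vec3 set \<Rightarrow> vec3) \<Rightarrow> real \<Rightarrow> nat \<Rightarrow> real \<Rightarrow> real \<Rightarrow> real \<Rightarrow> (real \<Rightarrow> real) \<Rightarrow>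
   (vec3 \<Rightarrow> real) \<Rightarrow> (vec3 \<Rightarrow> vec3) \<Rightarrow> (vec3 \<Rightarrow> real) \<Rightarrow> (vec3 \<Rightarrow> vec3) \<Rightarrow>
   (nat \<Rightarrow> vec3 \<Rightarrow> real) \<Rightarrow> (nat \<Rightarrow> vec3 \<Rightarrow> vec3) \<Rightarrow> bool" where
  "numerical_solution \<Omega> \<T> \<nu> \<tau> N \<alpha> \<mu> lam ph r0 u0 \<rho>B uB \<rho> u \<longleftrightarrow>
     \<rho> 0 = PiQ \<T> r0 \<and> is_PiV \<Omega> \<T> u0 (u 0) \<and>
     (\<forall>k\<in>{1..N}.
        \<rho> k \<in> Q_space \<T> \<and> (\<forall>K\<in>\<T>. \<forall>x\<in>interior K. 0 < \<rho> k x) \<and>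
        u k \<in> V_space \<Omega> \<T> \<and> (\<lambda>x. u k x - uB x) \<in> V0_space \<Omega> \<T> \<and>
        continuity_scheme \<Omega> \<T> \<nu> \<tau> \<alpha> \<rho>B uB \<rho> u k \<and>
        momentum_scheme \<Omega> \<T> \<nu> \<tau> \<alpha> \<mu> lam ph \<rho>B uB \<rho> u k)"

end

theory Submission
  imports Defs
begin

text \<open>All discrete functions are constant or affine on each tetrahedron, so every integral in the scheme
  is a volume or an area times a value at a centroid, and the divergence theorem for affine fields on a
  tetrahedron is the only integration by parts needed. It turns \<open>\<integral> p\<^sub>h(\<rho>) div\<^sub>h u\<close> into face sums and
  evaluates the convective boundary term containing \<open>u\<^sub>B\<close>.

  Mass conservation is the continuity equation tested with \<open>1\<close>. For the energy, test the momentum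
  equation with \<open>v\<close> and subtract the continuity equation tested with \<open>|v|\<^sup>2/2\<close>: the time difference
  leaves \<open>\<rho>\<^bsup>k-1\<^esup> |v\<^sup>k - v\<^bsup>k-1\<^esup>|\<^sup>2\<close>, the upwind flux leaves \<open>|Up| |[[v]]|\<^sup>2\<close>, and the artificial diffusion cancels.
  Then add the continuity equation tested with \<open>H\<^sub>h'(\<rho>)\<close>. Since \<open>r H\<^sub>h'(r) - H\<^sub>h(r) = p\<^sub>h(r)\<close>, on each
  interior face the upwind flux and the pressure combine to a Bregman distance of \<open>H\<^sub>h\<close>, on the outflow
  faces to \<open>H\<^sub>h(\<rho>)\<close> and on the inflow faces to a Bregman distance minus \<open>H\<^sub>h(\<rho>\<^sub>B)\<close>; the intermediate
  densities come from second-order Taylor expansions of \<open>H\<^sub>h\<close> in time and across faces.\<close>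


section \<open>Integrals over triangles\<close>

text \<open>The discrete notions are given by \<open>SOME\<close>, \<open>THE\<close> and
  \<open>Lim\<close>, and discrete functions are arbitrary outside the interiors of the elements;
  most of the work before the energy algebra evaluates these notions. On a tetrahedron signed
  volumes give barycentric coordinates, hence outward normals and the fact that near a relative
  interior point of a face the element fills the half-space behind that face. The obstacle is
  incidence: an interior face is merely one not contained in the frontier, yet it must have exactly
  two elements, with opposite normals, and an exterior face exactly one, with normal
  \<open>\<nu> \<sigma>\<close>. Only then can sums over elements be regrouped by faces. The
  Crouzeix-Raviart condition makes the face values of \<open>u\<close> independent of the side, so
  that contributions of two neighbours combine. Since \<open>u - uB\<close> lies in
  \<open>V0_space\<close>, it is an admissible test function, and on the boundary the face values of
  \<open>u\<close> are those of \<open>uB\<close>. The scheme becomes a system of finite sums, in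
  which the energy identity of a time step is linear.\<close>

abbreviation ref_triangle :: "(real \<times> real) set" where
  "ref_triangle \<equiv> {(s, t). 0 \<le> s \<and> 0 \<le> t \<and> s + t \<le> 1}"

lemma compact_ref_triangle: "compact ref_triangle"
proof -
  have eq: "ref_triangle = {x. 0 \<le> fst x} \<inter> {x. 0 \<le> snd x} \<inter> {x. fst x + snd x \<le> 1}"
    by auto
  have "closed ref_triangle"
    unfolding eq by (intro closed_Int closed_Collect_le continuous_intros)
  moreover have "bounded ref_triangle"
    by (rule bounded_subset[OF bounded_cbox[of "(0,0)" "(1,1)"]]) auto
  ultimately show ?thesis
    by (simp add: compact_eq_bounded_closed)
qed

text \<open>Continuity on a compact set makes \<open>f\<close> Lebesgue integrable, so Fubini for
  the product measure applies; gauge integrals are translated to Lebesgue integrals and back. The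
  slice over \<open>s\<close> is the segment from 0 to \<open>1 - s\<close>, empty unless
  \<open>s\<close> lies in the unit interval.\<close>

lemma has_integral_ref_triangle:
  fixes f :: "real \<times> real \<Rightarrow> real"
  assumes cont: "continuous_on ref_triangle f"
    and inner: "\<And>s. s \<in> {0..1} \<Longrightarrow> ((\<lambda>t. f (s, t)) has_integral g s) {0..1 - s}"
    and outer: "(g has_integral I) {0..1}"
  shows "(f has_integral I) ref_triangle"
proof -
  have int: "set_integrable lborel ref_triangle f"
    unfolding set_integrable_def by (rule borel_integrable_compact[OF compact_ref_triangle cont])
  have 1: "(LINT t|lborel. indicator ref_triangle (s, t) *\<^sub>R f (s, t)) = indicator {0..1} s *\<^sub>R g s" for s
  proof (cases "s \<in> {0..1}")
    case True
    have "continuous_on {0..1 - s} (\<lambda>t. f (s, t))"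
      by (rule continuous_on_compose2[OF cont]) (use True in \<open>auto intro!: continuous_intros\<close>)
    then have "set_integrable lborel {0..1 - s} (\<lambda>t. f (s, t))"
      by (rule borel_integrable_atLeastAtMost')
    from set_borel_integral_eq_integral(2)[OF this] inner[OF True]
    have "(LINT t:{0..1-s}|lborel. f (s, t)) = g s"
      by (simp add: integral_unique)
    moreover have "indicator ref_triangle (s, t) = (indicator {0..1 - s} t :: real)" for t
      using True by (auto simp: indicator_def)
    ultimately show ?thesis
      using True by (simp add: set_lebesgue_integral_def)
  next
    case False
    then have "indicator ref_triangle (s, t) = (0 :: real)" for t
      by (auto simp: indicator_def)
    then show ?thesis
      using False by simp
  qed
  have int2: "integrable (lborel \<Otimes>\<^sub>M lborel) (\<lambda>x. indicator ref_triangle x *\<^sub>R f x)"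
    using int by (simp add: set_integrable_def lborel_prod)
  have L: "(LINT s|lborel. LINT t|lborel. indicator ref_triangle (s, t) *\<^sub>R f (s, t)) =
      (LINT x|lborel. indicator ref_triangle x *\<^sub>R f x)"
    using lborel_pair.integral_fst'[OF int2] by (simp add: lborel_prod)
  have "integrable lborel (\<lambda>s. LINT t|lborel. indicator ref_triangle (s, t) *\<^sub>R f (s, t))"
    using lborel_pair.integrable_fst'[OF int2] .
  then have "set_integrable lborel {0..1} g"
    unfolding 1 set_integrable_def .
  from set_borel_integral_eq_integral(2)[OF this] outer
  have "(LINT s:{0..1}|lborel. g s) = I"
    by (simp add: integral_unique)
  with L have "(LINT x:ref_triangle|lborel. f x) = I"
    unfolding 1 set_lebesgue_integral_def by simp
  with set_borel_integral_eq_integral[OF int] show ?thesis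
    by (simp add: has_integral_integrable_integral)
qed

lemma has_integral_poly01:
  fixes a b c :: real
  shows "((\<lambda>x. a + b * x + c * x\<^sup>2) has_integral (a + b / 2 + c / 3)) {0..1}"
proof -
  have "((\<lambda>x. a + b * x + c * x\<^sup>2) has_integral
      ((\<lambda>x. a * x + b * x\<^sup>2 / 2 + c * x ^ 3 / 3) 1 - (\<lambda>x. a * x + b * x\<^sup>2 / 2 + c * x ^ 3 / 3) 0)) {0..1}"
    by (rule fundamental_theorem_of_calculus)
      (auto intro!: derivative_eq_intros simp: has_real_derivative_iff_has_vector_derivative[symmetric] power2_eq_square)
  then show ?thesis by simp
qed

text \<open>With the length of the cross product in \<open>surf_int\<close>, the value 1/2 yields
  the area of a triangle, and the ratio (1/6)/(1/2) = 1/3 puts the mean of an affine function at the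
  centroid.\<close>

lemma has_integral_ref_triangle_moments:
  "((\<lambda>x. 1 :: real) has_integral 1/2) ref_triangle"
  "(fst has_integral 1/6) ref_triangle"
  "(snd has_integral 1/6) ref_triangle"
proof -
  have c: "((\<lambda>t. k) has_integral k * (1 - s)) {0..1 - s}" if "s \<in> {0..1}" for k s :: real
    using has_integral_const_real[of k 0 "1 - s"] that by (simp add: mult.commute)
  have l: "((\<lambda>t. t) has_integral (1 - s)\<^sup>2 / 2) {0..1 - s}" if "s \<in> {0..1}" for s :: real
    using ident_has_integral[of 0 "1 - s"] that by simp
  show "((\<lambda>x. 1 :: real) has_integral 1/2) ref_triangle"
    by (rule has_integral_ref_triangle[OF _ c])
      (use has_integral_poly01[of 1 "-1" 0] in \<open>auto intro!: continuous_intros\<close>)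
  show "(fst has_integral 1/6) ref_triangle"
    by (rule has_integral_ref_triangle[where g = "\<lambda>s. s * (1 - s)"])
      (use has_integral_poly01[of 0 1 "-1"] c in \<open>auto intro!: continuous_intros simp: algebra_simps power2_eq_square\<close>)
  show "(snd has_integral 1/6) ref_triangle"
    by (rule has_integral_ref_triangle[where g = "\<lambda>s. (1 - s)\<^sup>2 / 2"])
      (use has_integral_poly01[of "1/2" "-1" "1/2"] l in \<open>auto intro!: continuous_intros simp: algebra_simps power2_eq_square add_divide_distrib diff_divide_distrib\<close>)
qed

text \<open>\<^const>\<open>surf_int\<close> picks the vertices of \<open>\<sigma>\<close> by choice; for affine integrands the value turns out
  to depend only on the area and the centroid, which are symmetric in the vertices.\<close>

definition area :: "vec3 set \<Rightarrow> real" where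
  "area \<sigma> = surf_int \<sigma> (\<lambda>x. 1)"

lemma convex_hull_3_param:
  fixes a b c :: "'a::real_vector"
  assumes "0 \<le> s" "0 \<le> t" "s + t \<le> 1"
  shows "a + s *\<^sub>R (b - a) + t *\<^sub>R (c - a) \<in> convex hull {a, b, c}"
  unfolding convex_hull_3
  by (rule CollectI, rule exI[of _ "1 - s - t"], rule exI[of _ s], rule exI[of _ t])
    (use assms in \<open>auto simp: algebra_simps\<close>)

text \<open>The vertices obtained are those picked by \<open>SOME\<close>, of which only the hull is
  known. They are fixed before the integrand, as one choice serves every \<open>f\<close>;
  independence of the choice is left to \<open>convex_hull_triangle_unique\<close>.\<close>

lemma surf_int_affine_SOME:
  assumes "\<sigma> = convex hull {a, b, c}"
  obtains a' b' c' where "\<sigma> = convex hull {a', b', c'}"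
    "\<And>(A :: vec3 \<Rightarrow> 'b::real_normed_vector) d f. linear A \<Longrightarrow> (\<And>x. x \<in> \<sigma> \<Longrightarrow> f x = A x + d) \<Longrightarrow>
      surf_int \<sigma> f = (norm (cross3 (b' - a') (c' - a')) / 2) *\<^sub>R (A ((a' + b' + c') /\<^sub>R 3) + d)"
proof -
  define abc where "abc = (SOME (a, b, c). \<sigma> = convex hull {a, b, c})"
  obtain a' b' c' where abc: "abc = (a', b', c')"
    by (cases abc)
  have "case abc of (a, b, c) \<Rightarrow> \<sigma> = convex hull {a, b, c}"
    unfolding abc_def by (rule someI[of _ "(a, b, c)"]) (use assms in simp)
  then have hull: "\<sigma> = convex hull {a', b', c'}"
    by (simp add: abc)
  have "surf_int \<sigma> f = (norm (cross3 (b' - a') (c' - a')) / 2) *\<^sub>R (A ((a' + b' + c') /\<^sub>R 3) + d)"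
    if A: "linear A" and f: "\<And>x. x \<in> \<sigma> \<Longrightarrow> f x = A x + d" for A :: "vec3 \<Rightarrow> 'b" and d f
  proof -
    have "((\<lambda>x. 1 *\<^sub>R (A a' + d) + fst x *\<^sub>R A (b' - a') + snd x *\<^sub>R A (c' - a')) has_integral
        (1/2) *\<^sub>R (A a' + d) + (1/6) *\<^sub>R A (b' - a') + (1/6) *\<^sub>R A (c' - a')) ref_triangle"
      by (intro has_integral_add has_integral_scaleR_left has_integral_ref_triangle_moments)
    moreover have "1 *\<^sub>R (A a' + d) + fst x *\<^sub>R A (b' - a') + snd x *\<^sub>R A (c' - a') =
        (case x of (s, t) \<Rightarrow> f (a' + s *\<^sub>R (b' - a') + t *\<^sub>R (c' - a')))" if "x \<in> ref_triangle" for x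
      using that
      by (auto simp: f hull convex_hull_3_param linear_add[OF A] linear_scale[OF A] linear_diff[OF A])
    ultimately have "((\<lambda>(s, t). f (a' + s *\<^sub>R (b' - a') + t *\<^sub>R (c' - a'))) has_integral
        (1/2) *\<^sub>R (A a' + d) + (1/6) *\<^sub>R A (b' - a') + (1/6) *\<^sub>R A (c' - a')) ref_triangle"
      by (subst has_integral_cong[OF sym]) auto
    moreover have "(1/2) *\<^sub>R (A a' + d) + (1/6) *\<^sub>R A (b' - a') + (1/6) *\<^sub>R A (c' - a') =
        (1/2) *\<^sub>R (A ((a' + b' + c') /\<^sub>R 3) + d)"
      by (simp add: linear_add[OF A] linear_scale[OF A] linear_diff[OF A] scaleR_add_right
          scaleR_diff_right scaleR_left_distrib[symmetric] flip: scaleR_left_diff_distrib)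
    ultimately show ?thesis
      unfolding surf_int_def abc_def[symmetric] abc
      by (simp add: integral_unique)
  qed
  with hull show thesis
    by (rule that)
qed


section \<open>Tetrahedra\<close>

text \<open>Six times the signed volume of the tetrahedron. Replacing one vertex by \<open>y\<close>
  and dividing by the original value gives the barycentric coordinate of \<open>y\<close> at that
  vertex.\<close>

definition det4 :: "vec3 \<Rightarrow> vec3 \<Rightarrow> vec3 \<Rightarrow> vec3 \<Rightarrow> real" where
  "det4 a b c d = cross3 (b - a) (c - a) \<bullet> (d - a)"

lemmas det4_simps = det4_def cross3_def inner_vec_def sum_3 vector_3

lemma cross3_nonzero_iff:
  "cross3 (b - a) (c - a) \<noteq> 0 \<longleftrightarrow> distinct [a, b, c] \<and> \<not> affine_dependent {a, b, c}"
proof -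
  have "collinear {b, a, c} \<longleftrightarrow> collinear {0, b - a, c - a}"
    by (rule collinear_3) simp
  then show ?thesis
    by (auto simp: cross_eq_0 collinear_3_eq_affine_dependent insert_commute)
qed

text \<open>The extreme points of a non-degenerate triangle are its vertices, so the hull determines
  them up to order; affine dimension 2 forces the primed points to be three independent ones as
  well. A reordering changes the cross product at most by a sign and leaves the sum alone.\<close>

lemma convex_hull_triangle_unique:
  fixes a b c :: vec3
  assumes cross: "cross3 (b - a) (c - a) \<noteq> 0"
    and hull: "convex hull {a', b', c'} = convex hull {a, b, c}"
  shows "norm (cross3 (b' - a') (c' - a')) = norm (cross3 (b - a) (c - a))"
    and "a' + b' + c' = a + b + c"
proof -
  have indep: "\<not> affine_dependent {a, b, c}" and "distinct [a, b, c]"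
    using cross cross3_nonzero_iff by blast+
  then have card: "card {a, b, c} = 3" by auto
  have "aff_dim {a', b', c'} = aff_dim {a, b, c}"
    by (metis aff_dim_convex_hull hull)
  also have "\<dots> = 2"
    using indep card by (simp add: affine_independent_iff_card)
  finally have dim: "aff_dim {a', b', c'} = 2" .
  have le: "card {a', b', c'} \<le> 3"
    by (simp add: card_insert_le_m1)
  moreover have "aff_dim {a', b', c'} \<le> int (card {a', b', c'}) - 1"
    by (rule aff_dim_le_card) simp
  ultimately have card': "card {a', b', c'} = 3" using dim by linarith
  then have indep': "\<not> affine_dependent {a', b', c'}"
    using dim by (simp add: affine_independent_iff_card)
  have "{a', b', c'} = {x. x extreme_point_of convex hull {a', b', c'}}"
    by (simp only: extreme_point_of_convex_hull_affine_independent[OF indep'] Collect_mem_eq)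
  also have "\<dots> = {a, b, c}"
    by (simp only: hull extreme_point_of_convex_hull_affine_independent[OF indep] Collect_mem_eq)
  finally have set: "{a', b', c'} = {a, b, c}" .
  have dist': "a' \<noteq> b'" "a' \<noteq> c'" "b' \<noteq> c'"
    using card' by (auto simp: card_insert_if split: if_splits)
  have perm: "(a' = a \<and> b' = b \<and> c' = c) \<or> (a' = a \<and> b' = c \<and> c' = b) \<or> (a' = b \<and> b' = a \<and> c' = c) \<or>
      (a' = b \<and> b' = c \<and> c' = a) \<or> (a' = c \<and> b' = a \<and> c' = b) \<or> (a' = c \<and> b' = b \<and> c' = a)"
    using set dist' unfolding set_eq_iff insert_iff empty_iff by metis
  then have "cross3 (b' - a') (c' - a') = cross3 (b - a) (c - a) \<or>
      cross3 (b' - a') (c' - a') = - cross3 (b - a) (c - a)"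
    by (elim disjE conjE; hypsubst)
      ((rule disjI1, simp add: cross3_simps; fail) | (rule disjI2, simp add: cross3_simps; fail))+
  then show "norm (cross3 (b' - a') (c' - a')) = norm (cross3 (b - a) (c - a))"
    by (elim disjE) simp_all
  show "a' + b' + c' = a + b + c"
    using perm by (elim disjE conjE) (simp_all add: ac_simps)
qed

lemma surf_int_affine_triangle:
  fixes A :: "vec3 \<Rightarrow> 'b::real_normed_vector"
  assumes cross: "cross3 (b - a) (c - a) \<noteq> 0"
    and A: "linear A" and f: "\<And>x. x \<in> convex hull {a, b, c} \<Longrightarrow> f x = A x + d"
  shows "surf_int (convex hull {a, b, c}) f =
    (norm (cross3 (b - a) (c - a)) / 2) *\<^sub>R (A ((a + b + c) /\<^sub>R 3) + d)"
proof -
  obtain a' b' c' where hull: "convex hull {a, b, c} = convex hull {a', b', c'}"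
    and int: "\<And>(A :: vec3 \<Rightarrow> 'b) d f. linear A \<Longrightarrow> (\<And>x. x \<in> convex hull {a, b, c} \<Longrightarrow> f x = A x + d) \<Longrightarrow>
      surf_int (convex hull {a, b, c}) f = (norm (cross3 (b' - a') (c' - a')) / 2) *\<^sub>R (A ((a' + b' + c') /\<^sub>R 3) + d)"
    using surf_int_affine_SOME[OF refl, where ?'b = 'b] by metis
  show ?thesis
    using int[OF A, of f d] f by (simp only: convex_hull_triangle_unique[OF cross hull[symmetric]])
qed

lemma area_triangle:
  assumes "cross3 (b - a) (c - a) \<noteq> 0"
  shows "area (convex hull {a, b, c}) = norm (cross3 (b - a) (c - a)) / 2"
  using surf_int_affine_triangle[OF assms linear_zero, of "\<lambda>x. 1 :: real" 1] by (simp add: area_def)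

lemma face_centre_triangle:
  assumes "cross3 (b - a) (c - a) \<noteq> 0"
  shows "face_centre (convex hull {a, b, c}) = (a + b + c) /\<^sub>R 3"
proof -
  let ?A = "norm (cross3 (b - a) (c - a)) / 2"
  have "surf_int (convex hull {a, b, c}) (\<lambda>x. x) = ?A *\<^sub>R ((a + b + c) /\<^sub>R 3)"
    using surf_int_affine_triangle[OF assms linear_id, of "\<lambda>x. x" 0] by (simp only: id_apply add_0_right)
  moreover have "?A \<noteq> 0"
    using assms by simp
  then have "(?A *\<^sub>R v) /\<^sub>R ?A = v" for v :: vec3
    by simp
  ultimately show ?thesis
    unfolding face_mean_def area_def[symmetric] area_triangle[OF assms] by metis
qed

text \<open>Cramer's rule in the basis \<open>b - a\<close>, \<open>c - a\<close>,
  \<open>d - a\<close>; cleared of denominators it is a polynomial identity in the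
  coordinates.\<close>

lemma det4_cramer:
  assumes "D = det4 a b c d" "D \<noteq> 0"
  shows "y = a + (det4 a y c d / D) *\<^sub>R (b - a) + (det4 a b y d / D) *\<^sub>R (c - a) + (det4 a b c y / D) *\<^sub>R (d - a)"
proof -
  have "D *\<^sub>R (y - a) = det4 a y c d *\<^sub>R (b - a) + det4 a b y d *\<^sub>R (c - a) + det4 a b c y *\<^sub>R (d - a)"
    unfolding assms(1) vec_eq_iff forall_3 by (simp add: det4_simps algebra_simps)
  then have "(1 / D) *\<^sub>R (D *\<^sub>R (y - a)) = (1 / D) *\<^sub>R (det4 a y c d *\<^sub>R (b - a) + det4 a b y d *\<^sub>R (c - a) + det4 a b c y *\<^sub>R (d - a))"
    by simp
  then show ?thesis
    using assms(2) by (simp add: scaleR_add_right algebra_simps)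
qed

text \<open>This says that barycentric coordinates sum to 1, before division by the volume.\<close>

lemma det4_sum: "det4 y b c d + det4 a y c d + det4 a b y d + det4 a b c y = det4 a b c d"
  by (simp add: det4_simps algebra_simps)

lemma in_convex_hull_4:
  fixes a b c d :: "'a::real_vector"
  assumes "0 \<le> q" "0 \<le> r" "0 \<le> s" "0 \<le> t" "q + r + s + t = 1"
  shows "q *\<^sub>R a + r *\<^sub>R b + s *\<^sub>R c + t *\<^sub>R d \<in> convex hull {a, b, c, d}"
proof -
  have "(\<Sum>i<4. [q, r, s, t] ! i *\<^sub>R [a, b, c, d] ! i) \<in> convex hull {a, b, c, d}"
    using assms
    by (intro convex_sum) (auto simp: eval_nat_numeral less_Suc_eq hull_inc)
  then show ?thesis
    by (simp add: eval_nat_numeral add.assoc)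
qed

lemma in_tetrahedron:
  assumes D: "D = det4 a b c d" "D \<noteq> 0"
    and "0 \<le> det4 y b c d / D" "0 \<le> det4 a y c d / D" "0 \<le> det4 a b y d / D" "0 \<le> det4 a b c y / D"
  shows "y \<in> convex hull {a, b, c, d}"
proof -
  have sum: "det4 y b c d / D + det4 a y c d / D + det4 a b y d / D + det4 a b c y / D = 1"
    using det4_sum[of y b c d a] D by (simp flip: add_divide_distrib)
  then have q: "det4 y b c d / D = 1 - det4 a y c d / D - det4 a b y d / D - det4 a b c y / D"
    by simp
  have "y = (det4 y b c d / D) *\<^sub>R a + (det4 a y c d / D) *\<^sub>R b + (det4 a b y d / D) *\<^sub>R c + (det4 a b c y / D) *\<^sub>R d"
    by (subst det4_cramer[OF D, of y], subst q) (simp add: algebra_simps)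
  also have "\<dots> \<in> convex hull {a, b, c, d}"
    by (rule in_convex_hull_4) (use assms sum in auto)
  finally show ?thesis .
qed

lemma continuous_det4 [continuous_intros]:
  assumes "continuous_on S a" "continuous_on S b" "continuous_on S c" "continuous_on S d"
  shows "continuous_on S (\<lambda>x. det4 (a x) (b x) (c x) (d x))"
  unfolding det4_simps using assms by (intro continuous_intros)

lemma in_interior_tetrahedron:
  assumes D: "D = det4 a b c d" "D \<noteq> 0"
    and "0 < det4 y b c d / D" "0 < det4 a y c d / D" "0 < det4 a b y d / D" "0 < det4 a b c y / D"
  shows "y \<in> interior (convex hull {a, b, c, d})"
proof (rule interiorI)
  let ?W = "{y. 0 < det4 y b c d / D} \<inter> {y. 0 < det4 a y c d / D} \<inter> {y. 0 < det4 a b y d / D} \<inter> {y. 0 < det4 a b c y / D}"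
  show "open ?W"
    by (intro open_Int open_Collect_less continuous_intros) (use D in auto)
  show "y \<in> ?W" using assms by auto
  show "?W \<subseteq> convex hull {a, b, c, d}"
    by (auto intro!: in_tetrahedron[OF D])
qed

text \<open>At a relative interior point of the face the coordinates at \<open>a\<close>,
  \<open>b\<close>, \<open>c\<close> are positive, and by continuity they stay so nearby. Hence the
  sign of the coordinate at \<open>d\<close> alone decides membership there.\<close>

lemma tetrahedron_near_face:
  assumes D: "D = det4 a b c d" "D \<noteq> 0" and x: "x \<in> rel_interior (convex hull {a, b, c})"
  shows "\<forall>\<^sub>F y in nhds x. (0 \<le> det4 a b c y / D \<longrightarrow> y \<in> convex hull {a, b, c, d}) \<and>
    (0 < det4 a b c y / D \<longrightarrow> y \<in> interior (convex hull {a, b, c, d}))"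
proof -
  have cross: "cross3 (b - a) (c - a) \<noteq> 0"
    using D by (auto simp: det4_def)
  then have indep: "\<not> affine_dependent {a, b, c}" and dist: "distinct [a, b, c]"
    using cross3_nonzero_iff by blast+
  obtain u where u: "0 < u a" "0 < u b" "0 < u c" "u a + u b + u c = 1"
    and xu: "x = u a *\<^sub>R a + u b *\<^sub>R b + u c *\<^sub>R c"
    using x dist unfolding rel_interior_convex_hull_explicit[OF indep] by (auto simp: add.assoc)
  have ua: "u a = 1 - u b - u c" using u by simp
  have "det4 x b c d = u a * D" "det4 a x c d = u b * D" "det4 a b x d = u c * D"
    unfolding xu D(1) ua by (simp_all add: det4_simps algebra_simps)
  then have pos: "0 < det4 x b c d / D" "0 < det4 a x c d / D" "0 < det4 a b x d / D"
    using u D by simp_all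
  let ?W = "{y. 0 < det4 y b c d / D} \<inter> {y. 0 < det4 a y c d / D} \<inter> {y. 0 < det4 a b y d / D}"
  have "open ?W"
    by (intro open_Int open_Collect_less continuous_intros) (use D in auto)
  then have "\<forall>\<^sub>F y in nhds x. y \<in> ?W"
    by (rule eventually_nhds_in_open) (use pos in simp)
  then show ?thesis
    by (rule eventually_mono) (use in_interior_tetrahedron[OF D] in_tetrahedron[OF D] in force)
qed

lemma content_tetrahedron:
  fixes a b c d :: vec3
  assumes "distinct [a, b, c, d]"
  shows "measure lebesgue (convex hull {a, b, c, d}) = \<bar>det4 a b c d\<bar> / 6"
proof -
  \<comment> \<open>The determinant formula for simplices wants the vertices other than the base
    point \<open>a\<close> enumerated by the index type of the coordinates.\<close>
  define f where "f = (\<lambda>i::3. if i = 1 then b else if i = 2 then c else d)"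
  have bij: "bij_betw f UNIV ({a, b, c, d} - {a})"
    using assms unfolding bij_betw_def UNIV_3 by (auto simp: inj_on_def f_def)
  have "Sigma_Algebra.measure lborel (convex hull {a, b, c, d}) = \<bar>det (\<chi> i j. f j $ i - a $ i)\<bar> / fact CARD(3)"
    by (rule content_simplex[OF _ _ _ bij]) (use assms in auto)
  also have "det (\<chi> i j. f j $ i - a $ i) = det4 a b c d"
    by (simp add: det_3 f_def det4_simps algebra_simps)
  finally have "Sigma_Algebra.measure lborel (convex hull {a, b, c, d}) = \<bar>det4 a b c d\<bar> / 6"
    by (simp add: eval_nat_numeral)
  moreover have "convex hull {a, b, c, d} \<in> sets borel"
    by (simp add: borel_closed compact_imp_closed finite_imp_compact_convex_hull)
  ultimately show ?thesis
    by (simp add: measure_completion)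
qed

text \<open>\<open>det4\<close> is seen to be nonzero through the volume: a convex set of full
  affine dimension has interior points, so it is not negligible, and its measure is a multiple of
  \<open>\<bar>det4 a b c d\<bar>\<close>.\<close>

lemma simplex3_vertices:
  fixes K :: "vec3 set"
  assumes "3 simplex K"
  obtains a b c d where "K = convex hull {a, b, c, d}" "distinct [a, b, c, d]"
    "\<not> affine_dependent {a, b, c, d}" "det4 a b c d \<noteq> 0"
proof -
  obtain C where C: "\<not> affine_dependent C" "int (card C) = 4" "K = convex hull C"
    using assms by (auto simp: simplex_def)
  then have "card C = Suc (Suc (Suc (Suc 0)))" by simp
  then obtain a b c d where abcd: "C = {a, b, c, d}" "distinct [a, b, c, d]"
    by (auto simp: card_Suc_eq)
  have "aff_dim K = 3"
    using aff_dim_affine_independent[OF C(1)] C by (simp add: aff_dim_convex_hull)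
  then have "affine hull K = UNIV"
    using aff_dim_eq_full[of K] by simp
  then have "interior K \<noteq> {}"
    using C rel_interior_interior[of K] rel_interior_eq_empty[of K] by fastforce
  then have "\<not> negligible K"
    by (meson interior_subset negligible_subset open_interior open_not_negligible)
  moreover have "K \<in> lmeasurable"
    using C by (metis convex_convex_hull finite_imp_compact_convex_hull aff_independent_finite
        compact_imp_bounded measurable_convex)
  ultimately have "measure lebesgue K \<noteq> 0"
    by (simp add: negligible_iff_measure)
  then have "det4 a b c d \<noteq> 0"
    using content_tetrahedron[OF abcd(2)] C(3) abcd(1) by auto
  with C abcd show thesis by (intro that) auto
qed

lemma det4_swap: "det4 b a c d = - det4 a b c d" "det4 a c b d = - det4 a b c d" "det4 a b d c = - det4 a b c d"
  by (simp_all add: det4_simps algebra_simps)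

text \<open>Each facet omits one vertex, and its extreme points reveal which one; so the four facets
  are distinct and none is counted twice.\<close>

lemma simplex3_faces:
  fixes a b c d :: vec3
  assumes "distinct [a, b, c, d]" "\<not> affine_dependent {a, b, c, d}"
  shows "(\<Sum>\<sigma>\<in>faces_of (convex hull {a, b, c, d}). f \<sigma>) =
    f (convex hull {b, c, d}) + f (convex hull {a, c, d}) + f (convex hull {a, b, d}) + (f (convex hull {a, b, c}) :: 'b::comm_monoid_add)"
proof -
  let ?S = "{a, b, c, d}"
  have faces: "faces_of (convex hull ?S) = (\<lambda>u. convex hull (?S - {u})) ` ?S"
    unfolding faces_of_def facet_of_convex_hull_affine_independent[OF assms(2)]
    using assms(1) by auto
  have ex: "x extreme_point_of (convex hull (?S - {u})) \<longleftrightarrow> x \<in> ?S - {u}" for x u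
    by (rule extreme_point_of_convex_hull_affine_independent)
      (metis assms(2) affine_dependent_subset Diff_subset)
  have inj: "inj_on (\<lambda>u. convex hull (?S - {u})) ?S"
    by (rule inj_onI) (metis ex DiffI Diff_iff singletonD singletonI)
  have "?S - {a} = {b, c, d}" "?S - {b} = {a, c, d}" "?S - {c} = {a, b, d}" "?S - {d} = {a, b, c}"
    using assms(1) by auto
  then show ?thesis
    unfolding faces sum.reindex[OF inj] using assms(1) by (simp add: add.assoc)
qed

text \<open>Renames the vertices so that the one off the face comes last; later arguments about a
  face need only treat \<open>a\<close>, \<open>b\<close>, \<open>c\<close> opposite to
  \<open>d\<close>.\<close>

lemma simplex3_face_vertices:
  assumes "3 simplex K" "\<sigma> \<in> faces_of K"
  obtains a b c d where "K = convex hull {a, b, c, d}" "\<sigma> = convex hull {a, b, c}" "det4 a b c d \<noteq> 0"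
proof -
  obtain a b c d where K: "K = convex hull {a, b, c, d}" and dist: "distinct [a, b, c, d]"
    and indep: "\<not> affine_dependent {a, b, c, d}" and D: "det4 a b c d \<noteq> 0"
    using assms simplex3_vertices by blast
  obtain u where u: "u \<in> {a, b, c, d}" "\<sigma> = convex hull ({a, b, c, d} - {u})"
    using assms(2) unfolding K faces_of_def facet_of_convex_hull_affine_independent[OF indep] by auto
  from u(1) consider "u = a" | "u = b" | "u = c" | "u = d" by blast
  then show thesis
  proof cases
    case 1
    have "{a, b, c, d} - {u} = {b, c, d}" using dist 1 by auto
    moreover have "{a, b, c, d} = {b, c, d, a}" by auto
    moreover have "det4 b c d a \<noteq> 0" using D det4_swap by (metis neg_equal_0_iff_equal)
    ultimately show ?thesis using that[of b c d a] K u by metis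
  next
    case 2
    have "{a, b, c, d} - {u} = {a, c, d}" using dist 2 by auto
    moreover have "{a, b, c, d} = {a, c, d, b}" by auto
    moreover have "det4 a c d b \<noteq> 0" using D det4_swap by (metis neg_equal_0_iff_equal)
    ultimately show ?thesis using that[of a c d b] K u by metis
  next
    case 3
    have "{a, b, c, d} - {u} = {a, b, d}" using dist 3 by auto
    moreover have "{a, b, c, d} = {a, b, d, c}" by auto
    moreover have "det4 a b d c \<noteq> 0" using D det4_swap by (metis neg_equal_0_iff_equal)
    ultimately show ?thesis using that[of a b d c] K u by metis
  next
    case 4
    have "{a, b, c, d} - {u} = {a, b, c}" using dist 4 by auto
    then show ?thesis using that[of a b c d] K D u by metis
  qed
qed


section \<open>Faces of a tetrahedron and the divergence theorem\<close>

text \<open>Expanding triple products twice: \<open>n\<close> has zero cross product with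
  \<open>cross3 u v\<close>, and then the triple product of \<open>cross3 u v\<close>,
  \<open>n\<close>, \<open>cross3 u v\<close> can be solved for \<open>n\<close>.\<close>

lemma cross3_parallel:
  fixes n u v :: vec3
  assumes "u \<bullet> n = 0" "v \<bullet> n = 0" "cross3 u v \<noteq> 0"
  obtains k where "n = k *\<^sub>R cross3 u v"
proof -
  let ?N = "cross3 u v"
  have "cross3 n ?N = 0"
    using assms by (simp add: Lagrange inner_commute)
  then have "(?N \<bullet> ?N) *\<^sub>R n = (?N \<bullet> n) *\<^sub>R ?N"
    using Lagrange[of ?N n ?N] by simp
  then have "(1 / (?N \<bullet> ?N)) *\<^sub>R ((?N \<bullet> ?N) *\<^sub>R n) = (1 / (?N \<bullet> ?N)) *\<^sub>R ((?N \<bullet> n) *\<^sub>R ?N)"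
    by simp
  then have "n = ((?N \<bullet> n) / (?N \<bullet> ?N)) *\<^sub>R ?N"
    using assms(3) by simp
  then show thesis by (rule that)
qed

context
  fixes a b c d :: vec3 and D N n
  assumes D: "D = det4 a b c d" "D \<noteq> 0"
    and N_def: "N = cross3 (b - a) (c - a)" and n_def: "n = (- sgn D / norm N) *\<^sub>R N"
begin

lemma N_nonzero: "N \<noteq> 0"
  using D by (auto simp: N_def det4_def)

lemma norm_n: "norm n = 1"
  using N_nonzero D by (simp add: n_def abs_sgn_eq)

text \<open>The factor \<open>- sgn D\<close> in \<open>n\<close> is chosen for this formula: the
  signed height over the face is a negative multiple of the barycentric coordinate at
  \<open>d\<close>, whatever the orientation of the vertices. So \<open>n\<close> points away from
  \<open>d\<close>.\<close>

lemma inner_n: "(y - a) \<bullet> n = - (\<bar>D\<bar> / norm N) * (det4 a b c y / D)"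
proof -
  have "sgn D = \<bar>D\<bar> / D"
    using D by (simp add: sgn_if)
  then show ?thesis
    by (simp add: n_def det4_def N_def inner_commute)
qed

lemma inner_n_le: "(y - a) \<bullet> n \<le> 0 \<longleftrightarrow> 0 \<le> det4 a b c y / D"
  and inner_n_less: "(y - a) \<bullet> n < 0 \<longleftrightarrow> 0 < det4 a b c y / D"
proof -
  have sgn: "- k * q \<le> 0 \<longleftrightarrow> 0 \<le> q" "- k * q < 0 \<longleftrightarrow> 0 < q" if "0 < k" for k q :: real
    using that by (simp_all add: zero_le_mult_iff zero_less_mult_iff)
  have "0 < \<bar>D\<bar> / norm N" using N_nonzero D by simp
  then show "(y - a) \<bullet> n \<le> 0 \<longleftrightarrow> 0 \<le> det4 a b c y / D" "(y - a) \<bullet> n < 0 \<longleftrightarrow> 0 < det4 a b c y / D"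
    unfolding inner_n using sgn by blast+
qed

lemma inner_n_face: "x \<in> convex hull {a, b, c} \<Longrightarrow> (x - a) \<bullet> n = 0"
proof -
  have "(b - a) \<bullet> n = 0" "(c - a) \<bullet> n = 0"
    by (simp_all add: n_def N_def dot_cross_self)
  then have "convex hull {a, b, c} \<subseteq> {x. n \<bullet> x = n \<bullet> a}"
    by (intro hull_minimal convex_hyperplane) (auto simp: inner_diff_left inner_diff_right inner_commute)
  moreover assume "x \<in> convex hull {a, b, c}"
  ultimately show ?thesis by (auto simp: inner_diff_left inner_diff_right inner_commute)
qed

lemma inner_n_elem: "y \<in> convex hull {a, b, c, d} \<Longrightarrow> (y - a) \<bullet> n \<le> 0"
proof -
  have "(b - a) \<bullet> n = 0" "(c - a) \<bullet> n = 0"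
    by (simp_all add: n_def N_def dot_cross_self)
  moreover have "(d - a) \<bullet> n \<le> 0"
    using D by (simp add: inner_n_le)
  ultimately have "convex hull {a, b, c, d} \<subseteq> {x. n \<bullet> x \<le> n \<bullet> a}"
    by (intro hull_minimal convex_halfspace_le) (auto simp: inner_diff_left inner_diff_right inner_commute)
  moreover assume "y \<in> convex hull {a, b, c, d}"
  ultimately show ?thesis by (auto simp: inner_diff_left inner_diff_right inner_commute)
qed

text \<open>Orthogonality to two edges leaves only multiples of \<open>N\<close>, and unit length
  leaves only the sign.\<close>

lemma unit_normal_unique:
  assumes "norm m = 1" "\<And>x y. x \<in> convex hull {a, b, c} \<Longrightarrow> y \<in> convex hull {a, b, c} \<Longrightarrow> (y - x) \<bullet> m = 0"
  shows "m = n \<or> m = - n"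
proof -
  have "(b - a) \<bullet> m = 0" "(c - a) \<bullet> m = 0"
    by (rule assms(2); simp add: hull_inc)+
  then obtain k where k: "m = k *\<^sub>R N"
    using N_nonzero unfolding N_def by (rule cross3_parallel)
  have "\<bar>k\<bar> * norm N = 1"
    using assms(1) by (simp add: k)
  then have "\<bar>k\<bar> = 1 / norm N"
    using N_nonzero by (simp add: field_simps)
  then have "k = 1 / norm N \<or> k = - 1 / norm N"
    by (auto simp: abs_if split: if_splits)
  moreover have "sgn D = 1 \<or> sgn D = -1"
    using D by (simp add: sgn_if)
  ultimately show ?thesis
    by (auto simp: k n_def)
qed

text \<open>The vertex \<open>d\<close> lies strictly on the negative side of \<open>n\<close>; this
  excludes \<open>- n\<close>, so the definite description has a unique solution.\<close>

lemma elem_normal_eq: "elem_normal (convex hull {a, b, c, d}) (convex hull {a, b, c}) = n"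
  unfolding elem_normal_def
proof (rule the_equality)
  have *: "(y - x) \<bullet> n = (y - a) \<bullet> n - (x - a) \<bullet> n" for x y
    by (simp add: inner_diff_left)
  show "norm n = 1 \<and> (\<forall>x\<in>convex hull {a, b, c}. \<forall>y\<in>convex hull {a, b, c}. (y - x) \<bullet> n = 0) \<and>
      (\<forall>x\<in>convex hull {a, b, c}. \<forall>y\<in>convex hull {a, b, c, d}. (y - x) \<bullet> n \<le> 0)"
    by (intro conjI ballI; (rule norm_n | (subst *, simp add: inner_n_face inner_n_elem)))
next
  fix m assume m: "norm m = 1 \<and> (\<forall>x\<in>convex hull {a, b, c}. \<forall>y\<in>convex hull {a, b, c}. (y - x) \<bullet> m = 0) \<and>
      (\<forall>x\<in>convex hull {a, b, c}. \<forall>y\<in>convex hull {a, b, c, d}. (y - x) \<bullet> m \<le> 0)"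
  then have "m = n \<or> m = - n"
    using unit_normal_unique by blast
  moreover have "(d - a) \<bullet> m \<le> 0"
    using m by (auto simp: hull_inc)
  moreover have "(d - a) \<bullet> n < 0"
    using D by (simp add: inner_n_less)
  ultimately show "m = n" by auto
qed

text \<open>Weighting by the area cancels the norm in \<open>n\<close>. Up to the sign of
  \<open>D\<close> the weighted normals are polynomial in the vertices, so they can be added in the
  divergence theorem.\<close>

lemma area_scaleR_normal:
  "area (convex hull {a, b, c}) *\<^sub>R elem_normal (convex hull {a, b, c, d}) (convex hull {a, b, c}) = (- sgn D / 2) *\<^sub>R N"
  unfolding elem_normal_eq using N_nonzero
  by (simp add: area_triangle[of b a c, folded N_def] n_def)

lemma near_face:
  assumes x: "x \<in> rel_interior (convex hull {a, b, c})"
  shows "\<forall>\<^sub>F y in nhds x. ((y - x) \<bullet> n \<le> 0 \<longrightarrow> y \<in> convex hull {a, b, c, d}) \<and>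
    ((y - x) \<bullet> n < 0 \<longrightarrow> y \<in> interior (convex hull {a, b, c, d}))"
proof -
  have "x \<in> convex hull {a, b, c}"
    using x rel_interior_subset by blast
  then have "(y - x) \<bullet> n = (y - a) \<bullet> n" for y
    using inner_n_face[of x] by (simp add: inner_diff_left)
  then show ?thesis
    using tetrahedron_near_face[OF D x] by (simp add: inner_n_le inner_n_less)
qed

end

lemma centroid_rel_interior:
  fixes a b c :: vec3
  assumes "cross3 (b - a) (c - a) \<noteq> 0"
  shows "(a + b + c) /\<^sub>R 3 \<in> rel_interior (convex hull {a, b, c})"
proof -
  have indep: "\<not> affine_dependent {a, b, c}" and dist: "distinct [a, b, c]"
    using assms cross3_nonzero_iff by blast+
  show ?thesis
    unfolding rel_interior_convex_hull_explicit[OF indep]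
    by (rule CollectI, rule exI[of _ "\<lambda>_. 1/3"]) (use dist in \<open>auto simp: scaleR_add_right\<close>)
qed

locale tetrahedron_face =
  fixes K \<sigma> :: "vec3 set"
  assumes simplex: "3 simplex K" and face: "\<sigma> \<in> faces_of K"
begin

lemma vertices:
  obtains a b c d where "K = convex hull {a, b, c, d}" "\<sigma> = convex hull {a, b, c}" "det4 a b c d \<noteq> 0"
    "cross3 (b - a) (c - a) \<noteq> 0"
    "elem_normal K \<sigma> = (- sgn (det4 a b c d) / norm (cross3 (b - a) (c - a))) *\<^sub>R cross3 (b - a) (c - a)"
  using simplex3_face_vertices[OF simplex face] elem_normal_eq[OF refl _ refl refl] N_nonzero[OF refl _ refl]
  by metis

lemma norm_normal: "norm (elem_normal K \<sigma>) = 1"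
  using vertices norm_n[OF refl _ refl refl] by metis

lemma normal_outward: "x \<in> \<sigma> \<Longrightarrow> y \<in> K \<Longrightarrow> (y - x) \<bullet> elem_normal K \<sigma> \<le> 0"
proof -
  obtain a where a: "\<And>x. x \<in> \<sigma> \<Longrightarrow> (x - a) \<bullet> elem_normal K \<sigma> = 0" "\<And>x. x \<in> K \<Longrightarrow> (x - a) \<bullet> elem_normal K \<sigma> \<le> 0"
    using vertices inner_n_face[OF refl _ refl refl] inner_n_elem[OF refl _ refl refl] by metis
  have "(y - x) \<bullet> elem_normal K \<sigma> = (y - a) \<bullet> elem_normal K \<sigma> - (x - a) \<bullet> elem_normal K \<sigma>"
    by (simp add: inner_diff_left)
  moreover assume "x \<in> \<sigma>" "y \<in> K"
  ultimately show ?thesis by (simp add: a)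
qed

lemma normal_unique:
  assumes "norm m = 1" "\<And>x y. x \<in> \<sigma> \<Longrightarrow> y \<in> \<sigma> \<Longrightarrow> (y - x) \<bullet> m = 0"
  shows "m = elem_normal K \<sigma> \<or> m = - elem_normal K \<sigma>"
  using vertices unit_normal_unique[OF refl _ refl refl assms(1)] assms(2) by metis

lemma near_face_inside:
  assumes "x \<in> rel_interior \<sigma>"
  shows "\<forall>\<^sub>F y in nhds x. ((y - x) \<bullet> elem_normal K \<sigma> \<le> 0 \<longrightarrow> y \<in> K) \<and>
    ((y - x) \<bullet> elem_normal K \<sigma> < 0 \<longrightarrow> y \<in> interior K)"
proof -
  obtain a b c d where v: "K = convex hull {a, b, c, d}" "\<sigma> = convex hull {a, b, c}" "det4 a b c d \<noteq> 0"
    "elem_normal K \<sigma> = (- sgn (det4 a b c d) / norm (cross3 (b - a) (c - a))) *\<^sub>R cross3 (b - a) (c - a)"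
    by (rule vertices)
  show ?thesis
    by (rule near_face[OF refl v(3) refl refl, folded v(4), folded v(1,2), OF assms])
qed

text \<open>Links normals to elements: a ray leaving a face against the outward normal starts inside
  the element. One-sided traces and the comparison of elements sharing a face both rest on
  this.\<close>

lemma ray_inside:
  assumes "x \<in> rel_interior \<sigma>" "m \<bullet> elem_normal K \<sigma> < 0"
  shows "\<forall>\<^sub>F \<delta> in at_right 0. x + \<delta> *\<^sub>R m \<in> interior K"
proof -
  have "((\<lambda>\<delta>. x + \<delta> *\<^sub>R m) \<longlongrightarrow> x + 0 *\<^sub>R m) (at_right 0)"
    by (intro tendsto_intros)
  then have "filterlim (\<lambda>\<delta>. x + \<delta> *\<^sub>R m) (nhds x) (at_right 0)" by simp
  from eventually_compose_filterlim[OF near_face_inside[OF assms(1)] this] eventually_at_right_less[of 0]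
  show ?thesis
    by eventually_elim (use assms(2) in \<open>auto simp: mult_pos_neg\<close>)
qed

lemma face_centre_rel_interior: "face_centre \<sigma> \<in> rel_interior \<sigma>"
  using vertices centroid_rel_interior face_centre_triangle by metis

lemma face_subset: "\<sigma> \<subseteq> K"
  using face by (simp add: faces_of_def facet_of_imp_subset)

lemma area_pos: "0 < area \<sigma>"
  using vertices area_triangle by (metis half_gt_zero zero_less_norm_iff)

lemma surf_int_affine:
  assumes "linear A" "\<And>x. x \<in> \<sigma> \<Longrightarrow> f x = A x + d"
  shows "surf_int \<sigma> f = area \<sigma> *\<^sub>R (A (face_centre \<sigma>) + d)"
proof -
  obtain a b c where v: "\<sigma> = convex hull {a, b, c}" "cross3 (b - a) (c - a) \<noteq> 0"
    by (rule vertices)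
  show ?thesis
    using surf_int_affine_triangle[OF v(2) assms(1), of f d] assms(2)
    unfolding v(1) area_triangle[OF v(2)] face_centre_triangle[OF v(2)] by blast
qed

lemma surf_int_const:
  fixes d :: "'b::real_normed_vector"
  assumes "\<And>x. x \<in> \<sigma> \<Longrightarrow> f x = d"
  shows "surf_int \<sigma> f = area \<sigma> *\<^sub>R d"
  using surf_int_affine[of "\<lambda>_. 0" f d] assms linear_zero by simp

end

text \<open>The derivative of the determinant of three columns when \<open>M\<close> acts on one
  column at a time; for linear fields this is the divergence in disguise.\<close>

lemma cross3_trace_identity:
  fixes M :: "real^3^3"
  shows "cross3 x y \<bullet> (M *v z) + cross3 y z \<bullet> (M *v x) + cross3 z x \<bullet> (M *v y) = (cross3 x y \<bullet> z) * trace M"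
  by (simp add: det4_simps matrix_vector_mult_def trace_def algebra_simps)

text \<open>The area-weighted normals are half cross products of edges and sum to zero, so
  \<open>e\<close> drops out. Centroids of two faces differ by a third of an edge, which leaves the
  three terms of \<open>cross3_trace_identity\<close>; the factor 1/2 * 1/3 is the 1/6 of the
  volume.\<close>

lemma divergence_simplex3:
  fixes F :: "vec3 \<Rightarrow> vec3"
  assumes "3 simplex K" "linear F"
  shows "(\<Sum>\<sigma>\<in>faces_of K. area \<sigma> * ((F (face_centre \<sigma>) + e) \<bullet> elem_normal K \<sigma>)) =
    measure lebesgue K * trace (matrix F)"
proof -
  obtain a b c d where K: "K = convex hull {a, b, c, d}" and dist: "distinct [a, b, c, d]"
    and indep: "\<not> affine_dependent {a, b, c, d}" and D: "det4 a b c d \<noteq> 0"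
    using assms(1) by (rule simplex3_vertices)
  define x y z where xyz: "x = b - a" "y = c - a" "z = d - a"
  define P Q R where PQR: "P = cross3 x y" "Q = cross3 y z" "R = cross3 z x"
  let ?D = "det4 a b c d"
  let ?s = "sgn ?D / 2"
  note F = linear_add[OF assms(2)] linear_scale[OF assms(2)] linear_diff[OF assms(2)]
  have hulls: "convex hull {b, c, d, a} = K" "convex hull {a, c, d, b} = K" "convex hull {a, b, d, c} = K"
    unfolding K by (rule arg_cong[of _ _ "\<lambda>S. convex hull S"]; blast)+
  \<comment> \<open>Moving the omitted vertex to the end is an odd or an even permutation; together
    with \<open>N\<close> this fixes the signs of the weighted normals.\<close>
  have dets: "det4 b c d a = - ?D" "det4 a c d b = ?D" "det4 a b d c = - ?D"
    by (simp_all add: det4_simps algebra_simps)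
  have N: "cross3 (c - b) (d - b) = P + Q + R" "cross3 (c - a) (d - a) = Q" "cross3 (b - a) (d - a) = - R"
    "cross3 (b - a) (c - a) = P"
    unfolding PQR xyz by (simp_all add: cross3_simps)
  have move: "area \<tau> * (w \<bullet> elem_normal K \<tau>) = k * (w \<bullet> M)" if "area \<tau> *\<^sub>R elem_normal K \<tau> = k *\<^sub>R M" for \<tau> w k M
    by (metis that inner_scaleR_right)
  have normals: "area (convex hull {b, c, d}) *\<^sub>R elem_normal K (convex hull {b, c, d}) = ?s *\<^sub>R (P + Q + R)"
    "area (convex hull {a, c, d}) *\<^sub>R elem_normal K (convex hull {a, c, d}) = (- ?s) *\<^sub>R Q"
    "area (convex hull {a, b, d}) *\<^sub>R elem_normal K (convex hull {a, b, d}) = (- ?s) *\<^sub>R R"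
    "area (convex hull {a, b, c}) *\<^sub>R elem_normal K (convex hull {a, b, c}) = (- ?s) *\<^sub>R P"
    using area_scaleR_normal[of _ b c d a] area_scaleR_normal[of _ a c d b] area_scaleR_normal[of _ a b d c]
      area_scaleR_normal[of _ a b c d] D unfolding hulls dets N K[symmetric] by (simp_all add: sgn_minus)
  have "cross3 (c - b) (d - b) \<noteq> 0" "cross3 (c - a) (d - a) \<noteq> 0" "cross3 (b - a) (d - a) \<noteq> 0" "cross3 (b - a) (c - a) \<noteq> 0"
    using N_nonzero[of _ b c d a] N_nonzero[of _ a c d b] N_nonzero[of _ a b d c]
      N_nonzero[of _ a b c d] D unfolding dets by simp_all
  note centres = this[THEN face_centre_triangle]
  have "(\<Sum>\<sigma>\<in>faces_of K. area \<sigma> * ((F (face_centre \<sigma>) + e) \<bullet> elem_normal K \<sigma>)) =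
      ?s * ((F ((b + c + d) /\<^sub>R 3) + e) \<bullet> (P + Q + R) - (F ((a + c + d) /\<^sub>R 3) + e) \<bullet> Q
        - (F ((a + b + d) /\<^sub>R 3) + e) \<bullet> R - (F ((a + b + c) /\<^sub>R 3) + e) \<bullet> P)"
    by (simp only: simplex3_faces[OF dist indep, folded K] normals[THEN move] centres ring_distribs)
  also have "\<dots> = ?s * ((P \<bullet> F z + Q \<bullet> F x + R \<bullet> F y) / 3)"
    unfolding xyz by (simp add: F inner_add_left inner_add_right inner_diff_right inner_commute) (simp add: field_simps)
  also have "P \<bullet> F z + Q \<bullet> F x + R \<bullet> F y = ?D * trace (matrix F)"
    using cross3_trace_identity[of x y "matrix F" z] fun_cong[OF matrix_vector_mul(2)[OF assms(2)]]
    by (simp add: det4_def xyz PQR)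
  also have "?s * (?D * trace (matrix F) / 3) = \<bar>?D\<bar> / 6 * trace (matrix F)"
    by (simp add: sgn_if)
  finally show ?thesis
    unfolding content_tetrahedron[OF dist, folded K] .
qed


section \<open>The mesh\<close>

lemma simplex3_properties:
  fixes K :: "vec3 set"
  assumes "3 simplex K"
  shows simplex3_convex: "convex K" and simplex3_compact: "compact K" and simplex3_aff_dim: "aff_dim K = 3"
    and simplex3_interior: "interior K \<noteq> {}" and simplex3_closure_interior: "closure (interior K) = K"
    and simplex3_finite_faces: "finite (faces_of K)" and simplex3_measure_pos: "0 < measure lebesgue K"
proof -
  obtain a b c d where K: "K = convex hull {a, b, c, d}" and dist: "distinct [a, b, c, d]"
    and indep: "\<not> affine_dependent {a, b, c, d}" and D: "det4 a b c d \<noteq> 0"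
    using assms by (rule simplex3_vertices)
  show "convex K" "compact K"
    by (simp_all add: K finite_imp_compact_convex_hull)
  show dim: "aff_dim K = 3"
    using aff_dim_affine_independent[OF indep] dist by (simp add: K aff_dim_convex_hull)
  then have "affine hull K = UNIV"
    using aff_dim_eq_full[of K] by simp
  then show int: "interior K \<noteq> {}"
    using rel_interior_interior[of K] rel_interior_eq_empty[OF \<open>convex K\<close>] by fastforce
  show "closure (interior K) = K"
    using convex_closure_interior[OF \<open>convex K\<close> int] \<open>compact K\<close>
    by (simp add: compact_imp_closed closure_closed)
  show "finite (faces_of K)"
    unfolding faces_of_def by (rule finite_polytope_facets) (simp add: K polytope_convex_hull)
  show "0 < measure lebesgue K"
    using content_tetrahedron[OF dist] D by (simp add: K)
qed

text \<open>A tetrahedron is the closure of its interior, so each of its points is a limit point of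
  the interior and the limit is that of any continuous \<open>f\<close> agreeing with
  \<open>g\<close> inside.\<close>

lemma elem_trace_eq:
  fixes g :: "vec3 \<Rightarrow> 'b::t2_space"
  assumes "3 simplex K" "x \<in> K" "\<And>y. y \<in> interior K \<Longrightarrow> g y = f y" "isCont f x"
  shows "elem_trace K g x = f x"
proof -
  have "x islimpt interior K"
  proof (cases "x \<in> interior K")
    case True
    then show ?thesis
      by (simp add: interior_limit_point interior_interior)
  next
    case False
    then show ?thesis
      using simplex3_closure_interior[OF assms(1)] assms(2) by (auto simp: closure_def)
  qed
  then have nt: "at x within interior K \<noteq> bot"
    by (simp add: trivial_limit_within)
  have "(f \<longlongrightarrow> f x) (at x within interior K)"
    using assms(4) by (metis isCont_def tendsto_within_subset subset_UNIV)
  moreover have "\<forall>\<^sub>F y in at x within interior K. f y = g y"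
    by (simp add: eventually_at_filter assms(3))
  ultimately have "(g \<longlongrightarrow> f x) (at x within interior K)"
    by (metis (mono_tags, lifting) tendsto_cong)
  then show ?thesis
    unfolding elem_trace_def by (rule tendsto_Lim[OF nt])
qed

lemma elem_trace_const:
  assumes "3 simplex K" "x \<in> K" "\<And>y. y \<in> interior K \<Longrightarrow> g y = k"
  shows "elem_trace K g x = k"
  using elem_trace_eq[of K x g "\<lambda>_. k"] assms by simp

lemma elem_val_eq:
  assumes "3 simplex K" "\<And>y. y \<in> interior K \<Longrightarrow> g y = k"
  shows "elem_val K g = k"
  unfolding elem_val_def using simplex3_interior[OF assms(1)] assms(2) by (intro the_equality) auto

lemma at_right_0_witness:
  fixes P :: "real \<Rightarrow> bool"
  assumes "\<forall>\<^sub>F t in at_right 0. P t"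
  obtains t where "0 < t" "P t"
proof -
  have "\<forall>\<^sub>F t in at_right 0. 0 < t \<and> P t"
    using assms eventually_at_right_less[of "0 :: real"] by eventually_elim simp
  from eventually_happens'[OF _ this] show thesis
    using that by auto
qed

text \<open>Rules out slits, where the domain would lie on both sides of its boundary. From a point
  \<open>x\<close> outside \<open>\<Omega>\<close>, a small step against \<open>e\<close> keeps the
  base point and drops below the graph of \<open>\<gamma>\<close>. The region below the graph is
  open and misses \<open>\<Omega>\<close>, hence also its closure, so \<open>x\<close> cannot be
  interior to the closure.\<close>

lemma interior_closure_lipschitz:
  fixes \<Omega> :: "vec3 set"
  assumes "open \<Omega>" "lipschitz_boundary \<Omega>"
  shows "interior (closure \<Omega>) = \<Omega>"
proof
  show "\<Omega> \<subseteq> interior (closure \<Omega>)"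
    using assms(1) by (simp add: closure_subset interior_maximal)
  show "interior (closure \<Omega>) \<subseteq> \<Omega>"
  proof (rule ccontr)
    assume "\<not> interior (closure \<Omega>) \<subseteq> \<Omega>"
    then obtain x where x: "x \<in> interior (closure \<Omega>)" "x \<notin> \<Omega>" by blast
    then have "x \<in> frontier \<Omega>"
      using assms(1) interior_subset by (auto simp: frontier_def interior_open)
    then obtain e r L and \<gamma> :: "vec3 \<Rightarrow> real" where e: "norm e = 1" and r: "0 < r"
      and lip: "lipschitz_on L {z. z \<bullet> e = 0} \<gamma>"
      and graph: "\<And>y. y \<in> ball x r \<Longrightarrow> y \<in> \<Omega> \<longleftrightarrow> \<gamma> (y - (y \<bullet> e) *\<^sub>R e) < y \<bullet> e"
      using assms(2) unfolding lipschitz_boundary_def by blast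
    have ee: "e \<bullet> e = 1"
      using e by (simp add: dot_square_norm)
    have cont: "continuous_on UNIV (\<lambda>z. \<gamma> (z - (z \<bullet> e) *\<^sub>R e))"
      by (rule continuous_on_compose2[OF lipschitz_on_continuous_on[OF lip]])
        (auto intro!: continuous_intros simp: inner_diff_left ee)
    let ?U = "ball x r \<inter> interior (closure \<Omega>) \<inter> {z. z \<bullet> e < \<gamma> (z - (z \<bullet> e) *\<^sub>R e)}"
    have "open ?U"
      by (intro open_Int open_Collect_less cont continuous_intros) auto
    moreover have "?U \<inter> \<Omega> = {}"
      using graph by auto
    ultimately have "?U \<inter> closure \<Omega> = {}"
      by (simp add: open_Int_closure_eq_empty)
    then have U: "?U = {}"
      using interior_subset by blast
    have "((\<lambda>t. x - t *\<^sub>R e) \<longlongrightarrow> x - 0 *\<^sub>R e) (at_right 0)"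
      by (intro tendsto_intros)
    then have lim: "((\<lambda>t. x - t *\<^sub>R e) \<longlongrightarrow> x) (at_right 0)" by simp
    have "\<forall>\<^sub>F t in at_right 0. x - t *\<^sub>R e \<in> ball x r \<inter> interior (closure \<Omega>)"
      by (rule topological_tendstoD[OF lim]) (use r x in \<open>auto intro: open_Int\<close>)
    then obtain t where t: "0 < t" "x - t *\<^sub>R e \<in> ball x r \<inter> interior (closure \<Omega>)"
      by (rule at_right_0_witness)
    have te: "(x - t *\<^sub>R e) \<bullet> e = x \<bullet> e - t"
      by (simp add: inner_diff_left ee)
    then have tp: "x - t *\<^sub>R e - ((x - t *\<^sub>R e) \<bullet> e) *\<^sub>R e = x - (x \<bullet> e) *\<^sub>R e"
      by (simp add: algebra_simps)
    have "x \<bullet> e \<le> \<gamma> (x - (x \<bullet> e) *\<^sub>R e)"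
      using graph[of x] r x(2) by simp
    then have "(x - t *\<^sub>R e) \<bullet> e < \<gamma> (x - t *\<^sub>R e - ((x - t *\<^sub>R e) \<bullet> e) *\<^sub>R e)"
      unfolding tp unfolding te using t(1) by linarith
    with t have "x - t *\<^sub>R e \<in> ?U"
      by blast
    with U show False by blast
  qed
qed

section \<open>Incidence of elements and faces\<close>

locale tetrahedral_mesh =
  fixes \<Omega> :: "vec3 set" and \<T> :: "vec3 set set" and \<nu> :: "vec3 set \<Rightarrow> vec3"
  assumes domain: "polyhedral_lipschitz_domain \<Omega>" and mesh: "tet_mesh \<Omega> \<T>"
    and normals: "face_normals \<Omega> \<T> \<nu>"
begin

lemma finite_mesh: "finite \<T>"
  and mesh_simplex: "K \<in> \<T> \<Longrightarrow> 3 simplex K"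
  and Int_face: "K \<in> \<T> \<Longrightarrow> L \<in> \<T> \<Longrightarrow> (K \<inter> L) face_of K"
  and Union_mesh: "\<Union>\<T> = closure \<Omega>"
  using mesh by (auto simp: tet_mesh_def triangulation_def)

lemma open_domain: "open \<Omega>" and interior_closure_domain: "interior (closure \<Omega>) = \<Omega>"
  using domain interior_closure_lipschitz by (auto simp: polyhedral_lipschitz_domain_def)

lemma tetrahedron_face: "K \<in> \<T> \<Longrightarrow> \<sigma> \<in> faces_of K \<Longrightarrow> tetrahedron_face K \<sigma>"
  by (simp add: tetrahedron_face_def mesh_simplex)

lemma normal: "\<sigma> \<in> faces \<T> \<Longrightarrow> norm (\<nu> \<sigma>) = 1"
  "\<sigma> \<in> faces \<T> \<Longrightarrow> x \<in> \<sigma> \<Longrightarrow> y \<in> \<sigma> \<Longrightarrow> (y - x) \<bullet> \<nu> \<sigma> = 0"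
  using normals by (auto simp: face_normals_def)

lemma interiors_disjoint:
  assumes "K \<in> \<T>" "L \<in> \<T>" "x \<in> interior K" "x \<in> interior L"
  shows "K = L"
proof -
  have "x \<in> K \<inter> L" using assms interior_subset by blast
  then have "K \<inter> L = K" "L \<inter> K = L"
    using face_of_disjoint_interior[OF Int_face[OF assms(1,2)]] face_of_disjoint_interior[OF Int_face[OF assms(2,1)]]
      assms(3,4) by blast+
  then show ?thesis by blast
qed

lemma elem_normal_cases:
  assumes "K \<in> \<T>" "\<sigma> \<in> faces_of K"
  shows "elem_normal K \<sigma> = \<nu> \<sigma> \<or> elem_normal K \<sigma> = - \<nu> \<sigma>"
proof -
  interpret tetrahedron_face K \<sigma> using tetrahedron_face[OF assms] .
  have "\<sigma> \<in> faces \<T>" using assms by (auto simp: faces_def)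
  from normal_unique[OF normal(1)[OF this] normal(2)[OF this]] show ?thesis
    by (metis minus_minus)
qed

text \<open>With a common normal, both elements contain the start of the ray from the face centre
  against it, so their interiors meet.\<close>

lemma elem_eq_if_normal_eq:
  assumes "K \<in> \<T>" "L \<in> \<T>" "\<sigma> \<in> faces_of K" "\<sigma> \<in> faces_of L" "elem_normal K \<sigma> = elem_normal L \<sigma>"
  shows "K = L"
proof -
  interpret K: tetrahedron_face K \<sigma> using tetrahedron_face assms by blast
  interpret L: tetrahedron_face L \<sigma> using tetrahedron_face assms by blast
  let ?n = "elem_normal K \<sigma>"
  have "(- ?n) \<bullet> ?n < 0"
    using K.norm_normal by (auto simp: dot_square_norm)
  then have "\<forall>\<^sub>F \<delta> in at_right 0. face_centre \<sigma> + \<delta> *\<^sub>R (- ?n) \<in> interior K"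
    "\<forall>\<^sub>F \<delta> in at_right 0. face_centre \<sigma> + \<delta> *\<^sub>R (- ?n) \<in> interior L"
    using K.ray_inside[OF K.face_centre_rel_interior] L.ray_inside[OF K.face_centre_rel_interior] assms(5) by metis+
  then have "\<forall>\<^sub>F \<delta> in at_right 0. face_centre \<sigma> + \<delta> *\<^sub>R (- ?n) \<in> interior K \<inter> interior L"
    by eventually_elim simp
  then obtain y where "y \<in> interior K \<inter> interior L"
    by (rule at_right_0_witness)
  with interiors_disjoint assms show ?thesis by blast
qed

text \<open>With the opposite sign, \<open>K\<close> would contain points reached from the face
  centre along \<open>\<nu> \<sigma>\<close>, which \<open>outer_normal\<close> places outside the
  closure of the domain.\<close>

lemma exterior_normal:
  assumes "K \<in> \<T>" "\<sigma> \<in> faces_of K" "\<sigma> \<in> faces_ext \<Omega> \<T>"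
  shows "elem_normal K \<sigma> = \<nu> \<sigma>"
proof (rule ccontr)
  interpret tetrahedron_face K \<sigma> using tetrahedron_face assms by blast
  let ?x = "face_centre \<sigma>"
  assume "elem_normal K \<sigma> \<noteq> \<nu> \<sigma>"
  then have neg: "elem_normal K \<sigma> = - \<nu> \<sigma>"
    using elem_normal_cases assms by blast
  have "outer_normal \<Omega> ?x (\<nu> \<sigma>)"
    using normals assms(3) face_centre_rel_interior by (auto simp: face_normals_def)
  then have n1: "norm (\<nu> \<sigma>) = 1"
    and out: "\<And>\<epsilon>. 0 < \<epsilon> \<Longrightarrow> \<exists>r>0. \<forall>y\<in>ball ?x r. \<epsilon> * norm (y - ?x) < (y - ?x) \<bullet> \<nu> \<sigma> \<longrightarrow> y \<notin> closure \<Omega>"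
    unfolding outer_normal_def by blast+
  \<comment> \<open>Along \<open>\<nu> \<sigma>\<close> the inner product equals the distance, so
    any constant strictly between 0 and 1 would do for the cone.\<close>
  obtain r where r: "0 < r" and far: "\<And>y. y \<in> ball ?x r \<Longrightarrow> 1/2 * norm (y - ?x) < (y - ?x) \<bullet> \<nu> \<sigma> \<Longrightarrow> y \<notin> closure \<Omega>"
    using out[of "1/2"] by auto
  have nn: "\<nu> \<sigma> \<bullet> \<nu> \<sigma> = 1" using n1 by (simp add: dot_square_norm)
  have "\<forall>\<^sub>F \<delta> in at_right 0. ?x + \<delta> *\<^sub>R \<nu> \<sigma> \<in> interior K"
    by (rule ray_inside[OF face_centre_rel_interior]) (simp add: neg nn)
  moreover have "\<forall>\<^sub>F \<delta> in at_right 0. \<delta> < r"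
    using r by (auto simp: eventually_at_right)
  ultimately have "\<forall>\<^sub>F \<delta> in at_right 0. \<delta> < r \<and> ?x + \<delta> *\<^sub>R \<nu> \<sigma> \<in> interior K"
    by eventually_elim simp
  then obtain \<delta> where \<delta>: "0 < \<delta>" "\<delta> < r" "?x + \<delta> *\<^sub>R \<nu> \<sigma> \<in> interior K"
    by (rule at_right_0_witness) auto
  have "?x + \<delta> *\<^sub>R \<nu> \<sigma> \<notin> closure \<Omega>"
    by (rule far) (use \<delta> n1 nn in \<open>simp_all add: dist_norm\<close>)
  moreover have "?x + \<delta> *\<^sub>R \<nu> \<sigma> \<in> closure \<Omega>"
    using \<delta>(3) assms(1) Union_mesh interior_subset by blast
  ultimately show False by contradiction
qed

text \<open>The relative interior is dense in the face, so it has a point \<open>x\<close> in the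
  open set \<open>\<Omega>\<close>. A small step along the outward normal leaves \<open>K\<close>
  but not \<open>\<Omega>\<close> and lands in an element \<open>L\<close>. The common face of
  \<open>K\<close> and \<open>L\<close> contains \<open>x\<close>, hence all of
  \<open>\<sigma>\<close>; its dimension is below 3, so it is \<open>\<sigma>\<close>.\<close>

lemma interior_face_neighbour:
  assumes "K \<in> \<T>" "\<sigma> \<in> faces_of K" "\<sigma> \<in> faces_int \<Omega> \<T>"
  obtains L where "L \<in> \<T>" "\<sigma> \<in> faces_of L" "L \<noteq> K"
proof -
  interpret tetrahedron_face K \<sigma> using tetrahedron_face assms by blast
  have sub: "\<sigma> \<subseteq> closure \<Omega>"
    using face_subset assms(1) Union_mesh by blast
  have "\<not> \<sigma> \<subseteq> frontier \<Omega>"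
    using assms by (auto simp: faces_int_def faces_ext_def)
  then have "\<sigma> \<inter> \<Omega> \<noteq> {}"
    using sub open_domain by (auto simp: frontier_def interior_open)
  moreover have cl: "\<sigma> \<subseteq> closure (rel_interior \<sigma>)"
    by (rule vertices) (metis convex_closure_rel_interior convex_convex_hull closure_subset)
  ultimately have "\<Omega> \<inter> closure (rel_interior \<sigma>) \<noteq> {}" by blast
  then obtain x where x: "x \<in> rel_interior \<sigma>" "x \<in> \<Omega>"
    using open_Int_closure_eq_empty[OF open_domain] by blast
  have x\<sigma>: "x \<in> \<sigma>" using x rel_interior_subset by blast
  let ?n = "elem_normal K \<sigma>"
  \<comment> \<open>Removing the finitely many closed elements that miss \<open>x\<close> guarantees
    that the element hit by the step contains \<open>x\<close>.\<close>
  let ?U = "\<Omega> - \<Union>{M \<in> \<T>. x \<notin> M}"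
  have "closed (\<Union>{M \<in> \<T>. x \<notin> M})"
    using finite_mesh mesh_simplex simplex3_compact by (intro closed_Union) (auto simp: compact_imp_closed)
  then have "open ?U" using open_domain by blast
  have "((\<lambda>t. x + t *\<^sub>R ?n) \<longlongrightarrow> x + 0 *\<^sub>R ?n) (at_right 0)"
    by (intro tendsto_intros)
  then have lim: "((\<lambda>t. x + t *\<^sub>R ?n) \<longlongrightarrow> x) (at_right 0)" by simp
  have "\<forall>\<^sub>F t in at_right 0. x + t *\<^sub>R ?n \<in> ?U"
    by (rule topological_tendstoD[OF lim \<open>open ?U\<close>]) (use x in auto)
  then obtain t where t: "0 < t" "x + t *\<^sub>R ?n \<in> ?U"
    by (rule at_right_0_witness)
  then obtain L where L: "L \<in> \<T>" "x + t *\<^sub>R ?n \<in> L" "x \<in> L"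
    using Union_mesh closure_subset by blast
  have "x + t *\<^sub>R ?n \<notin> K"
  proof
    assume "x + t *\<^sub>R ?n \<in> K"
    from normal_outward[OF x\<sigma> this] t(1) norm_normal show False
      by (simp add: dot_square_norm)
  qed
  then have LK: "L \<noteq> K" using L by blast
  have face: "(K \<inter> L) face_of K" "(K \<inter> L) face_of L"
    using Int_face assms(1) L(1) by (metis Int_commute)+
  have "\<sigma> \<subseteq> K \<inter> L"
    by (rule subset_of_face_of[OF face(1) face_subset]) (use x x\<sigma> L face_subset in blast)
  have "K \<inter> L \<noteq> K"
  proof
    assume "K \<inter> L = K"
    then have "K face_of L" using face by simp
    then have "aff_dim K < aff_dim L"
      using LK L by (intro face_of_aff_dim_lt) (auto intro: simplex3_convex mesh_simplex)
    then show False using simplex3_aff_dim mesh_simplex L(1) assms(1) by simp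
  qed
  then have dim: "aff_dim (K \<inter> L) < 3"
    using face_of_aff_dim_lt[OF simplex3_convex[OF mesh_simplex[OF assms(1)]] face(1)] simplex3_aff_dim[OF mesh_simplex[OF assms(1)]]
    by simp
  have \<sigma>face: "\<sigma> face_of K" "aff_dim \<sigma> = 2"
    using assms(2) simplex3_aff_dim[OF mesh_simplex[OF assms(1)]] by (auto simp: faces_of_def facet_of_def)
  have "\<sigma> = K \<inter> L"
  proof (rule ccontr)
    assume "\<sigma> \<noteq> K \<inter> L"
    moreover have "\<sigma> face_of (K \<inter> L)"
      by (rule face_of_subset[OF \<sigma>face(1)]) (use \<open>\<sigma> \<subseteq> K \<inter> L\<close> in auto)
    ultimately have "aff_dim \<sigma> < aff_dim (K \<inter> L)"
      by (intro face_of_aff_dim_lt) (auto intro: convex_Int simplex3_convex mesh_simplex assms L)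
    then show False using dim \<sigma>face by simp
  qed
  then have "\<sigma> \<in> faces_of L"
    using face(2) \<sigma>face(2) x\<sigma> simplex3_aff_dim[OF mesh_simplex[OF L(1)]] by (auto simp: faces_of_def facet_of_def)
  with L LK show thesis by (intro that)
qed

text \<open>The normal \<open>\<nu> \<sigma>\<close> points from \<open>elem_m \<sigma>\<close> into \<open>elem_p \<sigma>\<close>; on exterior faces only \<open>elem_m \<sigma>\<close> is
  meaningful.\<close>

definition elem_m :: "vec3 set \<Rightarrow> vec3 set" where
  "elem_m \<sigma> = (THE K. K \<in> \<T> \<and> \<sigma> \<in> faces_of K \<and> elem_normal K \<sigma> = \<nu> \<sigma>)"

definition elem_p :: "vec3 set \<Rightarrow> vec3 set" where
  "elem_p \<sigma> = (THE K. K \<in> \<T> \<and> \<sigma> \<in> faces_of K \<and> elem_normal K \<sigma> = - \<nu> \<sigma>)"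

lemma elem_m_eqI: "K \<in> \<T> \<Longrightarrow> \<sigma> \<in> faces_of K \<Longrightarrow> elem_normal K \<sigma> = \<nu> \<sigma> \<Longrightarrow> elem_m \<sigma> = K"
  unfolding elem_m_def by (rule the_equality) (blast, metis elem_eq_if_normal_eq)

lemma elem_p_eqI: "K \<in> \<T> \<Longrightarrow> \<sigma> \<in> faces_of K \<Longrightarrow> elem_normal K \<sigma> = - \<nu> \<sigma> \<Longrightarrow> elem_p \<sigma> = K"
  unfolding elem_p_def by (rule the_equality) (blast, metis elem_eq_if_normal_eq)

lemma normal_nonzero: "\<sigma> \<in> faces \<T> \<Longrightarrow> \<nu> \<sigma> \<noteq> - \<nu> \<sigma>"
proof
  assume "\<sigma> \<in> faces \<T>" "\<nu> \<sigma> = - \<nu> \<sigma>"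
  then have "\<nu> \<sigma> + \<nu> \<sigma> = 0"
    by (metis add.right_inverse)
  then have "2 *\<^sub>R \<nu> \<sigma> = 0"
    by (simp only: scaleR_2)
  with normal(1)[OF \<open>\<sigma> \<in> faces \<T>\<close>] show False by simp
qed

text \<open>Two neighbours exist and have different normals, while only
  \<open>\<nu> \<sigma>\<close> and its negative are possible and each determines its element. So
  one element of each kind exists, and no third.\<close>

lemma interior_face_elems:
  assumes "\<sigma> \<in> faces_int \<Omega> \<T>"
  shows "elem_m \<sigma> \<in> \<T> \<and> \<sigma> \<in> faces_of (elem_m \<sigma>) \<and> elem_normal (elem_m \<sigma>) \<sigma> = \<nu> \<sigma>"
    and "elem_p \<sigma> \<in> \<T> \<and> \<sigma> \<in> faces_of (elem_p \<sigma>) \<and> elem_normal (elem_p \<sigma>) \<sigma> = - \<nu> \<sigma>"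
    and "{K \<in> \<T>. \<sigma> \<in> faces_of K} = {elem_m \<sigma>, elem_p \<sigma>}" and "elem_m \<sigma> \<noteq> elem_p \<sigma>"
proof -
  obtain K where K: "K \<in> \<T>" "\<sigma> \<in> faces_of K"
    using assms by (auto simp: faces_int_def faces_def)
  obtain L where L: "L \<in> \<T>" "\<sigma> \<in> faces_of L" "L \<noteq> K"
    using interior_face_neighbour[OF K assms] by blast
  have ne: "elem_normal K \<sigma> \<noteq> elem_normal L \<sigma>"
    using elem_eq_if_normal_eq K L by blast
  have "elem_normal K \<sigma> = \<nu> \<sigma> \<and> elem_normal L \<sigma> = - \<nu> \<sigma> \<or> elem_normal K \<sigma> = - \<nu> \<sigma> \<and> elem_normal L \<sigma> = \<nu> \<sigma>"
    using elem_normal_cases K L ne by metis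
  then have ex: "\<exists>K. K \<in> \<T> \<and> \<sigma> \<in> faces_of K \<and> elem_normal K \<sigma> = \<nu> \<sigma>"
    "\<exists>K. K \<in> \<T> \<and> \<sigma> \<in> faces_of K \<and> elem_normal K \<sigma> = - \<nu> \<sigma>"
    using K L by blast+
  then show m: "elem_m \<sigma> \<in> \<T> \<and> \<sigma> \<in> faces_of (elem_m \<sigma>) \<and> elem_normal (elem_m \<sigma>) \<sigma> = \<nu> \<sigma>"
    and p: "elem_p \<sigma> \<in> \<T> \<and> \<sigma> \<in> faces_of (elem_p \<sigma>) \<and> elem_normal (elem_p \<sigma>) \<sigma> = - \<nu> \<sigma>"
    using elem_m_eqI elem_p_eqI by metis+
  show "{K \<in> \<T>. \<sigma> \<in> faces_of K} = {elem_m \<sigma>, elem_p \<sigma>}"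
    using m p elem_normal_cases elem_m_eqI elem_p_eqI by blast
  show "elem_m \<sigma> \<noteq> elem_p \<sigma>"
    using m p normal_nonzero assms by (metis DiffD1 faces_int_def)
qed

text \<open>All elements with this face have normal \<open>\<nu> \<sigma>\<close> and therefore
  coincide; in particular the choice in \<open>adj_elem\<close> is forced.\<close>

lemma exterior_face_elem:
  assumes "\<sigma> \<in> faces_ext \<Omega> \<T>"
  shows "elem_m \<sigma> \<in> \<T> \<and> \<sigma> \<in> faces_of (elem_m \<sigma>) \<and> elem_normal (elem_m \<sigma>) \<sigma> = \<nu> \<sigma>"
    and "{K \<in> \<T>. \<sigma> \<in> faces_of K} = {elem_m \<sigma>}" and "adj_elem \<T> \<sigma> = elem_m \<sigma>"
proof -
  obtain K where K: "K \<in> \<T>" "\<sigma> \<in> faces_of K"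
    using assms by (auto simp: faces_ext_def faces_def)
  have *: "L = elem_m \<sigma>" if "L \<in> \<T>" "\<sigma> \<in> faces_of L" for L
    using elem_m_eqI that exterior_normal assms by metis
  show "elem_m \<sigma> \<in> \<T> \<and> \<sigma> \<in> faces_of (elem_m \<sigma>) \<and> elem_normal (elem_m \<sigma>) \<sigma> = \<nu> \<sigma>"
    using * K exterior_normal assms by metis
  then show "{K \<in> \<T>. \<sigma> \<in> faces_of K} = {elem_m \<sigma>}"
    using * by blast
  show "adj_elem \<T> \<sigma> = elem_m \<sigma>"
    unfolding adj_elem_def using K * by (metis (mono_tags, lifting) someI)
qed

lemma faces_split: "faces \<T> = faces_int \<Omega> \<T> \<union> faces_ext \<Omega> \<T>" "faces_int \<Omega> \<T> \<inter> faces_ext \<Omega> \<T> = {}"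
  by (auto simp: faces_int_def faces_ext_def)

lemma finite_faces: "finite (faces \<T>)" "finite (faces_int \<Omega> \<T>)" "finite (faces_ext \<Omega> \<T>)"
proof -
  show "finite (faces \<T>)"
    unfolding faces_def using finite_mesh mesh_simplex simplex3_finite_faces by blast
  then show "finite (faces_int \<Omega> \<T>)" "finite (faces_ext \<Omega> \<T>)"
    using faces_split by simp_all
qed

section \<open>Regrouping sums by faces, integrals by elements, and one-sided traces\<close>

lemma sum_elements_faces:
  fixes X :: "vec3 set \<Rightarrow> vec3 set \<Rightarrow> 'b::comm_monoid_add"
  assumes "F \<subseteq> faces \<T>"
  shows "(\<Sum>K\<in>\<T>. \<Sum>\<sigma>\<in>faces_of K \<inter> F. X K \<sigma>) = (\<Sum>\<sigma>\<in>F. \<Sum>K\<in>{K \<in> \<T>. \<sigma> \<in> faces_of K}. X K \<sigma>)"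
proof -
  have "finite F" using assms finite_faces finite_subset by blast
  have "(\<Sum>\<sigma>\<in>faces_of K \<inter> F. X K \<sigma>) = (\<Sum>\<sigma>\<in>{\<sigma> \<in> F. \<sigma> \<in> faces_of K}. X K \<sigma>)" for K
    by (rule sum.cong) auto
  then show ?thesis
    using sum.swap_restrict[OF finite_mesh \<open>finite F\<close>, of X "\<lambda>K \<sigma>. \<sigma> \<in> faces_of K"] by simp
qed

lemma sum_interior_faces:
  "(\<Sum>K\<in>\<T>. \<Sum>\<sigma>\<in>faces_of K \<inter> faces_int \<Omega> \<T>. X K \<sigma>) = (\<Sum>\<sigma>\<in>faces_int \<Omega> \<T>. X (elem_m \<sigma>) \<sigma> + X (elem_p \<sigma>) \<sigma>)"
proof -
  have "faces_int \<Omega> \<T> \<subseteq> faces \<T>" by (auto simp: faces_int_def)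
  from sum_elements_faces[OF this] show ?thesis
    by (simp add: interior_face_elems)
qed

lemma sum_all_faces:
  "(\<Sum>K\<in>\<T>. \<Sum>\<sigma>\<in>faces_of K. X K \<sigma>) =
    (\<Sum>\<sigma>\<in>faces_int \<Omega> \<T>. X (elem_m \<sigma>) \<sigma> + X (elem_p \<sigma>) \<sigma>) + (\<Sum>\<sigma>\<in>faces_ext \<Omega> \<T>. X (elem_m \<sigma>) \<sigma>)"
proof -
  have "(\<Sum>K\<in>\<T>. \<Sum>\<sigma>\<in>faces_of K. X K \<sigma>) = (\<Sum>K\<in>\<T>. \<Sum>\<sigma>\<in>faces_of K \<inter> faces \<T>. X K \<sigma>)"
    by (intro sum.cong) (auto simp: faces_def)
  also have "\<dots> = (\<Sum>\<sigma>\<in>faces_int \<Omega> \<T> \<union> faces_ext \<Omega> \<T>. \<Sum>K\<in>{K \<in> \<T>. \<sigma> \<in> faces_of K}. X K \<sigma>)"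
    using sum_elements_faces[OF subset_refl] faces_split by simp
  also have "\<dots> = (\<Sum>\<sigma>\<in>faces_int \<Omega> \<T>. X (elem_m \<sigma>) \<sigma> + X (elem_p \<sigma>) \<sigma>) + (\<Sum>\<sigma>\<in>faces_ext \<Omega> \<T>. X (elem_m \<sigma>) \<sigma>)"
    using finite_faces faces_split by (simp add: sum.union_disjoint interior_face_elems exterior_face_elem)
  finally show ?thesis .
qed

text \<open>Frontiers of convex elements are null sets, which takes care of the unknown values there
  and of the overlaps of elements. The frontier of \<open>\<Omega>\<close> is covered by them, so
  integrating over the open domain or over its closure makes no difference.\<close>

lemma has_integral_piecewise:
  fixes f :: "vec3 \<Rightarrow> real"
  assumes "\<And>K x. K \<in> \<T> \<Longrightarrow> x \<in> interior K \<Longrightarrow> f x = k K"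
  shows "(f has_integral (\<Sum>K\<in>\<T>. measure lebesgue K * k K)) \<Omega>"
proof -
  have fr: "negligible (frontier K)" and cl: "closed K" if "K \<in> \<T>" for K
    using simplex3_convex[OF mesh_simplex[OF that]] simplex3_compact[OF mesh_simplex[OF that]]
    by (auto intro: negligible_convex_frontier compact_imp_closed)
  have "(f has_integral measure lebesgue K * k K) K" if "K \<in> \<T>" for K
  proof (rule has_integral_spike[OF fr[OF that]])
    have "K \<in> lmeasurable"
      by (intro lmeasurable_compact simplex3_compact mesh_simplex that)
    then have "((\<lambda>x. 1) has_integral measure lebesgue K) K"
      by (metis integrable_integral integrable_on_const lmeasure_integral)
    from has_integral_mult_left[OF this, of "k K"]
    show "((\<lambda>x. k K) has_integral measure lebesgue K * k K) K"
      by simp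
    show "f x = k K" if "x \<in> K - frontier K" for x
      using that assms \<open>K \<in> \<T>\<close> cl[OF \<open>K \<in> \<T>\<close>] by (auto simp: frontier_def closure_closed)
  qed
  moreover have "pairwise (\<lambda>K L. negligible (K \<inter> L)) \<T>"
  proof (rule pairwiseI)
    fix K L assume KL: "K \<in> \<T>" "L \<in> \<T>" "K \<noteq> L"
    have "K \<inter> L \<subseteq> frontier K \<union> frontier L"
    proof
      fix x assume x: "x \<in> K \<inter> L"
      have "x \<notin> interior K \<or> x \<notin> interior L"
        using interiors_disjoint KL by blast
      then show "x \<in> frontier K \<union> frontier L"
        using x closure_subset by (auto simp: frontier_def)
    qed
    then show "negligible (K \<inter> L)"
      using fr KL negligible_Un negligible_subset by metis
  qed
  ultimately have tot: "(f has_integral (\<Sum>K\<in>\<T>. measure lebesgue K * k K)) (\<Union>\<T>)"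
    by (intro has_integral_Union finite_mesh)
  have "frontier \<Omega> \<subseteq> \<Union>(frontier ` \<T>)"
  proof
    fix x assume x: "x \<in> frontier \<Omega>"
    then obtain K where K: "K \<in> \<T>" "x \<in> K"
      using Union_mesh by (auto simp: frontier_def)
    \<comment> \<open>Here the Lipschitz boundary enters: an element could otherwise contain a slit
      of the frontier in its interior.\<close>
    have "interior K \<subseteq> \<Omega>"
      using K Union_mesh interior_closure_domain by (metis Union_upper interior_mono)
    then have "x \<notin> interior K"
      using x open_domain by (auto simp: frontier_def interior_open)
    then show "x \<in> \<Union>(frontier ` \<T>)"
      using K closure_subset by (auto simp: frontier_def)
  qed
  moreover have "negligible (\<Union>(frontier ` \<T>))"
    by (rule negligible_Union) (use fr finite_mesh in auto)
  ultimately have neg: "negligible (frontier \<Omega>)"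
    by (meson negligible_subset)
  have "\<Omega> \<subseteq> closure \<Omega>" "closure \<Omega> - \<Omega> = frontier \<Omega>"
    using closure_subset open_domain by (auto simp: frontier_def interior_open)
  then have "(f has_integral I) \<Omega> \<longleftrightarrow> (f has_integral I) (closure \<Omega>)" for I
    by (intro has_integral_spike_set_eq) (auto intro: negligible_subset[OF neg])
  with tot show ?thesis
    by (simp add: Union_mesh)
qed

lemma integral_piecewise:
  fixes f :: "vec3 \<Rightarrow> real"
  assumes "\<And>K x. K \<in> \<T> \<Longrightarrow> x \<in> interior K \<Longrightarrow> f x = k K"
  shows "integral \<Omega> f = (\<Sum>K\<in>\<T>. measure lebesgue K * k K)"
  using has_integral_piecewise[OF assms] by (rule integral_unique)

text \<open>Going against \<open>\<nu> \<sigma>\<close> from the face centre enters the element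
  whose outward normal is \<open>\<nu> \<sigma>\<close>, so the function is eventually constant
  along the limit.\<close>

lemma trace_m_eq:
  assumes "\<sigma> \<in> faces_int \<Omega> \<T>" "\<And>x. x \<in> interior (elem_m \<sigma>) \<Longrightarrow> g x = k"
  shows "trace_m \<nu> g \<sigma> = k"
proof -
  have m: "elem_m \<sigma> \<in> \<T>" "\<sigma> \<in> faces_of (elem_m \<sigma>)" "elem_normal (elem_m \<sigma>) \<sigma> = \<nu> \<sigma>"
    using interior_face_elems assms by blast+
  interpret tetrahedron_face "elem_m \<sigma>" \<sigma> using tetrahedron_face m by blast
  have "\<forall>\<^sub>F \<delta> in at_right 0. face_centre \<sigma> + \<delta> *\<^sub>R (- \<nu> \<sigma>) \<in> interior (elem_m \<sigma>)"
    by (rule ray_inside[OF face_centre_rel_interior]) (use m norm_normal in \<open>simp add: dot_square_norm\<close>)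
  then have "\<forall>\<^sub>F \<delta> in at_right 0. g (face_centre \<sigma> - \<delta> *\<^sub>R \<nu> \<sigma>) = k"
    by eventually_elim (use assms(2) in simp)
  then show ?thesis
    unfolding trace_m_def by (intro tendsto_Lim tendsto_eventually) simp_all
qed

lemma trace_p_eq:
  assumes "\<sigma> \<in> faces_int \<Omega> \<T>" "\<And>x. x \<in> interior (elem_p \<sigma>) \<Longrightarrow> g x = k"
  shows "trace_p \<nu> g \<sigma> = k"
proof -
  have m: "elem_p \<sigma> \<in> \<T>" "\<sigma> \<in> faces_of (elem_p \<sigma>)" "elem_normal (elem_p \<sigma>) \<sigma> = - \<nu> \<sigma>"
    using interior_face_elems assms by blast+
  interpret tetrahedron_face "elem_p \<sigma>" \<sigma> using tetrahedron_face m by blast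
  have "\<nu> \<sigma> \<bullet> \<nu> \<sigma> = 1"
    using m norm_normal by (simp add: dot_square_norm)
  then have "\<forall>\<^sub>F \<delta> in at_right 0. face_centre \<sigma> + \<delta> *\<^sub>R \<nu> \<sigma> \<in> interior (elem_p \<sigma>)"
    by (intro ray_inside[OF face_centre_rel_interior]) (simp add: m)
  then have "\<forall>\<^sub>F \<delta> in at_right 0. g (face_centre \<sigma> + \<delta> *\<^sub>R \<nu> \<sigma>) = k"
    by eventually_elim (use assms(2) in simp)
  then show ?thesis
    unfolding trace_p_def by (intro tendsto_Lim tendsto_eventually) simp_all
qed

end


section \<open>Discrete functions and the pressure potential\<close>

text \<open>Lagrange's remainder asks only for the existence of the second derivative. The case
  \<open>a = b\<close>, with no room for an intermediate point, is covered by the closed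
  interval.\<close>

lemma Taylor_2:
  fixes f :: "real \<Rightarrow> real"
  assumes f: "\<And>r. 0 < r \<Longrightarrow> (f has_real_derivative f' r) (at r)"
    and f': "\<And>r. 0 < r \<Longrightarrow> (f' has_real_derivative f'' r) (at r)"
    and pos: "0 < a" "0 < b"
  obtains \<xi> where "\<xi> \<in> {min a b..max a b}" "f a = f b + f' b * (a - b) + f'' \<xi> * (a - b)\<^sup>2 / 2"
proof (cases "a = b")
  case True
  then show thesis using that[of a] by simp
next
  case False
  define d where "d = (\<lambda>m::nat. if m = 0 then f else if m = 1 then f' else f'')"
  have "\<exists>t. (if a < b then a < t \<and> t < b else b < t \<and> t < a) \<and>
      f a = (\<Sum>m<2. d m b / fact m * (a - b) ^ m) + d 2 t / fact 2 * (a - b) ^ 2"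
    by (rule Taylor[of 2 d f "min a b" "max a b"])
      (use False pos f f' in \<open>auto simp: d_def less_2_cases_iff split: if_splits\<close>)
  then obtain t where t: "if a < b then a < t \<and> t < b else b < t \<and> t < a"
    and eq: "f a = (\<Sum>m<2. d m b / fact m * (a - b) ^ m) + d 2 t / fact 2 * (a - b) ^ 2"
    by blast
  show thesis
    by (rule that[of t]) (use t eq in \<open>auto simp: d_def eval_nat_numeral split: if_splits\<close>)
qed

text \<open>By the fundamental theorem \<open>\<Phi>\<close> has derivative p(r)/r^2. In
  \<open>H''\<close> this cancels the term of opposite sign from the quotient rule for p(r)/r, so
  continuity and one derivative of \<open>p\<close> suffice for two derivatives of the
  potential.\<close>

lemma H_reg_derivatives:
  fixes p p' :: "real \<Rightarrow> real"
  assumes p: "\<And>r. 0 \<le> r \<Longrightarrow> (p has_real_derivative p' r) (at r within {0..})"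
  obtains H' H'' where
    "\<And>r. 0 < r \<Longrightarrow> (H_reg p \<kappa> \<eta> h has_real_derivative H' r) (at r)"
    "\<And>r. 0 < r \<Longrightarrow> (H' has_real_derivative H'' r) (at r)"
    "\<And>r. 0 < r \<Longrightarrow> r * H' r - H_reg p \<kappa> \<eta> h r = p_reg p \<kappa> \<eta> h r"
proof -
  define a where "a = \<kappa> * h powr \<eta>"
  define \<Phi> where "\<Phi> = (\<lambda>r. LBINT z=1..ereal r. p z / z\<^sup>2)"
  define H' where "H' = (\<lambda>r. \<Phi> r + p r / r + 2 * a * r)"
  define H'' where "H'' = (\<lambda>r. p' r / r + 2 * a)"
  have dp: "(p has_real_derivative p' r) (at r)" if "0 < r" for r
  proof -
    have "at r within {0..} = at r"
      by (rule at_within_interior) (use that in simp)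
    with p[of r] that show ?thesis by simp
  qed
  have cont: "continuous_on {0<..} (\<lambda>z. p z / z\<^sup>2)"
    by (intro continuous_intros continuous_at_imp_continuous_on) (auto intro: DERIV_isCont dp)
  have d\<Phi>: "(\<Phi> has_real_derivative p r / r\<^sup>2) (at r)" if r: "0 < r" for r
  proof -
    \<comment> \<open>The interval contains the base point 1, stays away from the singularity at 0,
      and has \<open>r\<close> in its interior, which turns the derivative within it into a full
      one.\<close>
    let ?l = "min r 1 / 2" and ?u = "max r 1 + 1"
    have "((\<lambda>u. LBINT z=ereal 1..u. p z / z\<^sup>2) has_vector_derivative p r / r\<^sup>2) (at r within {?l..?u})"
      by (rule interval_integral_FTC2)
        (use r in \<open>auto intro!: continuous_on_subset[OF cont]\<close>)
    moreover have "at r within {?l..?u} = at r"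
      using r by (intro at_within_interior) (simp add: min_def)
    ultimately show ?thesis
      by (simp add: \<Phi>_def has_real_derivative_iff_has_vector_derivative one_ereal_def)
  qed
  have H: "H_reg p \<kappa> \<eta> h = (\<lambda>r. r * \<Phi> r + a * r\<^sup>2)"
    by (simp add: fun_eq_iff H_reg_def H_pot_def a_def \<Phi>_def)
  show thesis
  proof (rule that[of H' H''])
    fix r :: real assume r: "0 < r"
    show "(H_reg p \<kappa> \<eta> h has_real_derivative H' r) (at r)"
      unfolding H by (rule derivative_eq_intros d\<Phi>[OF r] refl)+ (use r in \<open>simp add: H'_def field_simps power2_eq_square\<close>)
    show "(H' has_real_derivative H'' r) (at r)"
      unfolding H'_def using r
      by (auto intro!: derivative_eq_intros d\<Phi>[OF r] dp[OF r] simp: H''_def field_simps power2_eq_square)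
    show "r * H' r - H_reg p \<kappa> \<eta> h r = p_reg p \<kappa> \<eta> h r"
      using r unfolding H by (simp add: H'_def p_reg_def a_def field_simps power2_eq_square)
  qed
qed

text \<open>The divergence of the linear field that occurs in the convective boundary term, see
  \<open>convection_V\<close>.\<close>

lemma trace_matrix_rank_one:
  fixes G :: "real^3^3"
  shows "trace (matrix (\<lambda>x. ((G *v x) \<bullet> w) *\<^sub>R z)) = (G *v z) \<bullet> w"
  by (simp add: matrix_def trace_def matrix_vector_mult_def inner_vec_def sum_3 axis_def algebra_simps)

section \<open>Projections, traces and face values on the mesh\<close>

context tetrahedral_mesh
begin

lemma Q_space_elem_val:
  assumes "g \<in> Q_space \<T>" "K \<in> \<T>" "x \<in> interior K"
  shows "g x = elem_val K g"
proof -
  obtain k where k: "\<And>x. x \<in> interior K \<Longrightarrow> g x = k"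
    using assms unfolding Q_space_def by blast
  then show ?thesis
    using elem_val_eq[OF mesh_simplex[OF assms(2)] k] assms(3) by simp
qed

lemma Q_spaceI: "(\<And>K x. K \<in> \<T> \<Longrightarrow> x \<in> interior K \<Longrightarrow> g x = k K) \<Longrightarrow> g \<in> Q_space \<T>"
  unfolding Q_space_def by blast

lemma elem_val_mesh: "K \<in> \<T> \<Longrightarrow> (\<And>x. x \<in> interior K \<Longrightarrow> g x = k) \<Longrightarrow> elem_val K g = k"
  by (rule elem_val_eq[OF mesh_simplex])

lemma sum_indicator_interior:
  fixes k :: "vec3 set \<Rightarrow> 'b::real_vector"
  assumes "K \<in> \<T>" "x \<in> interior K"
  shows "(\<Sum>L\<in>\<T>. indicator (interior L) x *\<^sub>R k L) = k K"
proof -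
  have "(\<Sum>L\<in>\<T>. indicator (interior L) x *\<^sub>R k L) = (\<Sum>L\<in>\<T>. if L = K then k L else 0)"
    using interiors_disjoint assms by (intro sum.cong refl) (auto simp: indicator_def)
  then show ?thesis
    using assms finite_mesh by simp
qed

lemma PiQ_in_Q_space: "PiQ \<T> g \<in> Q_space \<T>"
  and elem_val_PiQ: "K \<in> \<T> \<Longrightarrow> elem_val K (PiQ \<T> g) = elem_mean K g"
  unfolding PiQ_def using sum_indicator_interior
  by (auto intro!: Q_spaceI[where k = "\<lambda>K. elem_mean K g"] elem_val_mesh)

text \<open>Meant for the initial density, which is a projection of data and to which the positivity
  of the computed densities does not extend. On a compact element the continuous \<open>g\<close>
  has a positive minimum, which bounds the mean from below.\<close>

lemma elem_mean_pos:
  fixes g :: "vec3 \<Rightarrow> real"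
  assumes "K \<in> \<T>" "continuous_on (closure \<Omega>) g" "\<And>x. x \<in> closure \<Omega> \<Longrightarrow> 0 < g x"
  shows "0 < elem_mean K g"
proof -
  have comp: "compact K" and "K \<noteq> {}"
    using simplex3_compact simplex3_interior mesh_simplex[OF assms(1)] interior_subset by fastforce+
  have sub: "K \<subseteq> closure \<Omega>" using assms(1) Union_mesh by blast
  then have cont: "continuous_on K g" using assms(2) continuous_on_subset by blast
  obtain x where x: "x \<in> K" and min: "\<And>y. y \<in> K \<Longrightarrow> g x \<le> g y"
    using continuous_attains_inf[OF comp \<open>K \<noteq> {}\<close> cont] by blast
  have "K \<in> lmeasurable" using comp by (rule lmeasurable_compact)
  have int: "g integrable_on K"
    using borel_integrable_compact[OF comp cont] set_borel_integral_eq_integral(1)[of K g]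
    by (simp add: set_integrable_def)
  have "measure lebesgue K * g x = integral K (\<lambda>y. g x)"
    using lmeasure_integral[OF \<open>K \<in> lmeasurable\<close>] integral_mult_left[of K "\<lambda>_. 1 :: real" "g x"] by simp
  also have "\<dots> \<le> integral K g"
    by (rule integral_le) (use min int integrable_on_const[OF \<open>K \<in> lmeasurable\<close>] in auto)
  finally have "measure lebesgue K * g x \<le> integral K g" .
  moreover have "0 < measure lebesgue K" "0 < g x"
    using simplex3_measure_pos mesh_simplex assms(1,3) x sub by blast+
  ultimately have "0 < integral K g"
    by (meson mult_pos_pos order_less_le_trans)
  then show ?thesis
    using \<open>0 < measure lebesgue K\<close> by (simp add: elem_mean_def)
qed

lemma elem_trace_Q:
  assumes "g \<in> Q_space \<T>" "K \<in> \<T>" "x \<in> K"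
  shows "elem_trace K g x = elem_val K g"
  using elem_trace_const[OF mesh_simplex] Q_space_elem_val assms by metis

lemma face_trace_Q:
  assumes "g \<in> Q_space \<T>" "\<sigma> \<in> faces_ext \<Omega> \<T>" "x \<in> \<sigma>"
  shows "face_trace \<T> \<sigma> g x = elem_val (elem_m \<sigma>) g"
proof -
  have "elem_m \<sigma> \<in> \<T>" "\<sigma> \<in> faces_of (elem_m \<sigma>)"
    using exterior_face_elem assms by blast+
  then show ?thesis
    using elem_trace_Q assms tetrahedron_face.face_subset[OF tetrahedron_face] exterior_face_elem(3) by (metis subsetD)
qed

lemma trace_Q:
  assumes "g \<in> Q_space \<T>" "\<sigma> \<in> faces_int \<Omega> \<T>"
  shows "trace_m \<nu> g \<sigma> = elem_val (elem_m \<sigma>) g" "trace_p \<nu> g \<sigma> = elem_val (elem_p \<sigma>) g"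
proof -
  note m = interior_face_elems(1,2)[OF assms(2), THEN conjunct1]
  show "trace_m \<nu> g \<sigma> = elem_val (elem_m \<sigma>) g"
    by (rule trace_m_eq[OF assms(2) Q_space_elem_val[OF assms(1) m(1)]])
  show "trace_p \<nu> g \<sigma> = elem_val (elem_p \<sigma>) g"
    by (rule trace_p_eq[OF assms(2) Q_space_elem_val[OF assms(1) m(2)]])
qed

lemma grad_h_affine:
  fixes v :: "vec3 \<Rightarrow> vec3"
  assumes "linear A" "\<And>y. y \<in> interior K \<Longrightarrow> v y = A y + b" "x \<in> interior K"
  shows "grad_h v x = matrix A"
proof -
  have "((\<lambda>y. A y + b) has_derivative A) (at x)"
    using assms(1) by (auto intro!: derivative_eq_intros linear_imp_has_derivative)
  then have "(v has_derivative A) (at x)"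
    by (rule has_derivative_transform_within_open[OF _ open_interior assms(3)]) (use assms in simp)
  then show ?thesis
    unfolding grad_h_def jacobian_def by (metis frechet_derivative_at)
qed

lemma grad_h_in_Q_space:
  fixes v :: "vec3 \<Rightarrow> vec3"
  assumes "v \<in> V_space \<Omega> \<T>"
  shows "grad_h v \<in> Q_space \<T>"
proof -
  have "\<exists>G. \<forall>x\<in>interior K. grad_h v x = G" if K: "K \<in> \<T>" for K
  proof -
    obtain A b where A: "linear A" and v: "\<And>x. x \<in> interior K \<Longrightarrow> v x = A x + b"
      using assms K unfolding V_space_def by blast
    show ?thesis
      by (intro exI ballI) (rule grad_h_affine[OF A v])
  qed
  then show ?thesis by (simp add: Q_space_def)
qed

text \<open>Takes the discrete gradient itself as the linear part, so that only the constant
  \<open>b\<close> remains to be chosen.\<close>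

lemma V_space_affine:
  fixes v :: "vec3 \<Rightarrow> vec3"
  assumes "v \<in> V_space \<Omega> \<T>" "K \<in> \<T>"
  obtains b where "\<And>x. x \<in> interior K \<Longrightarrow> v x = elem_val K (grad_h v) *v x + b"
proof -
  obtain A b where A: "linear A" and v: "\<And>x. x \<in> interior K \<Longrightarrow> v x = A x + b"
    using assms unfolding V_space_def by blast
  have "elem_val K (grad_h v) = matrix A"
    by (rule elem_val_mesh[OF assms(2) grad_h_affine[OF A v]])
  moreover have "matrix A *v x = A x" for x
    using fun_cong[OF matrix_vector_mul(2)[OF A]] .
  ultimately show thesis
    using that[of b] v by simp
qed

lemma elem_trace_V:
  fixes v :: "vec3 \<Rightarrow> vec3"
  assumes "K \<in> \<T>" "\<And>x. x \<in> interior K \<Longrightarrow> v x = G *v x + b" "x \<in> K"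
  shows "elem_trace K v x = G *v x + b"
  by (rule elem_trace_eq[OF mesh_simplex]) (use assms in \<open>auto intro!: continuous_intros\<close>)

text \<open>\<open>face_val\<close> uses whichever neighbour \<open>adj_elem\<close> picked; the
  matching face integrals of Crouzeix-Raviart functions allow any neighbour \<open>K\<close>
  instead, whose affine form is then evaluated at the centroid.\<close>

lemma face_val_V:
  fixes v :: "vec3 \<Rightarrow> vec3"
  assumes v: "v \<in> V_space \<Omega> \<T>" and K: "K \<in> \<T>" "\<sigma> \<in> faces_of K"
    and G: "\<And>x. x \<in> interior K \<Longrightarrow> v x = G *v x + b"
  shows "face_val \<T> v \<sigma> = G *v face_centre \<sigma> + b"
proof -
  interpret tetrahedron_face K \<sigma> using tetrahedron_face K by blast
  have K_int: "surf_int \<sigma> (elem_trace K v) = area \<sigma> *\<^sub>R (G *v face_centre \<sigma> + b)"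
    by (rule surf_int_affine) (use elem_trace_V K G face_subset in auto)
  have \<sigma>: "\<sigma> \<in> faces \<T>" using K by (auto simp: faces_def)
  have adj: "adj_elem \<T> \<sigma> \<in> \<T>" "\<sigma> \<in> faces_of (adj_elem \<T> \<sigma>)"
    unfolding adj_elem_def using someI[of "\<lambda>K. K \<in> \<T> \<and> \<sigma> \<in> faces_of K"] K by blast+
  have "surf_int \<sigma> (elem_trace (adj_elem \<T> \<sigma>) v) = surf_int \<sigma> (elem_trace K v)"
  proof (cases "\<sigma> \<in> faces_ext \<Omega> \<T>")
    case True
    then show ?thesis using exterior_face_elem(2) K adj by (metis (mono_tags, lifting) mem_Collect_eq singletonD)
  next
    case False
    then have "\<sigma> \<in> faces_int \<Omega> \<T>" using \<sigma> by (simp add: faces_int_def)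
    then show ?thesis using v K adj unfolding V_space_def by blast
  qed
  then show "face_val \<T> v \<sigma> = G *v face_centre \<sigma> + b"
    unfolding face_val_def face_mean_def K_int area_def[symmetric] using area_pos by simp
qed

lemma divergence_V:
  assumes "v \<in> V_space \<Omega> \<T>" "K \<in> \<T>"
  shows "(\<Sum>\<sigma>\<in>faces_of K. area \<sigma> * (face_val \<T> v \<sigma> \<bullet> elem_normal K \<sigma>)) =
    measure lebesgue K * trace (elem_val K (grad_h v))"
proof -
  obtain b where b: "\<And>x. x \<in> interior K \<Longrightarrow> v x = elem_val K (grad_h v) *v x + b"
    using V_space_affine[OF assms] by blast
  show ?thesis
    using divergence_simplex3[OF mesh_simplex[OF assms(2)] matrix_vector_mul_linear, of "elem_val K (grad_h v)" b]
      face_val_V[OF assms _ b] by simp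
qed

text \<open>Here \<open>r\<close>, \<open>z\<close>, \<open>w\<close> are constant on the element
  and \<open>uB\<close> is affine, so the sum over faces is \<open>r\<close> times the outward flux
  of the affine field (uB . w) z. Its divergence is the convective volume term.\<close>

lemma convection_V:
  assumes uB: "uB \<in> V_space \<Omega> \<T>" and K: "K \<in> \<T>" and Q: "r \<in> Q_space \<T>" "z \<in> Q_space \<T>" "w \<in> Q_space \<T>"
  shows "(\<Sum>\<sigma>\<in>faces_of K. surf_int \<sigma> (\<lambda>x. elem_trace K r x * (elem_trace K z x \<bullet> elem_normal K \<sigma>)
      * (elem_trace K uB x \<bullet> elem_trace K w x))) =
    measure lebesgue K * (elem_val K r * ((elem_val K (grad_h uB) *v elem_val K z) \<bullet> elem_val K w))"
proof -
  let ?G = "elem_val K (grad_h uB)" and ?r = "elem_val K r" and ?z = "elem_val K z" and ?w = "elem_val K w"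
  obtain b where b: "\<And>x. x \<in> interior K \<Longrightarrow> uB x = ?G *v x + b"
    using V_space_affine[OF uB K] by blast
  \<comment> \<open>The linear part of that field; the constant part
    \<open>(b \<bullet> ?w) *\<^sub>R ?z\<close> plays the role of \<open>e\<close> in the
    divergence theorem.\<close>
  let ?F = "\<lambda>x. ((?G *v x) \<bullet> ?w) *\<^sub>R ?z"
  have lin: "linear ?F"
    by (rule linearI) (simp_all add: matrix_vector_right_distrib inner_add_left scaleR_left_distrib matrix_vector_mult_scaleR)
  have "surf_int \<sigma> (\<lambda>x. elem_trace K r x * (elem_trace K z x \<bullet> elem_normal K \<sigma>) * (elem_trace K uB x \<bullet> elem_trace K w x)) =
      ?r * (area \<sigma> * ((?F (face_centre \<sigma>) + (b \<bullet> ?w) *\<^sub>R ?z) \<bullet> elem_normal K \<sigma>))" if \<sigma>: "\<sigma> \<in> faces_of K" for \<sigma>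
  proof -
    interpret tetrahedron_face K \<sigma> using tetrahedron_face K \<sigma> by blast
    let ?c = "?r * (?z \<bullet> elem_normal K \<sigma>)"
    have "surf_int \<sigma> (\<lambda>x. elem_trace K r x * (elem_trace K z x \<bullet> elem_normal K \<sigma>) * (elem_trace K uB x \<bullet> elem_trace K w x)) =
        area \<sigma> *\<^sub>R (?c * ((?G *v face_centre \<sigma>) \<bullet> ?w) + ?c * (b \<bullet> ?w))"
    proof (rule surf_int_affine)
      show "linear (\<lambda>x. ?c * ((?G *v x) \<bullet> ?w))"
        by (rule linearI) (simp_all add: matrix_vector_right_distrib inner_add_left matrix_vector_mult_scaleR algebra_simps)
      fix x assume "x \<in> \<sigma>"
      then have "x \<in> K" using face_subset by blast
      then show "elem_trace K r x * (elem_trace K z x \<bullet> elem_normal K \<sigma>) * (elem_trace K uB x \<bullet> elem_trace K w x) =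
          ?c * ((?G *v x) \<bullet> ?w) + ?c * (b \<bullet> ?w)"
        by (simp add: elem_trace_Q Q K elem_trace_V[OF K b] inner_add_left algebra_simps)
    qed
    then show ?thesis by (simp add: inner_add_left algebra_simps)
  qed
  then have "(\<Sum>\<sigma>\<in>faces_of K. surf_int \<sigma> (\<lambda>x. elem_trace K r x * (elem_trace K z x \<bullet> elem_normal K \<sigma>)
      * (elem_trace K uB x \<bullet> elem_trace K w x))) =
      ?r * (\<Sum>\<sigma>\<in>faces_of K. area \<sigma> * ((?F (face_centre \<sigma>) + (b \<bullet> ?w) *\<^sub>R ?z) \<bullet> elem_normal K \<sigma>))"
    by (simp add: sum_distrib_left)
  also have "\<dots> = ?r * (measure lebesgue K * ((?G *v ?z) \<bullet> ?w))"
    unfolding divergence_simplex3[OF mesh_simplex[OF K] lin] trace_matrix_rank_one ..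
  finally show ?thesis by (simp add: algebra_simps)
qed

lemma V_space_diff:
  assumes "u \<in> V_space \<Omega> \<T>" "w \<in> V_space \<Omega> \<T>" "K \<in> \<T>"
  shows "x \<in> interior K \<Longrightarrow> grad_h (\<lambda>x. u x - w x) x = elem_val K (grad_h u) - elem_val K (grad_h w)"
    and "\<sigma> \<in> faces_of K \<Longrightarrow> surf_int \<sigma> (elem_trace K (\<lambda>x. u x - w x)) = area \<sigma> *\<^sub>R (face_val \<T> u \<sigma> - face_val \<T> w \<sigma>)"
proof -
  let ?G = "elem_val K (grad_h u)" and ?H = "elem_val K (grad_h w)"
  obtain b where u: "\<And>x. x \<in> interior K \<Longrightarrow> u x = ?G *v x + b"
    using V_space_affine[OF assms(1,3)] by blast
  obtain c where w: "\<And>x. x \<in> interior K \<Longrightarrow> w x = ?H *v x + c"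
    using V_space_affine[OF assms(2,3)] by blast
  have uw: "u x - w x = (?G - ?H) *v x + (b - c)" if "x \<in> interior K" for x
    using u w that by (simp add: matrix_vector_mult_diff_rdistrib)
  show "grad_h (\<lambda>x. u x - w x) x = ?G - ?H" if "x \<in> interior K" for x
    using grad_h_affine[OF matrix_vector_mul_linear uw that] by simp
  assume \<sigma>: "\<sigma> \<in> faces_of K"
  interpret tetrahedron_face K \<sigma> using tetrahedron_face assms \<sigma> by blast
  have "surf_int \<sigma> (elem_trace K (\<lambda>x. u x - w x)) = area \<sigma> *\<^sub>R ((?G - ?H) *v face_centre \<sigma> + (b - c))"
    by (rule surf_int_affine) (use elem_trace_V[OF assms(3) uw] face_subset in auto)
  then show "surf_int \<sigma> (elem_trace K (\<lambda>x. u x - w x)) = area \<sigma> *\<^sub>R (face_val \<T> u \<sigma> - face_val \<T> w \<sigma>)"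
    using face_val_V[OF assms(1,3) \<sigma> u] face_val_V[OF assms(2,3) \<sigma> w]
    by (simp add: matrix_vector_mult_diff_rdistrib)
qed

lemma face_val_exterior_eq:
  fixes u w :: "vec3 \<Rightarrow> vec3"
  assumes "u \<in> V_space \<Omega> \<T>" "w \<in> V_space \<Omega> \<T>" "(\<lambda>x. u x - w x) \<in> V0_space \<Omega> \<T>" "\<sigma> \<in> faces_ext \<Omega> \<T>"
  shows "face_val \<T> u \<sigma> = face_val \<T> w \<sigma>"
proof -
  have m: "elem_m \<sigma> \<in> \<T>" "\<sigma> \<in> faces_of (elem_m \<sigma>)"
    using exterior_face_elem assms(4) by blast+
  have "area \<sigma> *\<^sub>R (face_val \<T> u \<sigma> - face_val \<T> w \<sigma>) = 0"
    using V_space_diff(2)[OF assms(1,2) m] assms(3,4) m unfolding V0_space_def by auto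
  then show ?thesis
    using tetrahedron_face.area_pos[OF tetrahedron_face[OF m]] by simp
qed

end


section \<open>The energy identity of one time step\<close>

text \<open>The upwind flux through a face with normal velocity \<open>s\<close>, where
  \<open>x\<close> is the value behind the face and \<open>y\<close> the one ahead; both
  \<open>flux\<close> and \<open>Up\<close> reduce to it.\<close>

definition upw :: "real \<Rightarrow> 'b::real_vector \<Rightarrow> 'b \<Rightarrow> 'b" where
  "upw s x y = s *\<^sub>R (if 0 \<le> s then x else y)"

text \<open>Polarization: twice the product of \<open>v\<close> and \<open>v'\<close> is the sum of
  their squares minus the square of the difference.\<close>

lemma kinetic_element:
  fixes v v' :: "'a::real_inner"
  assumes "\<tau> \<noteq> 0"
  shows "\<tau> * (((r *\<^sub>R v - r' *\<^sub>R v') /\<^sub>R \<tau>) \<bullet> v - (r - r') / \<tau> * ((norm v)\<^sup>2 / 2)) =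
    1/2 * r * (norm v)\<^sup>2 - 1/2 * r' * (norm v')\<^sup>2 + 1/2 * (r' * (norm (v - v'))\<^sup>2)"
  using assms unfolding power2_norm_eq_inner
  by (simp add: inner_diff_left inner_diff_right inner_commute field_simps)

text \<open>Both fluxes carry the same upwind side. If it is \<open>x\<close>, then x.(x - y)
  exceeds half the difference of squares by half of |x - y|^2; if it is \<open>y\<close>, it falls
  short by as much while \<open>s\<close> is negative. Positive densities make the prefactor
  \<open>\<bar>upw s a b\<bar>\<close>.\<close>

lemma kinetic_interface:
  fixes x y :: "'a::real_inner"
  assumes "0 < a" "0 < b"
  shows "upw s (a *\<^sub>R x) (b *\<^sub>R y) \<bullet> (x - y) - upw s a b * ((norm x)\<^sup>2 / 2 - (norm y)\<^sup>2 / 2) =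
    1/2 * (\<bar>upw s a b\<bar> * (norm (y - x))\<^sup>2)"
proof (cases "0 \<le> s")
  case True
  then show ?thesis
    using assms unfolding upw_def power2_norm_eq_inner
    by (simp add: abs_mult inner_diff_left inner_diff_right inner_commute field_simps)
next
  case False
  then show ?thesis
    using assms unfolding upw_def power2_norm_eq_inner
    by (simp add: abs_mult inner_diff_left inner_diff_right inner_commute field_simps)
qed

text \<open>The momentum equation tested with the velocity \<open>v\<close>, minus the continuity equation tested with
  \<open>|v|\<^sup>2/2\<close>, plus the continuity equation tested with \<open>H' \<circ> r\<close>. The index sets \<open>T\<close>, \<open>I\<close>, \<open>Ob\<close>, \<open>Ib\<close> stand for
  the elements and the interior, outflow and inflow faces.\<close>

lemma energy_step_identity:
  fixes v v' :: "'k \<Rightarrow> 'a::real_inner" and r r' rB conv SV SB trU trB h2K V :: "'k \<Rightarrow> real"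
    and A s b h2S :: "'s \<Rightarrow> real" and ml pl :: "'s \<Rightarrow> 'k" and H H' P :: "real \<Rightarrow> real"
  assumes \<tau>: "\<tau> \<noteq> 0"
    and ml: "\<And>\<sigma>. \<sigma> \<in> I \<Longrightarrow> ml \<sigma> \<in> T \<and> pl \<sigma> \<in> T" "\<And>\<sigma>. \<sigma> \<in> Ob \<union> Ib \<Longrightarrow> ml \<sigma> \<in> T"
    and pos: "\<And>K. K \<in> T \<Longrightarrow> 0 < r K"
    and P: "\<And>x. 0 < x \<Longrightarrow> P x = x * H' x - H x"
    and b: "\<And>\<sigma>. \<sigma> \<in> Ib \<Longrightarrow> b \<sigma> < 0"
    and h2K: "\<And>K. K \<in> T \<Longrightarrow> H' (r K) * (r K - r' K) = H (r K) - H (r' K) + 1/2 * (h2K K * \<bar>r K - r' K\<bar>\<^sup>2)"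
    and h2S: "\<And>\<sigma>. \<sigma> \<in> I \<Longrightarrow> upw (s \<sigma>) (r (ml \<sigma>)) (r (pl \<sigma>)) * (H' (r (ml \<sigma>)) - H' (r (pl \<sigma>)))
      - s \<sigma> * (P (r (ml \<sigma>)) - P (r (pl \<sigma>))) = 1/2 * (h2S \<sigma> * (r (pl \<sigma>) - r (ml \<sigma>))\<^sup>2 * \<bar>s \<sigma>\<bar>)"
    and cont: "\<And>\<phi>. (\<Sum>K\<in>T. V K * ((r K - r' K) / \<tau> * \<phi> K))
      + (\<Sum>\<sigma>\<in>I. A \<sigma> * (upw (s \<sigma>) (r (ml \<sigma>)) (r (pl \<sigma>)) * (\<phi> (ml \<sigma>) - \<phi> (pl \<sigma>))))
      + (\<Sum>\<sigma>\<in>Ob. A \<sigma> * (r (ml \<sigma>) * b \<sigma> * \<phi> (ml \<sigma>)))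
      + (\<Sum>\<sigma>\<in>Ib. A \<sigma> * (rB (ml \<sigma>) * b \<sigma> * \<phi> (ml \<sigma>)))
      + \<alpha> * (\<Sum>\<sigma>\<in>I. A \<sigma> * ((r (pl \<sigma>) - r (ml \<sigma>)) * (\<phi> (pl \<sigma>) - \<phi> (ml \<sigma>)))) = 0"
    and mom: "(\<Sum>K\<in>T. V K * (((r K *\<^sub>R v K - r' K *\<^sub>R v' K) /\<^sub>R \<tau>) \<bullet> v K))
      + (\<Sum>\<sigma>\<in>I. A \<sigma> * (upw (s \<sigma>) (r (ml \<sigma>) *\<^sub>R v (ml \<sigma>)) (r (pl \<sigma>) *\<^sub>R v (pl \<sigma>)) \<bullet> (v (ml \<sigma>) - v (pl \<sigma>))))
      + (\<Sum>K\<in>T. V K * (r K * conv K))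
      + (\<Sum>\<sigma>\<in>Ob. A \<sigma> * (r (ml \<sigma>) * b \<sigma> * (norm (v (ml \<sigma>)))\<^sup>2))
      + (\<Sum>\<sigma>\<in>Ib. A \<sigma> * (rB (ml \<sigma>) * b \<sigma> * (norm (v (ml \<sigma>)))\<^sup>2))
      + (\<Sum>K\<in>T. V K * (SV K + SB K - P (r K) * (trU K - trB K)))
      + \<alpha> * (\<Sum>\<sigma>\<in>I. A \<sigma> * ((r (pl \<sigma>) - r (ml \<sigma>)) * (((1/2) *\<^sub>R (v (pl \<sigma>) + v (ml \<sigma>))) \<bullet> (v (pl \<sigma>) - v (ml \<sigma>))))) = 0"
    and pdiv: "(\<Sum>K\<in>T. V K * (P (r K) * trU K)) = (\<Sum>\<sigma>\<in>I. A \<sigma> * (s \<sigma> * (P (r (ml \<sigma>)) - P (r (pl \<sigma>)))))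
      + (\<Sum>\<sigma>\<in>Ob. A \<sigma> * (b \<sigma> * P (r (ml \<sigma>)))) + (\<Sum>\<sigma>\<in>Ib. A \<sigma> * (b \<sigma> * P (r (ml \<sigma>))))"
  shows "(\<Sum>K\<in>T. V K * (1/2 * r K * (norm (v K))\<^sup>2)) + (\<Sum>K\<in>T. V K * H (r K))
      - (\<Sum>K\<in>T. V K * (1/2 * r' K * (norm (v' K))\<^sup>2)) - (\<Sum>K\<in>T. V K * H (r' K))
      + \<tau> * (\<Sum>K\<in>T. V K * SV K)
      + 1/2 * (\<Sum>K\<in>T. V K * (r' K * (norm (v K - v' K))\<^sup>2 + h2K K * \<bar>r K - r' K\<bar>\<^sup>2))
      + \<tau> / 2 * (\<Sum>\<sigma>\<in>I. A \<sigma> * (\<bar>upw (s \<sigma>) (r (ml \<sigma>)) (r (pl \<sigma>))\<bar> * (norm (v (pl \<sigma>) - v (ml \<sigma>)))\<^sup>2))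
      + \<alpha> * \<tau> * (\<Sum>\<sigma>\<in>I. A \<sigma> * ((r (pl \<sigma>) - r (ml \<sigma>)) * (H' (r (pl \<sigma>)) - H' (r (ml \<sigma>)))))
      + \<tau> / 2 * (\<Sum>\<sigma>\<in>I. A \<sigma> * (h2S \<sigma> * (r (pl \<sigma>) - r (ml \<sigma>))\<^sup>2 * \<bar>s \<sigma>\<bar>))
      + \<tau> / 2 * (\<Sum>\<sigma>\<in>Ob. A \<sigma> * (r (ml \<sigma>) * b \<sigma> * (norm (v (ml \<sigma>)))\<^sup>2))
      + \<tau> * (\<Sum>\<sigma>\<in>Ob. A \<sigma> * (H (r (ml \<sigma>)) * b \<sigma>))
      + \<tau> * (\<Sum>\<sigma>\<in>Ib. A \<sigma> * ((H (rB (ml \<sigma>)) - H' (r (ml \<sigma>)) * (rB (ml \<sigma>) - r (ml \<sigma>)) - H (r (ml \<sigma>))) * \<bar>b \<sigma>\<bar>))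
    = \<tau> * (\<Sum>\<sigma>\<in>Ib. A \<sigma> * (H (rB (ml \<sigma>)) * \<bar>b \<sigma>\<bar>))
      - \<tau> * (\<Sum>K\<in>T. V K * SB K)
      - \<tau> * (\<Sum>K\<in>T. V K * (P (r K) * trB K))
      - \<tau> * (\<Sum>K\<in>T. V K * (r K * conv K))
      - \<tau> / 2 * (\<Sum>\<sigma>\<in>Ib. A \<sigma> * (rB (ml \<sigma>) * b \<sigma> * (norm (v (ml \<sigma>)))\<^sup>2))"
proof -
  define up where "up = (\<lambda>\<sigma>. upw (s \<sigma>) (r (ml \<sigma>)) (r (pl \<sigma>)))"
  define upv where "upv = (\<lambda>\<sigma>. upw (s \<sigma>) (r (ml \<sigma>) *\<^sub>R v (ml \<sigma>)) (r (pl \<sigma>) *\<^sub>R v (pl \<sigma>)) \<bullet> (v (ml \<sigma>) - v (pl \<sigma>)))"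
  \<comment> \<open>\<open>e\<close> and \<open>h\<close> are the two test functions for the
    continuity equation; \<open>e\<close> enters with a minus sign, \<open>h\<close> with a plus
    sign.\<close>
  define e where "e = (\<lambda>K. (norm (v K))\<^sup>2 / 2)"
  define h where "h = (\<lambda>K. H' (r K))"
  have elem: "(\<Sum>K\<in>T. V K * (1/2 * r K * (norm (v K))\<^sup>2)) + (\<Sum>K\<in>T. V K * H (r K))
      - (\<Sum>K\<in>T. V K * (1/2 * r' K * (norm (v' K))\<^sup>2)) - (\<Sum>K\<in>T. V K * H (r' K))
      + 1/2 * (\<Sum>K\<in>T. V K * (r' K * (norm (v K - v' K))\<^sup>2 + h2K K * \<bar>r K - r' K\<bar>\<^sup>2)) =
      \<tau> * (\<Sum>K\<in>T. V K * (((r K *\<^sub>R v K - r' K *\<^sub>R v' K) /\<^sub>R \<tau>) \<bullet> v K))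
      - \<tau> * (\<Sum>K\<in>T. V K * ((r K - r' K) / \<tau> * e K)) + \<tau> * (\<Sum>K\<in>T. V K * ((r K - r' K) / \<tau> * h K))"
    unfolding sum_distrib_left sum.distrib[symmetric] sum_subtractf[symmetric]
  proof (rule sum.cong[OF refl])
    fix K assume K: "K \<in> T"
    have "\<tau> * ((r K - r' K) / \<tau> * h K) = H (r K) - H (r' K) + 1/2 * (h2K K * \<bar>r K - r' K\<bar>\<^sup>2)"
      using h2K[OF K] \<tau> by (simp add: h_def mult.commute)
    moreover note kinetic_element[OF \<tau>, of "r K" "v K" "r' K" "v' K"]
    moreover have "\<tau> * (V K * x) - \<tau> * (V K * y) + \<tau> * (V K * z) = V K * (\<tau> * (x - y) + \<tau> * z)" for x y z
      by (simp add: algebra_simps)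
    ultimately show "V K * (1/2 * r K * (norm (v K))\<^sup>2) + V K * H (r K) - V K * (1/2 * r' K * (norm (v' K))\<^sup>2) - V K * H (r' K)
        + 1/2 * (V K * (r' K * (norm (v K - v' K))\<^sup>2 + h2K K * \<bar>r K - r' K\<bar>\<^sup>2)) =
        \<tau> * (V K * (((r K *\<^sub>R v K - r' K *\<^sub>R v' K) /\<^sub>R \<tau>) \<bullet> v K))
        - \<tau> * (V K * ((r K - r' K) / \<tau> * e K)) + \<tau> * (V K * ((r K - r' K) / \<tau> * h K))"
      unfolding e_def by (simp only:) (simp add: algebra_simps)
  qed
  have int: "\<tau> / 2 * (\<Sum>\<sigma>\<in>I. A \<sigma> * (\<bar>up \<sigma>\<bar> * (norm (v (pl \<sigma>) - v (ml \<sigma>)))\<^sup>2))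
      + \<tau> / 2 * (\<Sum>\<sigma>\<in>I. A \<sigma> * (h2S \<sigma> * (r (pl \<sigma>) - r (ml \<sigma>))\<^sup>2 * \<bar>s \<sigma>\<bar>)) =
      \<tau> * (\<Sum>\<sigma>\<in>I. A \<sigma> * upv \<sigma>) - \<tau> * (\<Sum>\<sigma>\<in>I. A \<sigma> * (up \<sigma> * (e (ml \<sigma>) - e (pl \<sigma>))))
      + \<tau> * (\<Sum>\<sigma>\<in>I. A \<sigma> * (up \<sigma> * (h (ml \<sigma>) - h (pl \<sigma>))))
      - \<tau> * (\<Sum>\<sigma>\<in>I. A \<sigma> * (s \<sigma> * (P (r (ml \<sigma>)) - P (r (pl \<sigma>)))))"
    unfolding sum_distrib_left sum.distrib[symmetric] sum_subtractf[symmetric]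
  proof (rule sum.cong[OF refl])
    fix \<sigma> assume \<sigma>: "\<sigma> \<in> I"
    have k: "upv \<sigma> - up \<sigma> * (e (ml \<sigma>) - e (pl \<sigma>)) = 1/2 * (\<bar>up \<sigma>\<bar> * (norm (v (pl \<sigma>) - v (ml \<sigma>)))\<^sup>2)"
      unfolding upv_def up_def e_def using kinetic_interface pos ml(1)[OF \<sigma>] by blast
    note p = h2S[OF \<sigma>, folded up_def, folded h_def]
    have "\<tau> * (A \<sigma> * upv \<sigma>) - \<tau> * (A \<sigma> * (up \<sigma> * (e (ml \<sigma>) - e (pl \<sigma>))))
        + \<tau> * (A \<sigma> * (up \<sigma> * (h (ml \<sigma>) - h (pl \<sigma>)))) - \<tau> * (A \<sigma> * (s \<sigma> * (P (r (ml \<sigma>)) - P (r (pl \<sigma>))))) =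
        \<tau> * (A \<sigma> * ((upv \<sigma> - up \<sigma> * (e (ml \<sigma>) - e (pl \<sigma>)))
          + (up \<sigma> * (h (ml \<sigma>) - h (pl \<sigma>)) - s \<sigma> * (P (r (ml \<sigma>)) - P (r (pl \<sigma>))))))"
      by (simp add: algebra_simps)
    also have "\<dots> = \<tau> * (A \<sigma> * (1/2 * (\<bar>up \<sigma>\<bar> * (norm (v (pl \<sigma>) - v (ml \<sigma>)))\<^sup>2) + 1/2 * (h2S \<sigma> * (r (pl \<sigma>) - r (ml \<sigma>))\<^sup>2 * \<bar>s \<sigma>\<bar>)))"
      unfolding k using p by (simp only: h_def up_def)
    finally show "\<tau> / 2 * (A \<sigma> * (\<bar>up \<sigma>\<bar> * (norm (v (pl \<sigma>) - v (ml \<sigma>)))\<^sup>2))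
        + \<tau> / 2 * (A \<sigma> * (h2S \<sigma> * (r (pl \<sigma>) - r (ml \<sigma>))\<^sup>2 * \<bar>s \<sigma>\<bar>)) =
        \<tau> * (A \<sigma> * upv \<sigma>) - \<tau> * (A \<sigma> * (up \<sigma> * (e (ml \<sigma>) - e (pl \<sigma>))))
        + \<tau> * (A \<sigma> * (up \<sigma> * (h (ml \<sigma>) - h (pl \<sigma>)))) - \<tau> * (A \<sigma> * (s \<sigma> * (P (r (ml \<sigma>)) - P (r (pl \<sigma>)))))"
      by (simp add: algebra_simps)
  qed
  \<comment> \<open>Mean times jump of the velocity is the jump of \<open>e\<close>, so this sum is
    the artificial diffusion of the continuity equation tested with \<open>e\<close>; only the one
    tested with \<open>h\<close> survives.\<close>
  have art: "(\<Sum>\<sigma>\<in>I. A \<sigma> * ((r (pl \<sigma>) - r (ml \<sigma>)) * (((1/2) *\<^sub>R (v (pl \<sigma>) + v (ml \<sigma>))) \<bullet> (v (pl \<sigma>) - v (ml \<sigma>))))) =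
      (\<Sum>\<sigma>\<in>I. A \<sigma> * ((r (pl \<sigma>) - r (ml \<sigma>)) * (e (pl \<sigma>) - e (ml \<sigma>))))"
    unfolding e_def power2_norm_eq_inner
    by (intro sum.cong refl) (simp add: inner_add_left inner_add_right inner_diff_left inner_diff_right inner_commute diff_divide_distrib)
  have Pb: "P (r (ml \<sigma>)) = r (ml \<sigma>) * h (ml \<sigma>) - H (r (ml \<sigma>))" if "\<sigma> \<in> Ob \<union> Ib" for \<sigma>
    unfolding h_def by (rule P[OF pos[OF ml(2)[OF that]]])
  have out: "\<tau> / 2 * (\<Sum>\<sigma>\<in>Ob. A \<sigma> * (r (ml \<sigma>) * b \<sigma> * (norm (v (ml \<sigma>)))\<^sup>2))
      + \<tau> * (\<Sum>\<sigma>\<in>Ob. A \<sigma> * (H (r (ml \<sigma>)) * b \<sigma>)) =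
      \<tau> * (\<Sum>\<sigma>\<in>Ob. A \<sigma> * (r (ml \<sigma>) * b \<sigma> * (norm (v (ml \<sigma>)))\<^sup>2)) - \<tau> * (\<Sum>\<sigma>\<in>Ob. A \<sigma> * (r (ml \<sigma>) * b \<sigma> * e (ml \<sigma>)))
      + \<tau> * (\<Sum>\<sigma>\<in>Ob. A \<sigma> * (r (ml \<sigma>) * b \<sigma> * h (ml \<sigma>))) - \<tau> * (\<Sum>\<sigma>\<in>Ob. A \<sigma> * (b \<sigma> * P (r (ml \<sigma>))))"
    unfolding sum_distrib_left sum.distrib[symmetric] sum_subtractf[symmetric]
    by (rule sum.cong[OF refl]) (simp add: Pb e_def algebra_simps)
  \<comment> \<open>Inflow means \<open>b \<sigma> < 0\<close>. By \<open>Pb\<close>, rB h - P = h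
    (rB - r) + H(r); times \<open>b \<sigma>\<close> this is the Bregman distance times
    \<open>\<bar>b \<sigma>\<bar>\<close>, short of the term H(rB), which is therefore subtracted on
    the left.\<close>
  have inn: "\<tau> * (\<Sum>\<sigma>\<in>Ib. A \<sigma> * ((H (rB (ml \<sigma>)) - H' (r (ml \<sigma>)) * (rB (ml \<sigma>) - r (ml \<sigma>)) - H (r (ml \<sigma>))) * \<bar>b \<sigma>\<bar>))
      - \<tau> * (\<Sum>\<sigma>\<in>Ib. A \<sigma> * (H (rB (ml \<sigma>)) * \<bar>b \<sigma>\<bar>))
      + \<tau> / 2 * (\<Sum>\<sigma>\<in>Ib. A \<sigma> * (rB (ml \<sigma>) * b \<sigma> * (norm (v (ml \<sigma>)))\<^sup>2)) =
      \<tau> * (\<Sum>\<sigma>\<in>Ib. A \<sigma> * (rB (ml \<sigma>) * b \<sigma> * (norm (v (ml \<sigma>)))\<^sup>2)) - \<tau> * (\<Sum>\<sigma>\<in>Ib. A \<sigma> * (rB (ml \<sigma>) * b \<sigma> * e (ml \<sigma>)))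
      + \<tau> * (\<Sum>\<sigma>\<in>Ib. A \<sigma> * (rB (ml \<sigma>) * b \<sigma> * h (ml \<sigma>))) - \<tau> * (\<Sum>\<sigma>\<in>Ib. A \<sigma> * (b \<sigma> * P (r (ml \<sigma>))))"
    unfolding sum_distrib_left sum.distrib[symmetric] sum_subtractf[symmetric]
    by (rule sum.cong[OF refl]) (simp add: Pb e_def h_def abs_of_neg b algebra_simps)
  have visc: "(\<Sum>K\<in>T. V K * (SV K + SB K - P (r K) * (trU K - trB K))) =
      (\<Sum>K\<in>T. V K * SV K) + (\<Sum>K\<in>T. V K * SB K) - (\<Sum>K\<in>T. V K * (P (r K) * trU K)) + (\<Sum>K\<in>T. V K * (P (r K) * trB K))"
    by (simp add: algebra_simps sum.distrib sum_subtractf)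
  \<comment> \<open>Multiplying each equation by \<open>\<tau>\<close> term by term makes every
    product of \<open>\<tau>\<close> with a sum an atom, so that the final combination is purely
    linear.\<close>
  have scale5: "\<tau> * a1 + \<tau> * a2 + \<tau> * a3 + \<tau> * a4 + \<alpha> * \<tau> * a5 = 0"
    if "a1 + a2 + a3 + a4 + \<alpha> * a5 = 0" for a1 a2 a3 a4 a5 :: real
    using arg_cong[OF that, of "\<lambda>x. \<tau> * x"] by (simp add: algebra_simps)
  have scale7: "\<tau> * a1 + \<tau> * a2 + \<tau> * a3 + \<tau> * a4 + \<tau> * a5 + (\<tau> * b1 + \<tau> * b2 - \<tau> * b3 + \<tau> * b4) + \<alpha> * \<tau> * a7 = 0"
    if "a1 + a2 + a3 + a4 + a5 + (b1 + b2 - b3 + b4) + \<alpha> * a7 = 0" for a1 a2 a3 a4 a5 b1 b2 b3 b4 a7 :: real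
    using arg_cong[OF that, of "\<lambda>x. \<tau> * x"] by (simp add: algebra_simps)
  have scale3: "\<tau> * a = \<tau> * x + \<tau> * y + \<tau> * z" if "a = x + y + z" for a x y z :: real
    using that by (simp add: algebra_simps)
  note c1 = scale5[OF cont[of e, folded up_def]] and c2 = scale5[OF cont[of h, folded up_def]]
  note m = scale7[OF mom[unfolded art visc, folded upv_def]]
  note d = scale3[OF pdiv]
  have u: "upw (s \<sigma>) (r (ml \<sigma>)) (r (pl \<sigma>)) = up \<sigma>" and h': "H' (r K) = h K"
    and uv: "upw (s \<sigma>) (r (ml \<sigma>) *\<^sub>R v (ml \<sigma>)) (r (pl \<sigma>) *\<^sub>R v (pl \<sigma>)) \<bullet> (v (ml \<sigma>) - v (pl \<sigma>)) = upv \<sigma>" for \<sigma> K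
    by (simp_all only: up_def h_def upv_def)
  show ?thesis
    using elem int out inn c1 c2 m d unfolding u h' uv by linarith
qed


section \<open>Reduction of the scheme to finite sums\<close>

text \<open>The balance is stated with \<open>deriv\<close>. It agrees with the explicit derivative
  only on the positive half-line, which being open is enough to differentiate once more.\<close>

lemma H_reg_deriv:
  fixes p p' :: "real \<Rightarrow> real" and \<kappa> \<eta> h :: real
  assumes "\<And>r. 0 \<le> r \<Longrightarrow> (p has_real_derivative p' r) (at r within {0..})" and r: "0 < r"
  defines "H \<equiv> H_reg p \<kappa> \<eta> h"
  shows "(H has_real_derivative deriv H r) (at r)"
    and "(deriv H has_real_derivative deriv (deriv H) r) (at r)"
    and "p_reg p \<kappa> \<eta> h r = r * deriv H r - H r"
proof -
  obtain H' H'' where H': "\<And>r. 0 < r \<Longrightarrow> (H has_real_derivative H' r) (at r)"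
    and H'': "\<And>r. 0 < r \<Longrightarrow> (H' has_real_derivative H'' r) (at r)"
    and p: "\<And>r. 0 < r \<Longrightarrow> r * H' r - H r = p_reg p \<kappa> \<eta> h r"
    using H_reg_derivatives[OF assms(1)] unfolding H_def by metis
  have eq: "deriv H x = H' x" if "0 < x" for x
    by (rule DERIV_imp_deriv) (rule H'[OF that])
  show "(H has_real_derivative deriv H r) (at r)"
    using H'[OF r] eq[OF r] by simp
  have "(deriv H has_real_derivative H'' r) (at r)"
    by (rule has_field_derivative_transform_within_open[OF H''[OF r], of "{0<..}"]) (use r eq in auto)
  then show "(deriv H has_real_derivative deriv (deriv H) r) (at r)"
    by (metis DERIV_imp_deriv)
  show "p_reg p \<kappa> \<eta> h r = r * deriv H r - H r"
    using p[OF r] eq[OF r] by simp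
qed

text \<open>Inserting \<open>P\<close> cancels all terms but \<open>\<bar>s\<bar>\<close> times the
  Bregman distance of \<open>H\<close> from the downwind to the upwind density. So the Taylor
  expansion is at \<open>b\<close> for nonnegative \<open>s\<close> and at \<open>a\<close>
  otherwise.\<close>

lemma upwind_entropy:
  fixes H H' H'' :: "real \<Rightarrow> real"
  assumes H: "\<And>r. 0 < r \<Longrightarrow> (H has_real_derivative H' r) (at r)"
    and H': "\<And>r. 0 < r \<Longrightarrow> (H' has_real_derivative H'' r) (at r)"
    and P: "\<And>r. 0 < r \<Longrightarrow> P r = r * H' r - H r" and pos: "0 < a" "0 < b"
  obtains \<xi> where "\<xi> \<in> {min a b..max a b}"
    "upw s a b * (H' a - H' b) - s * (P a - P b) = 1/2 * (H'' \<xi> * (b - a)\<^sup>2 * \<bar>s\<bar>)"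
proof (cases "0 \<le> s")
  case True
  obtain \<xi> where \<xi>: "\<xi> \<in> {min a b..max a b}" and T: "H a = H b + H' b * (a - b) + H'' \<xi> * (a - b)\<^sup>2 / 2"
    using Taylor_2[OF H H' pos] by blast
  have "upw s a b * (H' a - H' b) - s * (P a - P b) = s * (H a - H b - H' b * (a - b))"
    using True pos by (simp add: upw_def P algebra_simps)
  also have "\<dots> = 1/2 * (H'' \<xi> * (b - a)\<^sup>2 * \<bar>s\<bar>)"
    using True unfolding T by (simp add: power2_commute)
  finally show thesis using \<xi> that by blast
next
  case False
  obtain \<xi> where \<xi>: "\<xi> \<in> {min b a..max b a}" and T: "H b = H a + H' a * (b - a) + H'' \<xi> * (b - a)\<^sup>2 / 2"
    using Taylor_2[OF H H' pos(2,1)] by blast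
  have "upw s a b * (H' a - H' b) - s * (P a - P b) = - s * (H b - H a - H' a * (b - a))"
    using False pos by (simp add: upw_def P algebra_simps)
  also have "\<dots> = 1/2 * (H'' \<xi> * (b - a)\<^sup>2 * \<bar>s\<bar>)"
    using False unfolding T by simp
  finally show thesis using \<xi> that by (metis min.commute max.commute)
qed

lemma telescope_energy:
  fixes E a1 a2 a3 a4 a5 a6 a7 a8 b1 b2 b3 b4 b5 :: "nat \<Rightarrow> real"
  assumes "\<And>k. k \<in> {1..N} \<Longrightarrow> E k - E (k - 1) + \<tau> * a1 k + 1/2 * a2 k + \<tau> / 2 * a3 k + \<alpha> * \<tau> * a4 k
      + \<tau> / 2 * a5 k + \<tau> / 2 * a6 k + \<tau> * a7 k + \<tau> * a8 k =
    \<tau> * b1 k - \<tau> * b2 k - \<tau> * b3 k - \<tau> * b4 k - \<tau> / 2 * b5 k"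
  shows "m \<le> N \<Longrightarrow> E m + \<tau> * (\<Sum>k=1..m. a1 k) + 1/2 * (\<Sum>k=1..m. a2 k) + \<tau> / 2 * (\<Sum>k=1..m. a3 k)
      + \<alpha> * \<tau> * (\<Sum>k=1..m. a4 k) + \<tau> / 2 * (\<Sum>k=1..m. a5 k) + \<tau> / 2 * (\<Sum>k=1..m. a6 k)
      + \<tau> * (\<Sum>k=1..m. a7 k) + \<tau> * (\<Sum>k=1..m. a8 k) =
    E 0 + \<tau> * (\<Sum>k=1..m. b1 k) - \<tau> * (\<Sum>k=1..m. b2 k) - \<tau> * (\<Sum>k=1..m. b3 k) - \<tau> * (\<Sum>k=1..m. b4 k)
      - \<tau> / 2 * (\<Sum>k=1..m. b5 k)"
proof (induction m)
  case 0
  then show ?case by simp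
next
  case (Suc m)
  then show ?case
    using assms[of "Suc m"] by (simp add: sum.cl_ivl_Suc ring_distribs)
qed

section \<open>The scheme and the pressure term as sums over elements and faces\<close>

context tetrahedral_mesh
begin

lemma opp_elem_interior:
  assumes "\<sigma> \<in> faces_int \<Omega> \<T>"
  shows "opp_elem \<T> (elem_m \<sigma>) \<sigma> = elem_p \<sigma>" "opp_elem \<T> (elem_p \<sigma>) \<sigma> = elem_m \<sigma>"
proof -
  have "L \<in> \<T> \<and> \<sigma> \<in> faces_of L \<longleftrightarrow> L = elem_m \<sigma> \<or> L = elem_p \<sigma>" for L
    using interior_face_elems(3)[OF assms] by blast
  then have *: "L \<in> \<T> \<and> L \<noteq> K \<and> \<sigma> \<in> faces_of L \<longleftrightarrow> (L = elem_m \<sigma> \<or> L = elem_p \<sigma>) \<and> L \<noteq> K" for L K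
    by blast
  note ne = interior_face_elems(4)[OF assms]
  show "opp_elem \<T> (elem_m \<sigma>) \<sigma> = elem_p \<sigma>" "opp_elem \<T> (elem_p \<sigma>) \<sigma> = elem_m \<sigma>"
    unfolding opp_elem_def * by (rule the_equality; use ne in metis)+
qed

text \<open>The two sides see opposite normals. At \<open>s = 0\<close> they choose different upwind
  elements, but the flux vanishes, so antisymmetry holds without exception.\<close>

lemma flux_interior:
  assumes "\<sigma> \<in> faces_int \<Omega> \<T>"
  shows "flux \<T> g u (elem_m \<sigma>) \<sigma> =
      upw (face_val \<T> u \<sigma> \<bullet> \<nu> \<sigma>) (elem_val (elem_m \<sigma>) g) (elem_val (elem_p \<sigma>) g)"
    and "flux \<T> g u (elem_p \<sigma>) \<sigma> =
      - upw (face_val \<T> u \<sigma> \<bullet> \<nu> \<sigma>) (elem_val (elem_m \<sigma>) g) (elem_val (elem_p \<sigma>) g)"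
  unfolding flux_def opp_elem_interior[OF assms] upw_def Let_def
  using interior_face_elems(1,2)[OF assms] by auto

lemma Up_eq_upw:
  assumes "r \<in> Q_space \<T>" "\<sigma> \<in> faces_int \<Omega> \<T>"
  shows "Up \<T> \<nu> r u \<sigma> = upw (face_val \<T> u \<sigma> \<bullet> \<nu> \<sigma>) (elem_val (elem_m \<sigma>) r) (elem_val (elem_p \<sigma>) r)"
  unfolding Up_def trace_Q[OF assms] upw_def by (simp add: max_def min_def)

lemma elem_trace_face:
  assumes "g \<in> Q_space \<T>" "K \<in> \<T>" "\<sigma> \<in> faces_of K" "x \<in> \<sigma>"
  shows "elem_trace K g x = elem_val K g"
  using elem_trace_Q[OF assms(1,2)] tetrahedron_face.face_subset[OF tetrahedron_face[OF assms(2,3)]] assms(4) by blast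

lemma surf_int_mesh:
  assumes "\<sigma> \<in> faces \<T>" "\<And>x. x \<in> \<sigma> \<Longrightarrow> f x = (d :: real)"
  shows "surf_int \<sigma> f = area \<sigma> * d"
proof -
  obtain K where "K \<in> \<T>" "\<sigma> \<in> faces_of K"
    using assms(1) by (auto simp: faces_def)
  from tetrahedron_face.surf_int_const[OF tetrahedron_face[OF this] assms(2)] show ?thesis
    by simp
qed

lemma faces_subsets: "\<sigma> \<in> faces_int \<Omega> \<T> \<Longrightarrow> \<sigma> \<in> faces \<T>" "\<sigma> \<in> faces_ext \<Omega> \<T> \<Longrightarrow> \<sigma> \<in> faces \<T>"
  "\<sigma> \<in> faces_in \<Omega> \<T> \<nu> uB \<Longrightarrow> \<sigma> \<in> faces_ext \<Omega> \<T>" "\<sigma> \<in> faces_out \<Omega> \<T> \<nu> uB \<Longrightarrow> \<sigma> \<in> faces_ext \<Omega> \<T>"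
  by (auto simp: faces_int_def faces_ext_def faces_in_def faces_out_def)

lemma Q_space_scaleR:
  assumes "r \<in> Q_space \<T>" "v \<in> Q_space \<T>"
  shows "(\<lambda>y. r y *\<^sub>R v y) \<in> Q_space \<T>"
    and "K \<in> \<T> \<Longrightarrow> elem_val K (\<lambda>y. r y *\<^sub>R v y) = elem_val K r *\<^sub>R elem_val K v"
  using Q_space_elem_val[OF assms(1)] Q_space_elem_val[OF assms(2)]
  by (auto intro!: Q_spaceI[where k = "\<lambda>K. elem_val K r *\<^sub>R elem_val K v"] elem_val_mesh)

text \<open>Any numbers \<open>\<phi>\<close> attached to the elements are the values of a test
  function in \<open>Q_space\<close>, so \<open>\<phi>\<close> is arbitrary; this permits the
  nonlinear test functions of the energy estimate.\<close>

lemma continuity_reduced: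
  fixes \<rho> :: "nat \<Rightarrow> vec3 \<Rightarrow> real" and \<phi> :: "vec3 set \<Rightarrow> real"
  assumes scheme: "continuity_scheme \<Omega> \<T> \<nu> \<tau> \<alpha> \<rho>B uB \<rho> u k"
    and Q: "\<rho> k \<in> Q_space \<T>" "\<rho> (k - 1) \<in> Q_space \<T>" "\<rho>B \<in> Q_space \<T>"
  defines "r \<equiv> \<lambda>K. elem_val K (\<rho> k)" and "r' \<equiv> \<lambda>K. elem_val K (\<rho> (k - 1))" and "rB \<equiv> \<lambda>K. elem_val K \<rho>B"
    and "s \<equiv> \<lambda>\<sigma>. face_val \<T> (u k) \<sigma> \<bullet> \<nu> \<sigma>" and "b \<equiv> \<lambda>\<sigma>. face_val \<T> uB \<sigma> \<bullet> \<nu> \<sigma>"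
  shows "(\<Sum>K\<in>\<T>. measure lebesgue K * ((r K - r' K) / \<tau> * \<phi> K))
      + (\<Sum>\<sigma>\<in>faces_int \<Omega> \<T>. area \<sigma> * (upw (s \<sigma>) (r (elem_m \<sigma>)) (r (elem_p \<sigma>)) * (\<phi> (elem_m \<sigma>) - \<phi> (elem_p \<sigma>))))
      + (\<Sum>\<sigma>\<in>faces_out \<Omega> \<T> \<nu> uB. area \<sigma> * (r (elem_m \<sigma>) * b \<sigma> * \<phi> (elem_m \<sigma>)))
      + (\<Sum>\<sigma>\<in>faces_in \<Omega> \<T> \<nu> uB. area \<sigma> * (rB (elem_m \<sigma>) * b \<sigma> * \<phi> (elem_m \<sigma>)))
      + \<alpha> * (\<Sum>\<sigma>\<in>faces_int \<Omega> \<T>. area \<sigma> * ((r (elem_p \<sigma>) - r (elem_m \<sigma>)) * (\<phi> (elem_p \<sigma>) - \<phi> (elem_m \<sigma>)))) = 0"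
proof -
  define \<psi> where "\<psi> = (\<lambda>x. \<Sum>K\<in>\<T>. indicator (interior K) x *\<^sub>R \<phi> K)"
  have \<psi>: "\<psi> x = \<phi> K" if "K \<in> \<T>" "x \<in> interior K" for K x
    unfolding \<psi>_def using sum_indicator_interior[OF that] .
  have \<psi>Q: "\<psi> \<in> Q_space \<T>" by (rule Q_spaceI[OF \<psi>])
  have \<psi>v: "elem_val K \<psi> = \<phi> K" if "K \<in> \<T>" for K
    using elem_val_mesh[OF that \<psi>[OF that]] .
  have 1: "integral \<Omega> (\<lambda>x. Dt \<tau> \<rho> k x * \<psi> x) = (\<Sum>K\<in>\<T>. measure lebesgue K * ((r K - r' K) / \<tau> * \<phi> K))"
    by (rule integral_piecewise)
      (simp add: Dt_def \<psi> Q_space_elem_val[OF Q(1)] Q_space_elem_val[OF Q(2)] r_def r'_def divide_inverse mult.commute del: One_nat_def)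
  have 2: "(\<Sum>K\<in>\<T>. \<Sum>\<sigma>\<in>faces_of K \<inter> faces_int \<Omega> \<T>. surf_int \<sigma> (\<lambda>x. flux \<T> (\<rho> k) (u k) K \<sigma> * elem_trace K \<psi> x)) =
      (\<Sum>\<sigma>\<in>faces_int \<Omega> \<T>. area \<sigma> * (upw (s \<sigma>) (r (elem_m \<sigma>)) (r (elem_p \<sigma>)) * (\<phi> (elem_m \<sigma>) - \<phi> (elem_p \<sigma>))))"
    unfolding sum_interior_faces
  proof (rule sum.cong[OF refl])
    fix \<sigma> assume \<sigma>: "\<sigma> \<in> faces_int \<Omega> \<T>"
    note m = interior_face_elems(1)[OF \<sigma>] and p = interior_face_elems(2)[OF \<sigma>]
    note traces = elem_trace_face[OF _ m[THEN conjunct1] m[THEN conjunct2, THEN conjunct1]]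
      elem_trace_face[OF _ p[THEN conjunct1] p[THEN conjunct2, THEN conjunct1]]
    have "surf_int \<sigma> (\<lambda>x. flux \<T> (\<rho> k) (u k) (elem_m \<sigma>) \<sigma> * elem_trace (elem_m \<sigma>) \<psi> x) =
        area \<sigma> * (upw (s \<sigma>) (r (elem_m \<sigma>)) (r (elem_p \<sigma>)) * \<phi> (elem_m \<sigma>))"
      by (rule surf_int_mesh[OF faces_subsets(1)[OF \<sigma>]])
        (use m in \<open>simp add: flux_interior[OF \<sigma>] traces[OF \<psi>Q] \<psi>v s_def r_def\<close>)
    moreover have "surf_int \<sigma> (\<lambda>x. flux \<T> (\<rho> k) (u k) (elem_p \<sigma>) \<sigma> * elem_trace (elem_p \<sigma>) \<psi> x) =
        area \<sigma> * (- upw (s \<sigma>) (r (elem_m \<sigma>)) (r (elem_p \<sigma>)) * \<phi> (elem_p \<sigma>))"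
      by (rule surf_int_mesh[OF faces_subsets(1)[OF \<sigma>]])
        (use p in \<open>simp add: flux_interior[OF \<sigma>] traces[OF \<psi>Q] \<psi>v s_def r_def\<close>)
    ultimately show "surf_int \<sigma> (\<lambda>x. flux \<T> (\<rho> k) (u k) (elem_m \<sigma>) \<sigma> * elem_trace (elem_m \<sigma>) \<psi> x)
        + surf_int \<sigma> (\<lambda>x. flux \<T> (\<rho> k) (u k) (elem_p \<sigma>) \<sigma> * elem_trace (elem_p \<sigma>) \<psi> x) =
        area \<sigma> * (upw (s \<sigma>) (r (elem_m \<sigma>)) (r (elem_p \<sigma>)) * (\<phi> (elem_m \<sigma>) - \<phi> (elem_p \<sigma>)))"
      by (simp add: algebra_simps)
  qed
  have ext: "surf_int \<sigma> (\<lambda>x. face_trace \<T> \<sigma> g x * (face_val \<T> uB \<sigma> \<bullet> \<nu> \<sigma>) * face_trace \<T> \<sigma> \<psi> x) =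
      area \<sigma> * (elem_val (elem_m \<sigma>) g * b \<sigma> * \<phi> (elem_m \<sigma>))" if "\<sigma> \<in> faces_ext \<Omega> \<T>" "g \<in> Q_space \<T>" for \<sigma> g
    by (rule surf_int_mesh[OF faces_subsets(2)[OF that(1)]])
      (use exterior_face_elem(1)[OF that(1)] in \<open>simp add: face_trace_Q that \<psi>Q \<psi>v b_def\<close>)
  have 3: "(\<Sum>\<sigma>\<in>faces_out \<Omega> \<T> \<nu> uB. surf_int \<sigma> (\<lambda>x. face_trace \<T> \<sigma> (\<rho> k) x * (face_val \<T> uB \<sigma> \<bullet> \<nu> \<sigma>) * face_trace \<T> \<sigma> \<psi> x)) =
      (\<Sum>\<sigma>\<in>faces_out \<Omega> \<T> \<nu> uB. area \<sigma> * (r (elem_m \<sigma>) * b \<sigma> * \<phi> (elem_m \<sigma>)))"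
    unfolding r_def by (rule sum.cong[OF refl ext[OF faces_subsets(4) Q(1)]])
  have 4: "(\<Sum>\<sigma>\<in>faces_in \<Omega> \<T> \<nu> uB. surf_int \<sigma> (\<lambda>x. face_trace \<T> \<sigma> \<rho>B x * (face_val \<T> uB \<sigma> \<bullet> \<nu> \<sigma>) * face_trace \<T> \<sigma> \<psi> x)) =
      (\<Sum>\<sigma>\<in>faces_in \<Omega> \<T> \<nu> uB. area \<sigma> * (rB (elem_m \<sigma>) * b \<sigma> * \<phi> (elem_m \<sigma>)))"
    unfolding rB_def by (rule sum.cong[OF refl ext[OF faces_subsets(3) Q(3)]])
  have 5: "(\<Sum>\<sigma>\<in>faces_int \<Omega> \<T>. surf_int \<sigma> (\<lambda>x. jump \<nu> (\<rho> k) \<sigma> * jump \<nu> \<psi> \<sigma>)) =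
      (\<Sum>\<sigma>\<in>faces_int \<Omega> \<T>. area \<sigma> * ((r (elem_p \<sigma>) - r (elem_m \<sigma>)) * (\<phi> (elem_p \<sigma>) - \<phi> (elem_m \<sigma>))))"
    by (intro sum.cong refl surf_int_mesh faces_subsets(1))
      (simp_all add: jump_def trace_Q Q(1) \<psi>Q \<psi>v interior_face_elems r_def)
  show ?thesis
    using scheme \<psi>Q unfolding continuity_scheme_def 1[symmetric] 2[symmetric] 3[symmetric] 4[symmetric] 5[symmetric] by blast
qed

text \<open>The test function is \<open>u k - uB\<close>, whose projection \<open>v\<close> appears
  in place of the hat of the test function. The third sum has been turned from faces to elements by
  \<open>convection_V\<close>.\<close>

lemma momentum_reduced:
  fixes \<rho> :: "nat \<Rightarrow> vec3 \<Rightarrow> real" and u :: "nat \<Rightarrow> vec3 \<Rightarrow> vec3"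
  assumes scheme: "momentum_scheme \<Omega> \<T> \<nu> \<tau> \<alpha> \<mu> lam ph \<rho>B uB \<rho> u k"
    and Q: "\<rho> k \<in> Q_space \<T>" "\<rho> (k - 1) \<in> Q_space \<T>" "\<rho>B \<in> Q_space \<T>"
    and V: "u k \<in> V_space \<Omega> \<T>" "uB \<in> V_space \<Omega> \<T>" "(\<lambda>x. u k x - uB x) \<in> V0_space \<Omega> \<T>"
  defines "r \<equiv> \<lambda>K. elem_val K (\<rho> k)" and "r' \<equiv> \<lambda>K. elem_val K (\<rho> (k - 1))" and "rB \<equiv> \<lambda>K. elem_val K \<rho>B"
    and "s \<equiv> \<lambda>\<sigma>. face_val \<T> (u k) \<sigma> \<bullet> \<nu> \<sigma>" and "b \<equiv> \<lambda>\<sigma>. face_val \<T> uB \<sigma> \<bullet> \<nu> \<sigma>"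
    and "v \<equiv> \<lambda>K. elem_val K (PiQ \<T> (\<lambda>x. u k x - uB x))"
    and "v' \<equiv> \<lambda>K. elem_val K (PiQ \<T> (\<lambda>x. u (k - 1) x - uB x))"
    and "w \<equiv> \<lambda>K. elem_val K (PiQ \<T> (u k))"
    and "G \<equiv> \<lambda>K. elem_val K (grad_h (u k))" and "GB \<equiv> \<lambda>K. elem_val K (grad_h uB)"
  shows "(\<Sum>K\<in>\<T>. measure lebesgue K * (((r K *\<^sub>R v K - r' K *\<^sub>R v' K) /\<^sub>R \<tau>) \<bullet> v K))
      + (\<Sum>\<sigma>\<in>faces_int \<Omega> \<T>. area \<sigma> * (upw (s \<sigma>) (r (elem_m \<sigma>) *\<^sub>R v (elem_m \<sigma>)) (r (elem_p \<sigma>) *\<^sub>R v (elem_p \<sigma>)) \<bullet> (v (elem_m \<sigma>) - v (elem_p \<sigma>))))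
      + (\<Sum>K\<in>\<T>. measure lebesgue K * (r K * ((GB K *v w K) \<bullet> v K)))
      + (\<Sum>\<sigma>\<in>faces_out \<Omega> \<T> \<nu> uB. area \<sigma> * (r (elem_m \<sigma>) * b \<sigma> * (norm (v (elem_m \<sigma>)))\<^sup>2))
      + (\<Sum>\<sigma>\<in>faces_in \<Omega> \<T> \<nu> uB. area \<sigma> * (rB (elem_m \<sigma>) * b \<sigma> * (norm (v (elem_m \<sigma>)))\<^sup>2))
      + (\<Sum>K\<in>\<T>. measure lebesgue K * (stress \<mu> lam (G K - GB K) \<bullet> (G K - GB K) + stress \<mu> lam (GB K) \<bullet> (G K - GB K)
          - ph (r K) * (trace (G K) - trace (GB K))))
      + \<alpha> * (\<Sum>\<sigma>\<in>faces_int \<Omega> \<T>. area \<sigma> * ((r (elem_p \<sigma>) - r (elem_m \<sigma>)) * (((1/2) *\<^sub>R (v (elem_p \<sigma>) + v (elem_m \<sigma>))) \<bullet> (v (elem_p \<sigma>) - v (elem_m \<sigma>))))) = 0"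
proof -
  define vh where "vh = (\<lambda>j. PiQ \<T> (\<lambda>x. u j x - uB x))"
  have vQ: "vh j \<in> Q_space \<T>" for j by (simp add: vh_def PiQ_in_Q_space)
  have v: "elem_val K (vh k) = v K" "elem_val K (vh (k - 1)) = v' K" for K
    by (simp_all add: vh_def v_def v'_def)
  have r: "elem_val K (\<rho> k) = r K" "elem_val K (\<rho> (k - 1)) = r' K" "elem_val K \<rho>B = rB K" for K
    by (simp_all add: r_def r'_def rB_def)
  note vals = Q_space_elem_val[OF Q(1), unfolded r] Q_space_elem_val[OF Q(2), unfolded r]
    Q_space_elem_val[OF vQ[of k], unfolded v] Q_space_elem_val[OF vQ[of "k - 1"], unfolded v]
  have 1: "integral \<Omega> (\<lambda>x. Dt \<tau> (\<lambda>j y. \<rho> j y *\<^sub>R vh j y) k x \<bullet> vh k x) =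
      (\<Sum>K\<in>\<T>. measure lebesgue K * (((r K *\<^sub>R v K - r' K *\<^sub>R v' K) /\<^sub>R \<tau>) \<bullet> v K))"
    by (rule integral_piecewise) (simp only: Dt_def vals)
  have 2: "(\<Sum>K\<in>\<T>. \<Sum>\<sigma>\<in>faces_of K \<inter> faces_int \<Omega> \<T>. surf_int \<sigma> (\<lambda>x. flux \<T> (\<lambda>y. \<rho> k y *\<^sub>R vh k y) (u k) K \<sigma> \<bullet> elem_trace K (vh k) x)) =
      (\<Sum>\<sigma>\<in>faces_int \<Omega> \<T>. area \<sigma> * (upw (s \<sigma>) (r (elem_m \<sigma>) *\<^sub>R v (elem_m \<sigma>)) (r (elem_p \<sigma>) *\<^sub>R v (elem_p \<sigma>)) \<bullet> (v (elem_m \<sigma>) - v (elem_p \<sigma>))))"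
    unfolding sum_interior_faces
  proof (rule sum.cong[OF refl])
    fix \<sigma> assume \<sigma>: "\<sigma> \<in> faces_int \<Omega> \<T>"
    note m = interior_face_elems(1)[OF \<sigma>] and p = interior_face_elems(2)[OF \<sigma>]
    note traces = elem_trace_face[OF _ m[THEN conjunct1] m[THEN conjunct2, THEN conjunct1]]
      elem_trace_face[OF _ p[THEN conjunct1] p[THEN conjunct2, THEN conjunct1]]
    let ?up = "upw (s \<sigma>) (r (elem_m \<sigma>) *\<^sub>R v (elem_m \<sigma>)) (r (elem_p \<sigma>) *\<^sub>R v (elem_p \<sigma>))"
    have rv: "elem_val (elem_m \<sigma>) (\<lambda>y. \<rho> k y *\<^sub>R vh k y) = r (elem_m \<sigma>) *\<^sub>R v (elem_m \<sigma>)"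
      "elem_val (elem_p \<sigma>) (\<lambda>y. \<rho> k y *\<^sub>R vh k y) = r (elem_p \<sigma>) *\<^sub>R v (elem_p \<sigma>)"
      using Q_space_scaleR(2)[OF Q(1) vQ[of k]] m p by (simp_all add: r v)
    note fl = flux_interior[OF \<sigma>, of "\<lambda>y. \<rho> k y *\<^sub>R vh k y" "u k", unfolded rv, folded s_def]
    have "surf_int \<sigma> (\<lambda>x. flux \<T> (\<lambda>y. \<rho> k y *\<^sub>R vh k y) (u k) (elem_m \<sigma>) \<sigma> \<bullet> elem_trace (elem_m \<sigma>) (vh k) x) =
        area \<sigma> * (?up \<bullet> v (elem_m \<sigma>))"
      unfolding fl by (rule surf_int_mesh[OF faces_subsets(1)[OF \<sigma>]])
        (use m in \<open>simp add: s_def traces[OF vQ] v\<close>)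
    moreover have "surf_int \<sigma> (\<lambda>x. flux \<T> (\<lambda>y. \<rho> k y *\<^sub>R vh k y) (u k) (elem_p \<sigma>) \<sigma> \<bullet> elem_trace (elem_p \<sigma>) (vh k) x) =
        area \<sigma> * (- ?up \<bullet> v (elem_p \<sigma>))"
      unfolding fl by (rule surf_int_mesh[OF faces_subsets(1)[OF \<sigma>]])
        (use p in \<open>simp add: s_def traces[OF vQ] v\<close>)
    ultimately show "surf_int \<sigma> (\<lambda>x. flux \<T> (\<lambda>y. \<rho> k y *\<^sub>R vh k y) (u k) (elem_m \<sigma>) \<sigma> \<bullet> elem_trace (elem_m \<sigma>) (vh k) x)
        + surf_int \<sigma> (\<lambda>x. flux \<T> (\<lambda>y. \<rho> k y *\<^sub>R vh k y) (u k) (elem_p \<sigma>) \<sigma> \<bullet> elem_trace (elem_p \<sigma>) (vh k) x) =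
        area \<sigma> * (?up \<bullet> (v (elem_m \<sigma>) - v (elem_p \<sigma>)))"
      by (simp add: inner_diff_right right_diff_distrib)
  qed
  have 3: "(\<Sum>K\<in>\<T>. \<Sum>\<sigma>\<in>faces_of K. surf_int \<sigma> (\<lambda>x. elem_trace K (\<rho> k) x * (elem_trace K (PiQ \<T> (u k)) x \<bullet> elem_normal K \<sigma>)
      * (elem_trace K uB x \<bullet> elem_trace K (vh k) x))) = (\<Sum>K\<in>\<T>. measure lebesgue K * (r K * ((GB K *v w K) \<bullet> v K)))"
    by (rule sum.cong[OF refl]) (simp only: convection_V[OF V(2) _ Q(1) PiQ_in_Q_space vQ] r v w_def GB_def)
  have ext: "surf_int \<sigma> (\<lambda>x. face_trace \<T> \<sigma> g x * (face_val \<T> uB \<sigma> \<bullet> \<nu> \<sigma>) * (face_trace \<T> \<sigma> (vh k) x \<bullet> face_trace \<T> \<sigma> (vh k) x)) =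
      area \<sigma> * (elem_val (elem_m \<sigma>) g * b \<sigma> * (norm (v (elem_m \<sigma>)))\<^sup>2)" if "\<sigma> \<in> faces_ext \<Omega> \<T>" "g \<in> Q_space \<T>" for \<sigma> g
    by (rule surf_int_mesh[OF faces_subsets(2)[OF that(1)]])
      (simp add: face_trace_Q that vQ v b_def power2_norm_eq_inner)
  have 4: "(\<Sum>\<sigma>\<in>faces_out \<Omega> \<T> \<nu> uB. surf_int \<sigma> (\<lambda>x. face_trace \<T> \<sigma> (\<rho> k) x * (face_val \<T> uB \<sigma> \<bullet> \<nu> \<sigma>)
      * (face_trace \<T> \<sigma> (vh k) x \<bullet> face_trace \<T> \<sigma> (vh k) x))) =
      (\<Sum>\<sigma>\<in>faces_out \<Omega> \<T> \<nu> uB. area \<sigma> * (r (elem_m \<sigma>) * b \<sigma> * (norm (v (elem_m \<sigma>)))\<^sup>2))"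
    unfolding r_def by (rule sum.cong[OF refl ext[OF faces_subsets(4) Q(1)]])
  have 5: "(\<Sum>\<sigma>\<in>faces_in \<Omega> \<T> \<nu> uB. surf_int \<sigma> (\<lambda>x. face_trace \<T> \<sigma> \<rho>B x * (face_val \<T> uB \<sigma> \<bullet> \<nu> \<sigma>)
      * (face_trace \<T> \<sigma> (vh k) x \<bullet> face_trace \<T> \<sigma> (vh k) x))) =
      (\<Sum>\<sigma>\<in>faces_in \<Omega> \<T> \<nu> uB. area \<sigma> * (rB (elem_m \<sigma>) * b \<sigma> * (norm (v (elem_m \<sigma>)))\<^sup>2))"
    unfolding rB_def by (rule sum.cong[OF refl ext[OF faces_subsets(3) Q(3)]])
  \<comment> \<open>Splits the stress of \<open>u\<close> into that of \<open>u - uB\<close>, the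
    dissipation, and that of \<open>uB\<close>, a source on the right of the balance.\<close>
  have str: "stress \<mu> lam A = stress \<mu> lam (A - B) + stress \<mu> lam B" for A B
    by (simp add: stress_def trace_sub algebra_simps)
  have 6: "integral \<Omega> (\<lambda>x. stress \<mu> lam (grad_h (u k) x) \<bullet> grad_h (\<lambda>x. u k x - uB x) x - ph (\<rho> k x) * div_h (\<lambda>x. u k x - uB x) x) =
      (\<Sum>K\<in>\<T>. measure lebesgue K * (stress \<mu> lam (G K - GB K) \<bullet> (G K - GB K) + stress \<mu> lam (GB K) \<bullet> (G K - GB K)
          - ph (r K) * (trace (G K) - trace (GB K))))"
  proof (rule integral_piecewise)
    fix K x assume Kx: "K \<in> \<T>" "x \<in> interior K"
    have g: "grad_h (u k) x = G K" "grad_h (\<lambda>x. u k x - uB x) x = G K - GB K"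
      using Q_space_elem_val[OF grad_h_in_Q_space[OF V(1)] Kx] V_space_diff(1)[OF V(1,2) Kx] by (simp_all add: G_def GB_def)
    show "stress \<mu> lam (grad_h (u k) x) \<bullet> grad_h (\<lambda>x. u k x - uB x) x - ph (\<rho> k x) * div_h (\<lambda>x. u k x - uB x) x =
        stress \<mu> lam (G K - GB K) \<bullet> (G K - GB K) + stress \<mu> lam (GB K) \<bullet> (G K - GB K) - ph (r K) * (trace (G K) - trace (GB K))"
      unfolding div_h_def g vals(1)[OF Kx] trace_sub by (subst str[of "G K" "GB K"]) (simp only: inner_add_left)
  qed
  have 7: "(\<Sum>\<sigma>\<in>faces_int \<Omega> \<T>. surf_int \<sigma> (\<lambda>x. jump \<nu> (\<rho> k) \<sigma> * (mean \<nu> (vh k) \<sigma> \<bullet> jump \<nu> (vh k) \<sigma>))) =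
      (\<Sum>\<sigma>\<in>faces_int \<Omega> \<T>. area \<sigma> * ((r (elem_p \<sigma>) - r (elem_m \<sigma>)) * (((1/2) *\<^sub>R (v (elem_p \<sigma>) + v (elem_m \<sigma>))) \<bullet> (v (elem_p \<sigma>) - v (elem_m \<sigma>)))))"
    by (intro sum.cong refl surf_int_mesh faces_subsets(1))
      (simp_all add: jump_def mean_def trace_Q Q(1) vQ v r)
  show ?thesis
    using scheme V(3) unfolding momentum_scheme_def Let_def vh_def[symmetric] fun_cong[OF vh_def[symmetric]]
      1[symmetric] 2[symmetric] 3[symmetric] 4[symmetric] 5[symmetric] 6[symmetric] 7[symmetric]
    by (auto dest!: bspec simp: vh_def)
qed

text \<open>Discrete integration by parts: the divergence theorem on each element, then regrouping
  by faces. The common face value of \<open>u\<close> meets opposite normals, leaving differences of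
  \<open>P\<close>; on the boundary it is that of \<open>uB\<close>.\<close>

lemma pressure_divergence:
  fixes P :: "vec3 set \<Rightarrow> real"
  assumes "u \<in> V_space \<Omega> \<T>" "uB \<in> V_space \<Omega> \<T>" "(\<lambda>x. u x - uB x) \<in> V0_space \<Omega> \<T>"
  shows "(\<Sum>K\<in>\<T>. measure lebesgue K * (P K * trace (elem_val K (grad_h u)))) =
      (\<Sum>\<sigma>\<in>faces_int \<Omega> \<T>. area \<sigma> * ((face_val \<T> u \<sigma> \<bullet> \<nu> \<sigma>) * (P (elem_m \<sigma>) - P (elem_p \<sigma>))))
      + (\<Sum>\<sigma>\<in>faces_out \<Omega> \<T> \<nu> uB. area \<sigma> * ((face_val \<T> uB \<sigma> \<bullet> \<nu> \<sigma>) * P (elem_m \<sigma>)))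
      + (\<Sum>\<sigma>\<in>faces_in \<Omega> \<T> \<nu> uB. area \<sigma> * ((face_val \<T> uB \<sigma> \<bullet> \<nu> \<sigma>) * P (elem_m \<sigma>)))"
proof -
  have "measure lebesgue K * (P K * trace (elem_val K (grad_h u))) =
      (\<Sum>\<sigma>\<in>faces_of K. area \<sigma> * ((face_val \<T> u \<sigma> \<bullet> elem_normal K \<sigma>) * P K))" if "K \<in> \<T>" for K
  proof -
    have "(\<Sum>\<sigma>\<in>faces_of K. area \<sigma> * ((face_val \<T> u \<sigma> \<bullet> elem_normal K \<sigma>) * P K)) =
        P K * (\<Sum>\<sigma>\<in>faces_of K. area \<sigma> * (face_val \<T> u \<sigma> \<bullet> elem_normal K \<sigma>))"
      by (simp add: sum_distrib_left algebra_simps)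
    then show ?thesis
      unfolding divergence_V[OF assms(1) that] by simp
  qed
  then have "(\<Sum>K\<in>\<T>. measure lebesgue K * (P K * trace (elem_val K (grad_h u)))) =
      (\<Sum>K\<in>\<T>. \<Sum>\<sigma>\<in>faces_of K. area \<sigma> * ((face_val \<T> u \<sigma> \<bullet> elem_normal K \<sigma>) * P K))"
    by simp
  also have "\<dots> = (\<Sum>\<sigma>\<in>faces_int \<Omega> \<T>. area \<sigma> * ((face_val \<T> u \<sigma> \<bullet> \<nu> \<sigma>) * (P (elem_m \<sigma>) - P (elem_p \<sigma>))))
      + (\<Sum>\<sigma>\<in>faces_ext \<Omega> \<T>. area \<sigma> * ((face_val \<T> uB \<sigma> \<bullet> \<nu> \<sigma>) * P (elem_m \<sigma>)))"
    unfolding sum_all_faces using interior_face_elems(1,2) exterior_face_elem(1) face_val_exterior_eq[OF assms]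
    by (intro arg_cong2[of _ _ _ _ "(+)"] sum.cong refl) (simp_all add: algebra_simps)
  also have "faces_ext \<Omega> \<T> = faces_out \<Omega> \<T> \<nu> uB \<union> faces_in \<Omega> \<T> \<nu> uB"
    by (auto simp: faces_in_def faces_out_def)
  also have "(\<Sum>\<sigma>\<in>faces_out \<Omega> \<T> \<nu> uB \<union> faces_in \<Omega> \<T> \<nu> uB. area \<sigma> * ((face_val \<T> uB \<sigma> \<bullet> \<nu> \<sigma>) * P (elem_m \<sigma>))) =
      (\<Sum>\<sigma>\<in>faces_out \<Omega> \<T> \<nu> uB. area \<sigma> * ((face_val \<T> uB \<sigma> \<bullet> \<nu> \<sigma>) * P (elem_m \<sigma>)))
      + (\<Sum>\<sigma>\<in>faces_in \<Omega> \<T> \<nu> uB. area \<sigma> * ((face_val \<T> uB \<sigma> \<bullet> \<nu> \<sigma>) * P (elem_m \<sigma>)))"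
    by (rule sum.union_disjoint)
      (use finite_faces(3) in \<open>auto simp: faces_in_def faces_out_def\<close>)
  finally show ?thesis by (simp add: add.assoc)
qed

end


section \<open>The balance laws\<close>

theorem lemma6p1:
  fixes \<Omega> :: "vec3 set" and \<T> :: "vec3 set set" and \<nu> :: "vec3 set \<Rightarrow> vec3"
    and T \<tau> h c \<mu> lam \<kappa> \<kappa>' \<omega> \<eta> :: real and N :: nat
    and p p' ph Hh :: "real \<Rightarrow> real"
    and r0 rBdata \<rho>B :: "vec3 \<Rightarrow> real" and u0 uBdata uB :: "vec3 \<Rightarrow> vec3"
    and \<rho> :: "nat \<Rightarrow> vec3 \<Rightarrow> real" and u v uh vh :: "nat \<Rightarrow> vec3 \<Rightarrow> vec3"
  assumes domain: "polyhedral_lipschitz_domain \<Omega>"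
    and mesh: "tet_mesh \<Omega> \<T>" "h = mesh_size \<T>" "h \<le> c * mesh_inradius \<T>" "face_normals \<Omega> \<T> \<nu>"
    and time: "0 < T" "T = real N * \<tau>"
    and visc: "0 < \<mu>" "0 < lam + 2 / 3 * \<mu>"
    and params: "\<kappa> \<in> {0, 1}" "\<kappa>' \<in> {0, 1}" "0 < \<omega>" "0 < \<eta>"
    and pressure: "\<And>r. 0 \<le> r \<Longrightarrow> (p has_real_derivative p' r) (at r within {0..})"
      "continuous_on {0..} p'" "p 0 = 0" "\<And>r. 0 < r \<Longrightarrow> 0 < p' r"
    and ph: "ph = p_reg p \<kappa>' \<eta> h" and Hh: "Hh = H_reg p \<kappa>' \<eta> h"
    and initial: "continuous_on (closure \<Omega>) r0" "\<And>x. x \<in> closure \<Omega> \<Longrightarrow> 0 < r0 x"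
      "continuous_on (closure \<Omega>) u0"
    and boundary: "C1_closure \<Omega> rBdata" "\<And>x. x \<in> closure \<Omega> \<Longrightarrow> 0 < rBdata x"
      "C2_closure \<Omega> uBdata"
    and discrete_boundary: "\<rho>B = PiQ \<T> rBdata" "is_PiV \<Omega> \<T> uBdata uB"
    and fit: "closure (Gamma_in \<Omega> uBdata) = \<Union>(faces_in \<Omega> \<T> \<nu> uB)"
      "closure (Gamma_out \<Omega> uBdata) = \<Union>(faces_out \<Omega> \<T> \<nu> uB)"
    and sol: "numerical_solution \<Omega> \<T> \<nu> \<tau> N (\<kappa> * h powr \<omega>) \<mu> lam ph r0 u0 \<rho>B uB \<rho> u"
    and v: "v = (\<lambda>k x. u k x - uB x)" and hat: "uh = (\<lambda>k. PiQ \<T> (u k))" "vh = (\<lambda>k. PiQ \<T> (v k))"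
  shows "\<forall>m\<in>{1..N}.
    ((\<forall>K\<in>\<T>. \<forall>x\<in>interior K. 0 < \<rho> m x) \<and>
     integral \<Omega> (\<rho> m)
       + \<tau> * (\<Sum>k=1..m. \<Sum>\<sigma>\<in>faces_out \<Omega> \<T> \<nu> uB.
           surf_int \<sigma> (\<lambda>x. face_trace \<T> \<sigma> (\<rho> k) x * (face_val \<T> uB \<sigma> \<bullet> \<nu> \<sigma>)))
     = integral \<Omega> (\<rho> 0)
       - \<tau> * (\<Sum>k=1..m. \<Sum>\<sigma>\<in>faces_in \<Omega> \<T> \<nu> uB.
           surf_int \<sigma> (\<lambda>x. face_trace \<T> \<sigma> \<rho>B x * (face_val \<T> uB \<sigma> \<bullet> \<nu> \<sigma>))))
    \<and>
    (\<exists>(rbar :: nat \<Rightarrow> vec3 \<Rightarrow> real) (rface :: nat \<Rightarrow> vec3 set \<Rightarrow> real).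
      (\<forall>k\<in>{1..N}. rbar k \<in> Q_space \<T> \<and>
         (\<forall>K\<in>\<T>. elem_val K (rbar k) \<in>
            {min (elem_val K (\<rho> (k - 1))) (elem_val K (\<rho> k)) ..
             max (elem_val K (\<rho> (k - 1))) (elem_val K (\<rho> k))}) \<and>
         (\<forall>\<sigma>\<in>faces_int \<Omega> \<T>. rface k \<sigma> \<in>
            {min (trace_m \<nu> (\<rho> k) \<sigma>) (trace_p \<nu> (\<rho> k) \<sigma>) ..
             max (trace_m \<nu> (\<rho> k) \<sigma>) (trace_p \<nu> (\<rho> k) \<sigma>)})) \<and>
      integral \<Omega> (\<lambda>x. 1/2 * \<rho> m x * (norm (vh m x))\<^sup>2)
      + integral \<Omega> (\<lambda>x. Hh (\<rho> m x))
      + \<tau> * (\<Sum>k=1..m. integral \<Omega> (\<lambda>x. stress \<mu> lam (grad_h (v k) x) \<bullet> grad_h (v k) x))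
      + 1/2 * (\<Sum>k=1..m. integral \<Omega> (\<lambda>x.
          \<rho> (k - 1) x * (norm (vh k x - vh (k - 1) x))\<^sup>2
          + deriv (deriv Hh) (rbar k x) * \<bar>\<rho> k x - \<rho> (k - 1) x\<bar>\<^sup>2))
      + \<tau> / 2 * (\<Sum>k=1..m. \<Sum>\<sigma>\<in>faces_int \<Omega> \<T>.
          surf_int \<sigma> (\<lambda>x. \<bar>Up \<T> \<nu> (\<rho> k) (u k) \<sigma>\<bar> * (norm (jump \<nu> (vh k) \<sigma>))\<^sup>2))
      + \<kappa> * h powr \<omega> * \<tau> * (\<Sum>k=1..m. \<Sum>\<sigma>\<in>faces_int \<Omega> \<T>.
          surf_int \<sigma> (\<lambda>x. jump \<nu> (\<rho> k) \<sigma> * jump \<nu> (\<lambda>y. deriv Hh (\<rho> k y)) \<sigma>))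
      + \<tau> / 2 * (\<Sum>k=1..m. \<Sum>\<sigma>\<in>faces_int \<Omega> \<T>.
          surf_int \<sigma> (\<lambda>x. deriv (deriv Hh) (rface k \<sigma>) * (jump \<nu> (\<rho> k) \<sigma>)\<^sup>2
                           * \<bar>face_val \<T> (u k) \<sigma> \<bullet> \<nu> \<sigma>\<bar>))
      + \<tau> / 2 * (\<Sum>k=1..m. \<Sum>\<sigma>\<in>faces_out \<Omega> \<T> \<nu> uB.
          surf_int \<sigma> (\<lambda>x. face_trace \<T> \<sigma> (\<rho> k) x * (face_val \<T> uB \<sigma> \<bullet> \<nu> \<sigma>)
                           * (norm (face_trace \<T> \<sigma> (vh k) x))\<^sup>2))
      + \<tau> * (\<Sum>k=1..m. \<Sum>\<sigma>\<in>faces_out \<Omega> \<T> \<nu> uB.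
          surf_int \<sigma> (\<lambda>x. Hh (face_trace \<T> \<sigma> (\<rho> k) x) * (face_val \<T> uB \<sigma> \<bullet> \<nu> \<sigma>)))
      + \<tau> * (\<Sum>k=1..m. \<Sum>\<sigma>\<in>faces_in \<Omega> \<T> \<nu> uB.
          surf_int \<sigma> (\<lambda>x. bregman Hh (face_trace \<T> \<sigma> \<rho>B x) (face_trace \<T> \<sigma> (\<rho> k) x)
                           * \<bar>face_val \<T> uB \<sigma> \<bullet> \<nu> \<sigma>\<bar>))
      = integral \<Omega> (\<lambda>x. 1/2 * \<rho> 0 x * (norm (vh 0 x))\<^sup>2 + Hh (\<rho> 0 x))
      + \<tau> * (\<Sum>k=1..m. \<Sum>\<sigma>\<in>faces_in \<Omega> \<T> \<nu> uB.
          surf_int \<sigma> (\<lambda>x. Hh (face_trace \<T> \<sigma> \<rho>B x) * \<bar>face_val \<T> uB \<sigma> \<bullet> \<nu> \<sigma>\<bar>))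
      - \<tau> * (\<Sum>k=1..m. integral \<Omega> (\<lambda>x. stress \<mu> lam (grad_h uB x) \<bullet> grad_h (v k) x))
      - \<tau> * (\<Sum>k=1..m. integral \<Omega> (\<lambda>x. ph (\<rho> k x) * div_h uB x))
      - \<tau> * (\<Sum>k=1..m. integral \<Omega> (\<lambda>x. \<rho> k x * ((grad_h uB x *v uh k x) \<bullet> vh k x)))
      - \<tau> / 2 * (\<Sum>k=1..m. \<Sum>\<sigma>\<in>faces_in \<Omega> \<T> \<nu> uB.
          surf_int \<sigma> (\<lambda>x. face_trace \<T> \<sigma> \<rho>B x * (face_val \<T> uB \<sigma> \<bullet> \<nu> \<sigma>)
                           * (norm (face_trace \<T> \<sigma> (vh k) x))\<^sup>2)))"
proof -

  \<comment> \<open>Positivity and membership in the discrete spaces\<close>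
  interpret tetrahedral_mesh \<Omega> \<T> \<nu>
    using domain mesh by unfold_locales auto
  define \<alpha> where "\<alpha> = \<kappa> * h powr \<omega>"
  have "0 < \<tau>"
    using time by (metis of_nat_0_le_iff zero_less_mult_pos mult_eq_0_iff order_le_less)
  then have \<tau>: "\<tau> \<noteq> 0" by simp
  have Hd: "\<And>r. 0 < r \<Longrightarrow> (Hh has_real_derivative deriv Hh r) (at r)"
    "\<And>r. 0 < r \<Longrightarrow> (deriv Hh has_real_derivative deriv (deriv Hh) r) (at r)"
    "\<And>r. 0 < r \<Longrightarrow> ph r = r * deriv Hh r - Hh r"
    unfolding Hh ph by (rule H_reg_deriv[OF pressure(1)]; assumption)+
  have uBV: "uB \<in> V_space \<Omega> \<T>"
    using discrete_boundary(2) by (simp add: is_PiV_def)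
  have \<rho>0: "\<rho> 0 = PiQ \<T> r0"
    using sol by (simp add: numerical_solution_def)
  have sol_k: "\<rho> k \<in> Q_space \<T>" "\<And>K x. K \<in> \<T> \<Longrightarrow> x \<in> interior K \<Longrightarrow> 0 < \<rho> k x" "u k \<in> V_space \<Omega> \<T>"
    "(\<lambda>x. u k x - uB x) \<in> V0_space \<Omega> \<T>" "continuity_scheme \<Omega> \<T> \<nu> \<tau> \<alpha> \<rho>B uB \<rho> u k"
    "momentum_scheme \<Omega> \<T> \<nu> \<tau> \<alpha> \<mu> lam ph \<rho>B uB \<rho> u k" if "k \<in> {1..N}" for k
    using sol that unfolding numerical_solution_def \<alpha>_def by blast+
  have \<rho>Q: "\<rho> k \<in> Q_space \<T>" if "k \<le> N" for k
    using sol_k(1)[of k] that by (cases "k = 0") (auto simp: \<rho>0 PiQ_in_Q_space)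
  have \<rho>BQ: "\<rho>B \<in> Q_space \<T>"
    unfolding discrete_boundary by (rule PiQ_in_Q_space)
  have vQ: "vh k \<in> Q_space \<T>" "uh k \<in> Q_space \<T>" for k
    unfolding hat by (rule PiQ_in_Q_space)+
  \<comment> \<open>Index 0 is included because the first time step expands the potential between
    the initial and the first density.\<close>
  have pos: "0 < elem_val K (\<rho> k)" if k: "k \<le> N" and K: "K \<in> \<T>" for k K
  proof (cases "k = 0")
    case True
    then show ?thesis
      using elem_mean_pos[OF K initial(1,2)] elem_val_PiQ[OF K, of r0] by (simp add: \<rho>0)
  next
    case False
    obtain x where x: "x \<in> interior K"
      using simplex3_interior[OF mesh_simplex[OF K]] by blast
    then show ?thesis
      using sol_k(2)[of k K x] Q_space_elem_val[OF \<rho>Q[OF k] K x] k K False by simp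
  qed

  \<comment> \<open>Element values and intermediate densities\<close>
  define r where "r = (\<lambda>k K. elem_val K (\<rho> k))"
  define V where "V = (\<lambda>k K. elem_val K (vh k))"
  define W where "W = (\<lambda>k K. elem_val K (uh k))"
  define rB where "rB = (\<lambda>K. elem_val K \<rho>B)"
  define G where "G = (\<lambda>k K. elem_val K (grad_h (u k)))"
  define GB where "GB = (\<lambda>K. elem_val K (grad_h uB))"
  define s where "s = (\<lambda>k \<sigma>. face_val \<T> (u k) \<sigma> \<bullet> \<nu> \<sigma>)"
  define b where "b = (\<lambda>\<sigma>. face_val \<T> uB \<sigma> \<bullet> \<nu> \<sigma>)"
  let ?m = "elem_m" and ?p = "elem_p" and ?I = "faces_int \<Omega> \<T>"
    and ?O = "faces_out \<Omega> \<T> \<nu> uB" and ?B = "faces_in \<Omega> \<T> \<nu> uB"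
  have rpos: "0 < r k K" if "k \<le> N" "K \<in> \<T>" for k K
    unfolding r_def by (rule pos[OF that])
  \<comment> \<open>Expansion at the new density, evaluated at the old one: the implicit step gives
    the remainder the sign of dissipation.\<close>
  have "\<exists>\<xi>. \<xi> \<in> {min (r (k - 1) K) (r k K)..max (r (k - 1) K) (r k K)} \<and>
      deriv Hh (r k K) * (r k K - r (k - 1) K) = Hh (r k K) - Hh (r (k - 1) K)
        + 1/2 * (deriv (deriv Hh) \<xi> * \<bar>r k K - r (k - 1) K\<bar>\<^sup>2)" if "k \<in> {1..N}" "K \<in> \<T>" for k K
  proof -
    have "0 < r (k - 1) K" "0 < r k K"
      using that by (auto intro!: rpos)
    from Taylor_2[OF Hd(1,2) this] obtain \<xi> where "\<xi> \<in> {min (r (k - 1) K) (r k K)..max (r (k - 1) K) (r k K)}"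
      "Hh (r (k - 1) K) = Hh (r k K) + deriv Hh (r k K) * (r (k - 1) K - r k K)
        + deriv (deriv Hh) \<xi> * (r (k - 1) K - r k K)\<^sup>2 / 2" by metis
    then show ?thesis
      by (intro exI[of _ \<xi>]) (simp add: power2_commute algebra_simps)
  qed
  then obtain \<xi> where \<xi>: "\<And>k K. k \<in> {1..N} \<Longrightarrow> K \<in> \<T> \<Longrightarrow>
      \<xi> k K \<in> {min (r (k - 1) K) (r k K)..max (r (k - 1) K) (r k K)}"
    and \<xi>_eq: "\<And>k K. k \<in> {1..N} \<Longrightarrow> K \<in> \<T> \<Longrightarrow> deriv Hh (r k K) * (r k K - r (k - 1) K) =
      Hh (r k K) - Hh (r (k - 1) K) + 1/2 * (deriv (deriv Hh) (\<xi> k K) * \<bar>r k K - r (k - 1) K\<bar>\<^sup>2)"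
    by metis
  have "\<exists>\<zeta>. \<zeta> \<in> {min (r k (?m \<sigma>)) (r k (?p \<sigma>))..max (r k (?m \<sigma>)) (r k (?p \<sigma>))} \<and>
      upw (s k \<sigma>) (r k (?m \<sigma>)) (r k (?p \<sigma>)) * (deriv Hh (r k (?m \<sigma>)) - deriv Hh (r k (?p \<sigma>)))
      - s k \<sigma> * (ph (r k (?m \<sigma>)) - ph (r k (?p \<sigma>))) =
      1/2 * (deriv (deriv Hh) \<zeta> * (r k (?p \<sigma>) - r k (?m \<sigma>))\<^sup>2 * \<bar>s k \<sigma>\<bar>)" if "k \<in> {1..N}" "\<sigma> \<in> ?I" for k \<sigma>
  proof -
    have "0 < r k (?m \<sigma>)" "0 < r k (?p \<sigma>)"
      using that interior_face_elems(1,2)[OF that(2)] by (auto intro!: rpos)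
    from upwind_entropy[OF Hd this] show ?thesis by metis
  qed
  then obtain \<zeta> where \<zeta>: "\<And>k \<sigma>. k \<in> {1..N} \<Longrightarrow> \<sigma> \<in> ?I \<Longrightarrow>
      \<zeta> k \<sigma> \<in> {min (r k (?m \<sigma>)) (r k (?p \<sigma>))..max (r k (?m \<sigma>)) (r k (?p \<sigma>))}"
    and \<zeta>_eq: "\<And>k \<sigma>. k \<in> {1..N} \<Longrightarrow> \<sigma> \<in> ?I \<Longrightarrow>
      upw (s k \<sigma>) (r k (?m \<sigma>)) (r k (?p \<sigma>)) * (deriv Hh (r k (?m \<sigma>)) - deriv Hh (r k (?p \<sigma>)))
      - s k \<sigma> * (ph (r k (?m \<sigma>)) - ph (r k (?p \<sigma>))) =
      1/2 * (deriv (deriv Hh) (\<zeta> k \<sigma>) * (r k (?p \<sigma>) - r k (?m \<sigma>))\<^sup>2 * \<bar>s k \<sigma>\<bar>)"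
    by metis
  \<comment> \<open>Any extension off the open elements would do; this one is zero there.\<close>
  define rbar where "rbar = (\<lambda>k x. \<Sum>K\<in>\<T>. indicator (interior K) x *\<^sub>R \<xi> k K)"
  have rbar: "rbar k x = \<xi> k K" if "K \<in> \<T>" "x \<in> interior K" for k K x
    unfolding rbar_def using sum_indicator_interior[OF that] .
  have rbarQ: "rbar k \<in> Q_space \<T>" for k
    by (rule Q_spaceI[OF rbar])
  have rbar_val: "elem_val K (rbar k) = \<xi> k K" if "K \<in> \<T>" for k K
    by (rule elem_val_mesh[OF that rbar[OF that]])
  have r_val: "\<rho> k x = r k K" if "k \<le> N" "K \<in> \<T>" "x \<in> interior K" for k K x
    unfolding r_def by (rule Q_space_elem_val[OF \<rho>Q[OF that(1)] that(2,3)])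
  have v_val: "vh k x = V k K" if "K \<in> \<T>" "x \<in> interior K" for k K x
    unfolding V_def by (rule Q_space_elem_val[OF vQ(1) that])
  have w_val: "uh k x = W k K" if "K \<in> \<T>" "x \<in> interior K" for k K x
    unfolding W_def by (rule Q_space_elem_val[OF vQ(2) that])
  have cont: "(\<Sum>K\<in>\<T>. measure lebesgue K * ((r k K - r (k - 1) K) / \<tau> * \<phi> K))
      + (\<Sum>\<sigma>\<in>?I. area \<sigma> * (upw (s k \<sigma>) (r k (?m \<sigma>)) (r k (?p \<sigma>)) * (\<phi> (?m \<sigma>) - \<phi> (?p \<sigma>))))
      + (\<Sum>\<sigma>\<in>?O. area \<sigma> * (r k (?m \<sigma>) * b \<sigma> * \<phi> (?m \<sigma>)))
      + (\<Sum>\<sigma>\<in>?B. area \<sigma> * (rB (?m \<sigma>) * b \<sigma> * \<phi> (?m \<sigma>)))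
      + \<alpha> * (\<Sum>\<sigma>\<in>?I. area \<sigma> * ((r k (?p \<sigma>) - r k (?m \<sigma>)) * (\<phi> (?p \<sigma>) - \<phi> (?m \<sigma>)))) = 0"
    if k: "k \<in> {1..N}" for k and \<phi> :: "vec3 set \<Rightarrow> real"
  proof -
    have "k - 1 \<le> N" using k by auto
    show ?thesis
      unfolding r_def rB_def s_def b_def
      by (rule continuity_reduced[OF sol_k(5)[OF k] sol_k(1)[OF k] \<rho>Q[OF \<open>k - 1 \<le> N\<close>] \<rho>BQ])
  qed
  have ext_int: "surf_int \<sigma> (\<lambda>x. f x) = area \<sigma> * d" if "\<sigma> \<in> ?O \<union> ?B" "\<And>x. x \<in> \<sigma> \<Longrightarrow> f x = d" for \<sigma> f and d :: real
    by (rule surf_int_mesh) (use that faces_subsets in auto)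
  have \<rho>_tr: "face_trace \<T> \<sigma> (\<rho> k) x = r k (?m \<sigma>)" if "k \<le> N" "\<sigma> \<in> ?O \<union> ?B" "x \<in> \<sigma>" for k \<sigma> x
    unfolding r_def by (rule face_trace_Q[OF \<rho>Q[OF that(1)]]) (use that faces_subsets in auto)
  have v_tr: "face_trace \<T> \<sigma> (vh k) x = V k (?m \<sigma>)" if "\<sigma> \<in> ?O \<union> ?B" "x \<in> \<sigma>" for k \<sigma> x
    unfolding V_def by (rule face_trace_Q[OF vQ(1)]) (use that faces_subsets in auto)
  have \<rho>B_tr: "face_trace \<T> \<sigma> \<rho>B x = rB (?m \<sigma>)" if "\<sigma> \<in> ?O \<union> ?B" "x \<in> \<sigma>" for \<sigma> x
    unfolding rB_def by (rule face_trace_Q[OF \<rho>BQ]) (use that faces_subsets in auto)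

  \<comment> \<open>Mass balance\<close>
  define fO where "fO = (\<lambda>k. \<Sum>\<sigma>\<in>?O. surf_int \<sigma> (\<lambda>x. face_trace \<T> \<sigma> (\<rho> k) x * (face_val \<T> uB \<sigma> \<bullet> \<nu> \<sigma>)))"
  define fB where "fB = (\<lambda>k::nat. \<Sum>\<sigma>\<in>?B. surf_int \<sigma> (\<lambda>x. face_trace \<T> \<sigma> \<rho>B x * (face_val \<T> uB \<sigma> \<bullet> \<nu> \<sigma>)))"
  have mass_step: "integral \<Omega> (\<rho> k) + \<tau> * fO k = integral \<Omega> (\<rho> (k - 1)) - \<tau> * fB k" if k: "k \<in> {1..N}" for k
  proof -
    have kN: "k \<le> N" "k - 1 \<le> N" using k by auto
    have I: "integral \<Omega> (\<rho> j) = (\<Sum>K\<in>\<T>. measure lebesgue K * r j K)" if "j \<le> N" for j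
      by (rule integral_piecewise[OF r_val[OF that]])
    have O: "fO k = (\<Sum>\<sigma>\<in>?O. area \<sigma> * (r k (?m \<sigma>) * b \<sigma>))"
      unfolding fO_def by (intro sum.cong refl ext_int) (simp_all add: \<rho>_tr kN b_def)
    have B: "fB k = (\<Sum>\<sigma>\<in>?B. area \<sigma> * (rB (?m \<sigma>) * b \<sigma>))"
      unfolding fB_def by (intro sum.cong refl ext_int) (simp_all add: \<rho>B_tr b_def)
    have "(\<Sum>K\<in>\<T>. measure lebesgue K * ((r k K - r (k - 1) K) / \<tau> * 1)) =
        (integral \<Omega> (\<rho> k) - integral \<Omega> (\<rho> (k - 1))) / \<tau>"
      unfolding I[OF kN(1)] I[OF kN(2)] sum_subtractf[symmetric] sum_divide_distrib
      by (intro sum.cong refl) (simp add: right_diff_distrib)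
    \<comment> \<open>For the constant test function the interior flux and diffusion sums vanish,
      since they contain differences across faces.\<close>
    then have "(integral \<Omega> (\<rho> k) - integral \<Omega> (\<rho> (k - 1))) / \<tau> + fO k + fB k = 0"
      using cont[OF k, of "\<lambda>_. 1"] unfolding O B by simp
    then show ?thesis
      using \<tau> by (simp add: field_simps)
  qed
  have mass: "integral \<Omega> (\<rho> m) + \<tau> * (\<Sum>k=1..m. fO k) = integral \<Omega> (\<rho> 0) - \<tau> * (\<Sum>k=1..m. fB k)" if "m \<le> N" for m
    using that
  proof (induction m)
    case 0
    then show ?case by simp
  next
    case (Suc m)
    then show ?case
      using mass_step[of "Suc m"] by (simp add: sum.cl_ivl_Suc ring_distribs)
  qed

  \<comment> \<open>Energy balance: terms of one time level, one step, summation in time\<close>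
  define E where "E = (\<lambda>k. integral \<Omega> (\<lambda>x. 1/2 * \<rho> k x * (norm (vh k x))\<^sup>2) + integral \<Omega> (\<lambda>x. Hh (\<rho> k x)))"
  define a1 where "a1 = (\<lambda>k. integral \<Omega> (\<lambda>x. stress \<mu> lam (grad_h (v k) x) \<bullet> grad_h (v k) x))"
  define a2 where "a2 = (\<lambda>k. integral \<Omega> (\<lambda>x. \<rho> (k - 1) x * (norm (vh k x - vh (k - 1) x))\<^sup>2
      + deriv (deriv Hh) (rbar k x) * \<bar>\<rho> k x - \<rho> (k - 1) x\<bar>\<^sup>2))"
  define a3 where "a3 = (\<lambda>k. \<Sum>\<sigma>\<in>?I. surf_int \<sigma> (\<lambda>x. \<bar>Up \<T> \<nu> (\<rho> k) (u k) \<sigma>\<bar> * (norm (jump \<nu> (vh k) \<sigma>))\<^sup>2))"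
  define a4 where "a4 = (\<lambda>k. \<Sum>\<sigma>\<in>?I. surf_int \<sigma> (\<lambda>x. jump \<nu> (\<rho> k) \<sigma> * jump \<nu> (\<lambda>y. deriv Hh (\<rho> k y)) \<sigma>))"
  define a5 where "a5 = (\<lambda>k. \<Sum>\<sigma>\<in>?I. surf_int \<sigma> (\<lambda>x. deriv (deriv Hh) (\<zeta> k \<sigma>) * (jump \<nu> (\<rho> k) \<sigma>)\<^sup>2
      * \<bar>face_val \<T> (u k) \<sigma> \<bullet> \<nu> \<sigma>\<bar>))"
  define a6 where "a6 = (\<lambda>k. \<Sum>\<sigma>\<in>?O. surf_int \<sigma> (\<lambda>x. face_trace \<T> \<sigma> (\<rho> k) x * (face_val \<T> uB \<sigma> \<bullet> \<nu> \<sigma>)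
      * (norm (face_trace \<T> \<sigma> (vh k) x))\<^sup>2))"
  define a7 where "a7 = (\<lambda>k. \<Sum>\<sigma>\<in>?O. surf_int \<sigma> (\<lambda>x. Hh (face_trace \<T> \<sigma> (\<rho> k) x) * (face_val \<T> uB \<sigma> \<bullet> \<nu> \<sigma>)))"
  define a8 where "a8 = (\<lambda>k. \<Sum>\<sigma>\<in>?B. surf_int \<sigma> (\<lambda>x. bregman Hh (face_trace \<T> \<sigma> \<rho>B x) (face_trace \<T> \<sigma> (\<rho> k) x)
      * \<bar>face_val \<T> uB \<sigma> \<bullet> \<nu> \<sigma>\<bar>))"
  define b1 where "b1 = (\<lambda>k::nat. \<Sum>\<sigma>\<in>?B. surf_int \<sigma> (\<lambda>x. Hh (face_trace \<T> \<sigma> \<rho>B x) * \<bar>face_val \<T> uB \<sigma> \<bullet> \<nu> \<sigma>\<bar>))"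
  define b2 where "b2 = (\<lambda>k. integral \<Omega> (\<lambda>x. stress \<mu> lam (grad_h uB x) \<bullet> grad_h (v k) x))"
  define b3 where "b3 = (\<lambda>k. integral \<Omega> (\<lambda>x. ph (\<rho> k x) * div_h uB x))"
  define b4 where "b4 = (\<lambda>k. integral \<Omega> (\<lambda>x. \<rho> k x * ((grad_h uB x *v uh k x) \<bullet> vh k x)))"
  define b5 where "b5 = (\<lambda>k. \<Sum>\<sigma>\<in>?B. surf_int \<sigma> (\<lambda>x. face_trace \<T> \<sigma> \<rho>B x * (face_val \<T> uB \<sigma> \<bullet> \<nu> \<sigma>)
      * (norm (face_trace \<T> \<sigma> (vh k) x))\<^sup>2))"

  have E_sum: "E k = (\<Sum>K\<in>\<T>. measure lebesgue K * (1/2 * r k K * (norm (V k K))\<^sup>2)) + (\<Sum>K\<in>\<T>. measure lebesgue K * Hh (r k K))"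
    if "k \<le> N" for k
    unfolding E_def by (intro arg_cong2[of _ _ _ _ "(+)"] integral_piecewise) (simp_all add: r_val[OF that] v_val)
  have E_0: "E 0 = integral \<Omega> (\<lambda>x. 1/2 * \<rho> 0 x * (norm (vh 0 x))\<^sup>2 + Hh (\<rho> 0 x))"
  proof -
    have "integral \<Omega> (\<lambda>x. 1/2 * \<rho> 0 x * (norm (vh 0 x))\<^sup>2 + Hh (\<rho> 0 x)) =
        (\<Sum>K\<in>\<T>. measure lebesgue K * (1/2 * r 0 K * (norm (V 0 K))\<^sup>2 + Hh (r 0 K)))"
      by (rule integral_piecewise) (simp add: r_val v_val)
    then show ?thesis
      by (simp add: E_sum distrib_left sum.distrib)
  qed
  have step: "E k - E (k - 1) + \<tau> * a1 k + 1/2 * a2 k + \<tau> / 2 * a3 k + \<alpha> * \<tau> * a4 k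
      + \<tau> / 2 * a5 k + \<tau> / 2 * a6 k + \<tau> * a7 k + \<tau> * a8 k =
    \<tau> * b1 k - \<tau> * b2 k - \<tau> * b3 k - \<tau> * b4 k - \<tau> / 2 * b5 k" if k: "k \<in> {1..N}" for k
  proof -
    have kN: "k \<le> N" "k - 1 \<le> N" using k by auto
    note rk = r_val[OF kN(1)] and rk' = r_val[OF kN(2)]
    have gB: "grad_h uB x = GB K" if "K \<in> \<T>" "x \<in> interior K" for K x
      using Q_space_elem_val[OF grad_h_in_Q_space[OF uBV] that] by (simp add: GB_def)
    have gv: "grad_h (v k) x = G k K - GB K" if "K \<in> \<T>" "x \<in> interior K" for K x
      using V_space_diff(1)[OF sol_k(3)[OF k] uBV that] by (simp add: v G_def GB_def)
    have A1: "a1 k = (\<Sum>K\<in>\<T>. measure lebesgue K * (stress \<mu> lam (G k K - GB K) \<bullet> (G k K - GB K)))"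
      unfolding a1_def by (rule integral_piecewise) (simp only: gv)
    have A2: "a2 k = (\<Sum>K\<in>\<T>. measure lebesgue K * (r (k - 1) K * (norm (V k K - V (k - 1) K))\<^sup>2
        + deriv (deriv Hh) (\<xi> k K) * \<bar>r k K - r (k - 1) K\<bar>\<^sup>2))"
      unfolding a2_def by (rule integral_piecewise) (simp only: rk rk' v_val rbar)
    have jump_r: "jump \<nu> (\<rho> k) \<sigma> = r k (?p \<sigma>) - r k (?m \<sigma>)" if "\<sigma> \<in> ?I" for \<sigma>
      unfolding jump_def trace_Q[OF \<rho>Q[OF kN(1)] that] r_def ..
    have jump_v: "jump \<nu> (vh k) \<sigma> = V k (?p \<sigma>) - V k (?m \<sigma>)" if "\<sigma> \<in> ?I" for \<sigma>
      unfolding jump_def trace_Q[OF vQ(1) that] V_def ..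
    have jump_H: "jump \<nu> (\<lambda>y. deriv Hh (\<rho> k y)) \<sigma> = deriv Hh (r k (?p \<sigma>)) - deriv Hh (r k (?m \<sigma>))" if \<sigma>: "\<sigma> \<in> ?I" for \<sigma>
    proof -
      have "trace_p \<nu> (\<lambda>y. deriv Hh (\<rho> k y)) \<sigma> = deriv Hh (r k (?p \<sigma>))"
        by (rule trace_p_eq[OF \<sigma>]) (simp add: rk[OF interior_face_elems(2)[OF \<sigma>, THEN conjunct1]])
      moreover have "trace_m \<nu> (\<lambda>y. deriv Hh (\<rho> k y)) \<sigma> = deriv Hh (r k (?m \<sigma>))"
        by (rule trace_m_eq[OF \<sigma>]) (simp add: rk[OF interior_face_elems(1)[OF \<sigma>, THEN conjunct1]])
      ultimately show ?thesis by (simp add: jump_def)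
    qed
    have Up: "Up \<T> \<nu> (\<rho> k) (u k) \<sigma> = upw (s k \<sigma>) (r k (?m \<sigma>)) (r k (?p \<sigma>))" if "\<sigma> \<in> ?I" for \<sigma>
      unfolding Up_eq_upw[OF \<rho>Q[OF kN(1)] that] s_def r_def ..
    have A3: "a3 k = (\<Sum>\<sigma>\<in>?I. area \<sigma> * (\<bar>upw (s k \<sigma>) (r k (?m \<sigma>)) (r k (?p \<sigma>))\<bar> * (norm (V k (?p \<sigma>) - V k (?m \<sigma>)))\<^sup>2))"
      unfolding a3_def by (intro sum.cong refl surf_int_mesh faces_subsets(1)) (simp_all only: Up jump_v)
    have A4: "a4 k = (\<Sum>\<sigma>\<in>?I. area \<sigma> * ((r k (?p \<sigma>) - r k (?m \<sigma>)) * (deriv Hh (r k (?p \<sigma>)) - deriv Hh (r k (?m \<sigma>)))))"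
      unfolding a4_def by (intro sum.cong refl surf_int_mesh faces_subsets(1)) (simp_all only: jump_r jump_H)
    have A5: "a5 k = (\<Sum>\<sigma>\<in>?I. area \<sigma> * (deriv (deriv Hh) (\<zeta> k \<sigma>) * (r k (?p \<sigma>) - r k (?m \<sigma>))\<^sup>2 * \<bar>s k \<sigma>\<bar>))"
      unfolding a5_def by (intro sum.cong refl surf_int_mesh faces_subsets(1)) (simp_all only: jump_r s_def)
    have A6: "a6 k = (\<Sum>\<sigma>\<in>?O. area \<sigma> * (r k (?m \<sigma>) * b \<sigma> * (norm (V k (?m \<sigma>)))\<^sup>2))"
      unfolding a6_def by (intro sum.cong refl ext_int) (simp_all add: \<rho>_tr kN v_tr b_def)
    have A7: "a7 k = (\<Sum>\<sigma>\<in>?O. area \<sigma> * (Hh (r k (?m \<sigma>)) * b \<sigma>))"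
      unfolding a7_def by (intro sum.cong refl ext_int) (simp_all add: \<rho>_tr kN b_def)
    have A8: "a8 k = (\<Sum>\<sigma>\<in>?B. area \<sigma> * ((Hh (rB (?m \<sigma>)) - deriv Hh (r k (?m \<sigma>)) * (rB (?m \<sigma>) - r k (?m \<sigma>)) - Hh (r k (?m \<sigma>))) * \<bar>b \<sigma>\<bar>))"
      unfolding a8_def by (intro sum.cong refl ext_int) (simp_all add: \<rho>_tr \<rho>B_tr kN b_def bregman_def)
    have B1: "b1 k = (\<Sum>\<sigma>\<in>?B. area \<sigma> * (Hh (rB (?m \<sigma>)) * \<bar>b \<sigma>\<bar>))"
      unfolding b1_def by (intro sum.cong refl ext_int) (simp_all add: \<rho>B_tr b_def)
    have B2: "b2 k = (\<Sum>K\<in>\<T>. measure lebesgue K * (stress \<mu> lam (GB K) \<bullet> (G k K - GB K)))"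
      unfolding b2_def by (rule integral_piecewise) (simp only: gv gB)
    have B3: "b3 k = (\<Sum>K\<in>\<T>. measure lebesgue K * (ph (r k K) * trace (GB K)))"
      unfolding b3_def div_h_def by (rule integral_piecewise) (simp only: rk gB)
    have B4: "b4 k = (\<Sum>K\<in>\<T>. measure lebesgue K * (r k K * ((GB K *v W k K) \<bullet> V k K)))"
      unfolding b4_def by (rule integral_piecewise) (simp only: rk gB v_val w_val)
    have B5: "b5 k = (\<Sum>\<sigma>\<in>?B. area \<sigma> * (rB (?m \<sigma>) * b \<sigma> * (norm (V k (?m \<sigma>)))\<^sup>2))"
      unfolding b5_def by (intro sum.cong refl ext_int) (simp_all add: \<rho>B_tr v_tr b_def)
    note mom = momentum_reduced[OF sol_k(6)[OF k] \<rho>Q[OF kN(1)] \<rho>Q[OF kN(2)] \<rho>BQ sol_k(3)[OF k] uBV sol_k(4)[OF k]]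
    note div = pressure_divergence[OF sol_k(3)[OF k] uBV sol_k(4)[OF k], of "\<lambda>K. ph (r k K)"]
    have hats: "PiQ \<T> (\<lambda>x. u j x - uB x) = vh j" "PiQ \<T> (u j) = uh j" for j
      by (simp_all add: hat v)
    have "(\<Sum>K\<in>\<T>. measure lebesgue K * (1/2 * r k K * (norm (V k K))\<^sup>2)) + (\<Sum>K\<in>\<T>. measure lebesgue K * Hh (r k K))
      - (\<Sum>K\<in>\<T>. measure lebesgue K * (1/2 * r (k - 1) K * (norm (V (k - 1) K))\<^sup>2)) - (\<Sum>K\<in>\<T>. measure lebesgue K * Hh (r (k - 1) K))
      + \<tau> * a1 k + 1/2 * a2 k + \<tau> / 2 * a3 k + \<alpha> * \<tau> * a4 k + \<tau> / 2 * a5 k + \<tau> / 2 * a6 k + \<tau> * a7 k + \<tau> * a8 k =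
      \<tau> * b1 k - \<tau> * b2 k - \<tau> * b3 k - \<tau> * b4 k - \<tau> / 2 * b5 k"
      unfolding A1 A2 A3 A4 A5 A6 A7 A8 B1 B2 B3 B4 B5
    proof (rule energy_step_identity[OF \<tau>])
      show "\<sigma> \<in> ?I \<Longrightarrow> ?m \<sigma> \<in> \<T> \<and> ?p \<sigma> \<in> \<T>" "\<sigma> \<in> ?O \<union> ?B \<Longrightarrow> ?m \<sigma> \<in> \<T>" for \<sigma>
        using interior_face_elems exterior_face_elem faces_subsets by blast+
      show "K \<in> \<T> \<Longrightarrow> 0 < r k K" for K
        by (rule rpos[OF kN(1)])
      show "0 < x \<Longrightarrow> ph x = x * deriv Hh x - Hh x" for x
        by (rule Hd(3))
      show "\<sigma> \<in> ?B \<Longrightarrow> b \<sigma> < 0" for \<sigma>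
        by (simp add: b_def faces_in_def)
      show "K \<in> \<T> \<Longrightarrow> deriv Hh (r k K) * (r k K - r (k - 1) K) =
          Hh (r k K) - Hh (r (k - 1) K) + 1/2 * (deriv (deriv Hh) (\<xi> k K) * \<bar>r k K - r (k - 1) K\<bar>\<^sup>2)" for K
        by (rule \<xi>_eq[OF k])
      show "\<sigma> \<in> ?I \<Longrightarrow> upw (s k \<sigma>) (r k (?m \<sigma>)) (r k (?p \<sigma>)) * (deriv Hh (r k (?m \<sigma>)) - deriv Hh (r k (?p \<sigma>)))
          - s k \<sigma> * (ph (r k (?m \<sigma>)) - ph (r k (?p \<sigma>))) =
          1/2 * (deriv (deriv Hh) (\<zeta> k \<sigma>) * (r k (?p \<sigma>) - r k (?m \<sigma>))\<^sup>2 * \<bar>s k \<sigma>\<bar>)" for \<sigma>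
        by (rule \<zeta>_eq[OF k])
      show "(\<Sum>K\<in>\<T>. measure lebesgue K * ((r k K - r (k - 1) K) / \<tau> * \<phi> K))
          + (\<Sum>\<sigma>\<in>?I. area \<sigma> * (upw (s k \<sigma>) (r k (?m \<sigma>)) (r k (?p \<sigma>)) * (\<phi> (?m \<sigma>) - \<phi> (?p \<sigma>))))
          + (\<Sum>\<sigma>\<in>?O. area \<sigma> * (r k (?m \<sigma>) * b \<sigma> * \<phi> (?m \<sigma>)))
          + (\<Sum>\<sigma>\<in>?B. area \<sigma> * (rB (?m \<sigma>) * b \<sigma> * \<phi> (?m \<sigma>)))
          + \<alpha> * (\<Sum>\<sigma>\<in>?I. area \<sigma> * ((r k (?p \<sigma>) - r k (?m \<sigma>)) * (\<phi> (?p \<sigma>) - \<phi> (?m \<sigma>)))) = 0" for \<phi>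
        by (rule cont[OF k])
      show "(\<Sum>K\<in>\<T>. measure lebesgue K * (((r k K *\<^sub>R V k K - r (k - 1) K *\<^sub>R V (k - 1) K) /\<^sub>R \<tau>) \<bullet> V k K))
          + (\<Sum>\<sigma>\<in>?I. area \<sigma> * (upw (s k \<sigma>) (r k (?m \<sigma>) *\<^sub>R V k (?m \<sigma>)) (r k (?p \<sigma>) *\<^sub>R V k (?p \<sigma>)) \<bullet> (V k (?m \<sigma>) - V k (?p \<sigma>))))
          + (\<Sum>K\<in>\<T>. measure lebesgue K * (r k K * ((GB K *v W k K) \<bullet> V k K)))
          + (\<Sum>\<sigma>\<in>?O. area \<sigma> * (r k (?m \<sigma>) * b \<sigma> * (norm (V k (?m \<sigma>)))\<^sup>2))
          + (\<Sum>\<sigma>\<in>?B. area \<sigma> * (rB (?m \<sigma>) * b \<sigma> * (norm (V k (?m \<sigma>)))\<^sup>2))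
          + (\<Sum>K\<in>\<T>. measure lebesgue K * (stress \<mu> lam (G k K - GB K) \<bullet> (G k K - GB K) + stress \<mu> lam (GB K) \<bullet> (G k K - GB K)
              - ph (r k K) * (trace (G k K) - trace (GB K))))
          + \<alpha> * (\<Sum>\<sigma>\<in>?I. area \<sigma> * ((r k (?p \<sigma>) - r k (?m \<sigma>)) * (((1/2) *\<^sub>R (V k (?p \<sigma>) + V k (?m \<sigma>))) \<bullet> (V k (?p \<sigma>) - V k (?m \<sigma>))))) = 0"
        using mom unfolding hats r_def rB_def s_def b_def V_def W_def G_def GB_def .
      show "(\<Sum>K\<in>\<T>. measure lebesgue K * (ph (r k K) * trace (G k K))) =
          (\<Sum>\<sigma>\<in>?I. area \<sigma> * (s k \<sigma> * (ph (r k (?m \<sigma>)) - ph (r k (?p \<sigma>)))))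
          + (\<Sum>\<sigma>\<in>?O. area \<sigma> * (b \<sigma> * ph (r k (?m \<sigma>)))) + (\<Sum>\<sigma>\<in>?B. area \<sigma> * (b \<sigma> * ph (r k (?m \<sigma>))))"
        using div unfolding G_def s_def b_def .
    qed
    then show ?thesis
      unfolding E_sum[OF kN(1)] E_sum[OF kN(2)] by linarith
  qed
  have energy: "E m + \<tau> * (\<Sum>k=1..m. a1 k) + 1/2 * (\<Sum>k=1..m. a2 k) + \<tau> / 2 * (\<Sum>k=1..m. a3 k)
      + \<alpha> * \<tau> * (\<Sum>k=1..m. a4 k) + \<tau> / 2 * (\<Sum>k=1..m. a5 k) + \<tau> / 2 * (\<Sum>k=1..m. a6 k)
      + \<tau> * (\<Sum>k=1..m. a7 k) + \<tau> * (\<Sum>k=1..m. a8 k) =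
    integral \<Omega> (\<lambda>x. 1/2 * \<rho> 0 x * (norm (vh 0 x))\<^sup>2 + Hh (\<rho> 0 x))
      + \<tau> * (\<Sum>k=1..m. b1 k) - \<tau> * (\<Sum>k=1..m. b2 k) - \<tau> * (\<Sum>k=1..m. b3 k) - \<tau> * (\<Sum>k=1..m. b4 k)
      - \<tau> / 2 * (\<Sum>k=1..m. b5 k)" if "m \<le> N" for m
    unfolding E_0[symmetric] by (rule telescope_energy[OF _ that]) (rule step)
  have bounds: "\<forall>k\<in>{1..N}. rbar k \<in> Q_space \<T> \<and>
       (\<forall>K\<in>\<T>. elem_val K (rbar k) \<in>
          {min (elem_val K (\<rho> (k - 1))) (elem_val K (\<rho> k)) ..
           max (elem_val K (\<rho> (k - 1))) (elem_val K (\<rho> k))}) \<and>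
       (\<forall>\<sigma>\<in>?I. \<zeta> k \<sigma> \<in>
          {min (trace_m \<nu> (\<rho> k) \<sigma>) (trace_p \<nu> (\<rho> k) \<sigma>) ..
           max (trace_m \<nu> (\<rho> k) \<sigma>) (trace_p \<nu> (\<rho> k) \<sigma>)})"
  proof (intro ballI conjI)
    fix k assume k: "k \<in> {1..N}"
    show "rbar k \<in> Q_space \<T>" by (rule rbarQ)
    show "elem_val K (rbar k) \<in>
          {min (elem_val K (\<rho> (k - 1))) (elem_val K (\<rho> k)) ..
           max (elem_val K (\<rho> (k - 1))) (elem_val K (\<rho> k))}" if "K \<in> \<T>" for K
      using \<xi>[OF k that] unfolding rbar_val[OF that] r_def .
    show "\<zeta> k \<sigma> \<in> {min (trace_m \<nu> (\<rho> k) \<sigma>) (trace_p \<nu> (\<rho> k) \<sigma>) ..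
           max (trace_m \<nu> (\<rho> k) \<sigma>) (trace_p \<nu> (\<rho> k) \<sigma>)}" if "\<sigma> \<in> ?I" for \<sigma>
      using \<zeta>[OF k that] unfolding trace_Q[OF sol_k(1)[OF k] that] r_def .
  qed
  show ?thesis
  proof (rule ballI, rule conjI, rule conjI, goal_cases)
    case (1 m)
    then show ?case using sol_k(2) by blast
  next
    case (2 m)
    then have "m \<le> N" by simp
    from mass[OF this] show ?case
      unfolding fO_def fB_def .
  next
    case (3 m)
    then have "m \<le> N" by simp
    note balance = energy[OF this]
    show ?case
      \<comment> \<open>The intermediate densities were chosen for all time levels at once, so the
        same witnesses serve every \<open>m\<close>.\<close>
      by (rule exI[of _ rbar], rule exI[of _ \<zeta>], rule conjI[OF bounds])
        (rule balance[unfolded E_def a1_def a2_def a3_def a4_def a5_def a6_def a7_def a8_def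
          b1_def b2_def b3_def b4_def b5_def \<alpha>_def])
  qed
qed

end
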